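(* Let $I$ be any inner function with $I(0)=0$, and set $a=(1-I)/2$ and $b=(1+I)/2$. Then $$\mathscr{H}(b)=\mathscr{M}(a)\oplus_b K_I .$$
   Context: $H^2$ is the Hardy space of the open unit disk with $\langle f,g\rangle_{H^2}=\int_{\mathbb{T}}f\overline{g}\,dm$ ($m$ normalized Lebesgue measure on the unit circle $\mathbb{T}$). For $\varphi\in L^\infty(\mathbb{T})$, $T_\varphi f=P_+(\varphi f)$ on $H^2$, with $P_+:L^2\to H^2$ the orthogonal projection. $\mathscr{M}(a):=aH^2$ and $K_I:=H^2\ominus IH^2$. For $b$ in the closed unit ball of $H^\infty$, the de Branges--Rovnyak space is $\mathscr{H}(b):=AH^2$ with $A=(\mathrm{Id}-T_bT_{\overline{b}})^{1/2}$ ($\mathrm{Id}$ the identity operator), with inner product $\langle Af,Ag\rangle_b:=\langle f,g\rangle_{H^2}$ for $f,g\in H^2\ominus\ker A$. $\oplus_b$ denotes the orthogonal direct sum with respect to $\langle\cdot,\cdot\rangle_b$. *)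

theory Defs
  imports "HOL-Analysis.Analysis"
begin

text \<open>
  Functions on the disk and functions on the circle both have type
  \<^typ>\<open>complex \<Rightarrow> complex\<close>; the passage from the disk to the circle is always made
  explicitly by taking radial limits.
\<close>

text \<open>Normalized arc length, as a probability measure whose space is the unit circle itself.\<close>

definition circle_measure :: "complex measure" where
  "circle_measure =
     distr (uniform_measure lborel {0..2 * pi}) (restrict_space borel (sphere 0 1)) cis"

definition circle_inner :: "(complex \<Rightarrow> complex) \<Rightarrow> (complex \<Rightarrow> complex) \<Rightarrow> complex" where
  "circle_inner g h = (\<integral>\<zeta>. g \<zeta> * cnj (h \<zeta>) \<partial>circle_measure)"

text \<open>
  For the functions used here the limit exists for almost every \<open>\<zeta>\<close> on the circle
  (Fatou's theorem).
\<close>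

definition radial_limit :: "(complex \<Rightarrow> complex) \<Rightarrow> complex \<Rightarrow> complex" where
  "radial_limit f \<zeta> = Lim (at_left 1) (\<lambda>r::real. f (of_real r * \<zeta>))"

text \<open>
  The Hardy space of the disk. Its elements are extended by 0 off the disk, so that two of them
  agree on the disk if and only if they are equal in HOL.
\<close>

definition H2 :: "(complex \<Rightarrow> complex) set" where
  "H2 = {f. f holomorphic_on ball 0 1 \<and> (\<forall>z. z \<notin> ball 0 1 \<longrightarrow> f z = 0) \<and>
        bdd_above ((\<lambda>r::real. \<integral>\<zeta>. (norm (f (of_real r * \<zeta>)))\<^sup>2 \<partial>circle_measure) ` {0..<1})}"

definition H2_inner :: "(complex \<Rightarrow> complex) \<Rightarrow> (complex \<Rightarrow> complex) \<Rightarrow> complex" where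
  "H2_inner f g = circle_inner (radial_limit f) (radial_limit g)"

definition H2_norm :: "(complex \<Rightarrow> complex) \<Rightarrow> real" where
  "H2_norm f = sqrt (Re (H2_inner f f))"

definition H2_ominus :: "(complex \<Rightarrow> complex) set \<Rightarrow> (complex \<Rightarrow> complex) set" where
  "H2_ominus S = {f \<in> H2. \<forall>g\<in>S. H2_inner f g = 0}"

definition inner_function :: "(complex \<Rightarrow> complex) \<Rightarrow> bool" where
  "inner_function I \<longleftrightarrow>
     I holomorphic_on ball 0 1 \<and> bounded (I ` ball 0 1) \<and>
     (AE \<zeta> in circle_measure.
        \<exists>l. ((\<lambda>r::real. I (of_real r * \<zeta>)) \<longlongrightarrow> l) (at_left 1) \<and> norm l = 1)"

definition mult_range :: "(complex \<Rightarrow> complex) \<Rightarrow> (complex \<Rightarrow> complex) set" where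
  "mult_range a = (\<lambda>f z. a z * f z) ` H2"

definition model_space :: "(complex \<Rightarrow> complex) \<Rightarrow> (complex \<Rightarrow> complex) set" where
  "model_space I = H2_ominus (mult_range I)"

text \<open>
  The orthogonal projection of \<open>L\<^sup>2\<close> of the circle onto \<^const>\<open>H2\<close>: the value at \<open>g\<close> is the
  element \<open>h\<close> of \<^const>\<open>H2\<close> for which \<open>g\<close> minus the boundary function of \<open>h\<close> is
  orthogonal to the boundary functions of \<^const>\<open>H2\<close>.
\<close>

definition P_plus :: "(complex \<Rightarrow> complex) \<Rightarrow> complex \<Rightarrow> complex" where
  "P_plus g = (THE h. h \<in> H2 \<and>
     (\<forall>f\<in>H2. circle_inner (\<lambda>\<zeta>. g \<zeta> - radial_limit h \<zeta>) (radial_limit f) = 0))"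

text \<open>The symbol \<open>\<phi>\<close> is a (bounded measurable) function on the circle.\<close>

definition toeplitz ::
  "(complex \<Rightarrow> complex) \<Rightarrow> (complex \<Rightarrow> complex) \<Rightarrow> complex \<Rightarrow> complex" where
  "toeplitz \<phi> f = P_plus (\<lambda>\<zeta>. \<phi> \<zeta> * radial_limit f \<zeta>)"

definition H2_bounded_operator ::
  "((complex \<Rightarrow> complex) \<Rightarrow> complex \<Rightarrow> complex) \<Rightarrow> bool" where
  "H2_bounded_operator A \<longleftrightarrow>
     A \<in> H2 \<rightarrow> H2 \<and>
     (\<forall>f\<in>H2. \<forall>g\<in>H2. A (\<lambda>z. f z + g z) = (\<lambda>z. A f z + A g z)) \<and>
     (\<forall>c. \<forall>f\<in>H2. A (\<lambda>z. c * f z) = (\<lambda>z. c * A f z)) \<and>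
     (\<exists>C. \<forall>f\<in>H2. H2_norm (A f) \<le> C * H2_norm f)"

definition H2_positive_operator ::
  "((complex \<Rightarrow> complex) \<Rightarrow> complex \<Rightarrow> complex) \<Rightarrow> bool" where
  "H2_positive_operator A \<longleftrightarrow>
     H2_bounded_operator A \<and> (\<forall>f\<in>H2. H2_inner (A f) f \<in> \<real>\<^sub>\<ge>\<^sub>0)"

text \<open>
  The positive square root of a positive operator is unique as an operator on \<^const>\<open>H2\<close>; the
  choice below only concerns the irrelevant values outside \<^const>\<open>H2\<close>.
\<close>

definition H2_operator_sqrt ::
  "((complex \<Rightarrow> complex) \<Rightarrow> complex \<Rightarrow> complex) \<Rightarrow> (complex \<Rightarrow> complex) \<Rightarrow> complex \<Rightarrow> complex"
  where
  "H2_operator_sqrt T = (SOME A. H2_positive_operator A \<and> (\<forall>f\<in>H2. A (A f) = T f))"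

definition dBR_operator ::
  "(complex \<Rightarrow> complex) \<Rightarrow> (complex \<Rightarrow> complex) \<Rightarrow> complex \<Rightarrow> complex" where
  "dBR_operator b = H2_operator_sqrt
     (\<lambda>f z. f z - toeplitz (radial_limit b) (toeplitz (\<lambda>\<zeta>. cnj (radial_limit b \<zeta>)) f) z)"

text \<open>
  The de Branges--Rovnyak space, for \<open>b\<close> holomorphic on the disk with \<open>\<bar>b\<bar> \<le> 1\<close> there.
\<close>

definition dBR_space :: "(complex \<Rightarrow> complex) \<Rightarrow> (complex \<Rightarrow> complex) set" where
  "dBR_space b = dBR_operator b ` H2"

definition dBR_kernel :: "(complex \<Rightarrow> complex) \<Rightarrow> (complex \<Rightarrow> complex) set" where
  "dBR_kernel b = {f \<in> H2. dBR_operator b f = (\<lambda>z. 0)}"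

definition dBR_preimage :: "(complex \<Rightarrow> complex) \<Rightarrow> (complex \<Rightarrow> complex) \<Rightarrow> complex \<Rightarrow> complex" where
  "dBR_preimage b u = (THE f. f \<in> H2_ominus (dBR_kernel b) \<and> dBR_operator b f = u)"

definition dBR_inner ::
  "(complex \<Rightarrow> complex) \<Rightarrow> (complex \<Rightarrow> complex) \<Rightarrow> (complex \<Rightarrow> complex) \<Rightarrow> complex" where
  "dBR_inner b u v = H2_inner (dBR_preimage b u) (dBR_preimage b v)"

definition orthogonal_direct_sum ::
  "((complex \<Rightarrow> complex) \<Rightarrow> (complex \<Rightarrow> complex) \<Rightarrow> complex) \<Rightarrow>
   (complex \<Rightarrow> complex) set \<Rightarrow> (complex \<Rightarrow> complex) set \<Rightarrow> (complex \<Rightarrow> complex) set \<Rightarrow> bool"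
  where
  "orthogonal_direct_sum ip H U V \<longleftrightarrow>
     H = {(\<lambda>z. u z + v z) | u v. u \<in> U \<and> v \<in> V} \<and>
     U \<inter> V = {\<lambda>z. 0} \<and>
     (\<forall>u\<in>U. \<forall>v\<in>V. ip u v = 0)"

end

theory Submission
  imports Defs "HOL-Complex_Analysis.Complex_Analysis"
begin

text \<open>
  Let \<open>S\<close> be multiplication by \<open>I\<close>, an isometry of \<^const>\<open>H2\<close> with \<open>ker S\<^sup>* = K\<^sub>I\<close>, and let
  \<open>P = 1 - S S\<^sup>*\<close> be the projection onto \<open>K\<^sub>I\<close>. As \<open>T\<^sub>b = (1 + S) / 2\<close> and \<open>T\<^sub>a = (1 - S) / 2\<close>,
  \<open>1 - T\<^sub>b T\<^sub>b\<^sup>* = T\<^sub>a T\<^sub>a\<^sup>* + P / 2 = J J\<^sup>*\<close>, where \<open>J (h, k) = a h + k / sqrt 2\<close> on the direct sum of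
  \<^const>\<open>H2\<close> and \<open>K\<^sub>I\<close>. Since \<open>S\<close> has no nonzero fixed point, \<open>J\<close> and the square root \<open>A\<close> of
  \<open>J J\<^sup>*\<close> are injective, so \<open>A\<close> and \<open>J\<^sup>*\<close> have dense range and \<open>A f \<mapsto> J\<^sup>* f\<close> extends to a unitary
  map. Hence \<open>J\<close> is a unitary map onto the de Branges--Rovnyak space, and it carries the orthogonal
  summands to \<open>a H\<^sup>2\<close> and \<open>K\<^sub>I\<close>.

  The inner product of \<^const>\<open>H2\<close> is defined by radial limits, so everything rests on Fatou's theorem.
  For \<open>f = \<Sum> a\<^sub>n z\<^sup>n\<close> it is obtained from the absolutely convergent series \<open>\<Sum> (a\<^sub>n / n) z\<^sup>n\<close>, whose
  boundary function is an indefinite integral and hence differentiable almost everywhere; the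
  derivative of the Poisson kernel recovers \<open>f\<close> from it.
\<close>

section \<open>Positive square roots and a range decomposition in a real Hilbert space\<close>

text \<open>The condition I(0) = 0 keeps I away from 1 near the origin, so (1 - I) u = 0 forces u =
  0. The operator theory lives in types of class \<open>real_inner\<close> and
  \<open>banach\<close>, whereas \<open>H2\<close> is a set of functions; the type \<open>l2\<close>
  of Taylor coefficients mediates, through the unitary map \<open>hardy\<close>. Real inner products
  suffice there, because a relation that also holds with i y in place of y determines the complex
  inner product. \<open>dBR_operator\<close> is picked by \<open>SOME\<close>, so the range is
  computed for every symmetric A with the right square, and a separate construction of one square
  root shows that the choice is not vacuous. Fatou's theorem goes through an integrated series
  because the boundary function of f is a priori just an L^2 limit of partial sums, with no meaning
  at single points.\<close>

lemma closest_point_exists_complete: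
  fixes V :: "'a::{real_inner, complete_space} set"
  assumes V: "subspace V" "closed V"
  shows "\<exists>p\<in>V. \<forall>v\<in>V. inner (x - p) v = 0"
proof -
  define d where "d = Inf ((\<lambda>v. (norm (x - v))\<^sup>2) ` V)"
  have ne: "V \<noteq> {}" using V subspace_0 by blast
  have dle: "d \<le> (norm (x - v))\<^sup>2" if "v \<in> V" for v
    unfolding d_def by (rule cInf_lower) (use that in \<open>auto intro!: bdd_belowI[of _ 0]\<close>)
  have "\<exists>v\<in>V. (norm (x - v))\<^sup>2 < d + 1 / Suc n" for n
    using cInf_lessD[of "(\<lambda>v. (norm (x - v))\<^sup>2) ` V" "d + 1 / Suc n"] ne
    unfolding d_def by auto
  then obtain q where q: "\<And>n. q n \<in> V" "\<And>n. (norm (x - q n))\<^sup>2 < d + 1 / Suc n"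
    by metis
  \<comment> \<open>Parallelogram law for x - q m and x - q n: the midpoint of q m and q n lies in
    V, so its squared distance to x is at least d.\<close>
  have qq: "(norm (q m - q n))\<^sup>2 \<le> 2 / Suc m + 2 / Suc n" for m n
  proof -
    have "(1/2) *\<^sub>R (q m + q n) \<in> V"
      using V q by (intro subspace_mul subspace_add) auto
    then have "d \<le> (norm (x - (1/2) *\<^sub>R (q m + q n)))\<^sup>2" by (rule dle)
    moreover have "(norm (q m - q n))\<^sup>2 + 4 * (norm (x - (1/2) *\<^sub>R (q m + q n)))\<^sup>2 =
        2 * (norm (x - q m))\<^sup>2 + 2 * (norm (x - q n))\<^sup>2"
      by (simp add: power2_norm_eq_inner inner_diff_left inner_diff_right inner_add_left
          inner_add_right inner_commute algebra_simps)
    ultimately show ?thesis using q(2)[of m] q(2)[of n] by simp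
  qed
  have "Cauchy q"
  proof (rule metric_CauchyI)
    fix e :: real assume "e > 0"
    then obtain N where N: "4 / (e\<^sup>2) < real N" using reals_Archimedean2 by blast
    then have N': "4 / Suc N < e\<^sup>2"
      using \<open>e > 0\<close> by (simp add: field_simps) (smt (verit) zero_less_power)
    have "dist (q m) (q n) < e" if "m \<ge> N" "n \<ge> N" for m n
    proof -
      have "(2::real) / Suc m \<le> 2 / Suc N" "(2::real) / Suc n \<le> 2 / Suc N"
        using that by (auto intro!: divide_left_mono)
      then have "(norm (q m - q n))\<^sup>2 < e\<^sup>2" using qq[of m n] N' by simp
      then show ?thesis using \<open>e > 0\<close> by (simp add: dist_norm power_less_imp_less_base)
    qed
    then show "\<exists>M. \<forall>m\<ge>M. \<forall>n\<ge>M. dist (q m) (q n) < e" by blast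
  qed
  then obtain p where p: "q \<longlonglongrightarrow> p" using Cauchy_convergent_iff convergent_def by blast
  have pV: "p \<in> V" using V(2) q(1) p closed_sequentially by blast
  have "(\<lambda>n. (norm (x - q n))\<^sup>2) \<longlonglongrightarrow> (norm (x - p))\<^sup>2" by (intro tendsto_intros p)
  moreover have "(\<lambda>n. d + 1 / Suc n) \<longlonglongrightarrow> d + 0"
    by (intro tendsto_intros LIMSEQ_Suc lim_1_over_n)
  ultimately have pd: "(norm (x - p))\<^sup>2 \<le> d"
    using q(2) by (metis (no_types, lifting) LIMSEQ_le add.right_neutral less_imp_le)
  have "inner (x - p) v = 0" if v: "v \<in> V" for v
  proof (cases "v = 0")
    case False
    \<comment> \<open>This t minimizes the distance from x to p + t v. The gain over p is the square
      of inner (x - p) v divided by inner v v, and minimality of p makes it vanish.\<close>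
    define t where "t = inner (x - p) v / inner v v"
    have "p + t *\<^sub>R v \<in> V" using V pV v by (intro subspace_mul subspace_add)
    then have "(norm (x - p))\<^sup>2 \<le> (norm (x - (p + t *\<^sub>R v)))\<^sup>2" 
      using dle[of "p + t *\<^sub>R v"] pd by linarith
    also have "\<dots> = (norm (x - p))\<^sup>2 - (inner (x - p) v)\<^sup>2 / inner v v"
    proof -
      have "(norm (w - t *\<^sub>R v))\<^sup>2 = (norm w)\<^sup>2 - (inner w v)\<^sup>2 / inner v v"
        if "t = inner w v / inner v v" for w
        using False that unfolding power2_norm_eq_inner
        by (simp add: inner_diff_left inner_diff_right inner_commute[of v w] field_simps power2_eq_square)
      from this[of "x - p"] show ?thesis by (simp add: t_def diff_diff_add)
    qed
    finally have "(inner (x - p) v)\<^sup>2 / inner v v \<le> 0" by simp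
    then show ?thesis using False by (smt (verit) inner_gt_zero_iff divide_pos_pos zero_less_power2)
  qed simp
  then show ?thesis using pV by blast
qed

lemma subspace_closure:
  fixes V :: "'a::real_normed_vector set"
  assumes "subspace V"
  shows "subspace (closure V)"
proof (rule subspaceI)
  show "0 \<in> closure V" using subspace_0[OF assms] closure_subset by blast
next
  fix x y assume "x \<in> closure V" "y \<in> closure V"
  then obtain f g where fg: "\<And>n. f n \<in> V" "f \<longlonglongrightarrow> x" "\<And>n. g n \<in> V" "g \<longlonglongrightarrow> y"
    unfolding closure_sequential by auto
  show "x + y \<in> closure V" unfolding closure_sequential
    by (rule exI[of _ "\<lambda>n. f n + g n"]) (simp add: fg tendsto_add subspace_add[OF assms])
next
  fix c x assume "x \<in> closure V"
  then obtain f where f: "\<And>n. f n \<in> V" "f \<longlonglongrightarrow> x" unfolding closure_sequential by auto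
  show "c *\<^sub>R x \<in> closure V" unfolding closure_sequential
    by (rule exI[of _ "\<lambda>n. c *\<^sub>R f n"]) (simp add: f tendsto_scaleR subspace_scale[OF assms])
qed

text \<open>Subtracting from x its projection onto the closed range leaves a vector of L orthogonal
  to the range, hence 0. In other words, injectivity of the adjoint gives dense range; the subspace
  L serves as the target space, so that a closed subspace of a product type can play that
  role.\<close>

lemma in_closure_range_linear:
  fixes T :: "'b::real_vector \<Rightarrow> 'a::{real_inner, complete_space}"
  assumes "linear T" "subspace L" "closed L" "range T \<subseteq> L" "x \<in> L"
    and triv: "\<And>y. y \<in> L \<Longrightarrow> (\<And>z. inner y (T z) = 0) \<Longrightarrow> y = 0"
  shows "x \<in> closure (range T)"
proof -
  have "subspace (range T)" using assms(1) by (simp add: linear_subspace_image)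
  then have sub: "subspace (closure (range T))" by (rule subspace_closure)
  obtain p where p: "p \<in> closure (range T)"
    "\<And>v. v \<in> closure (range T) \<Longrightarrow> inner (x - p) v = 0"
    using closest_point_exists_complete[OF sub closed_closure, of x] by blast
  have "p \<in> L" using p(1) closure_minimal[OF assms(4,3)] by blast
  then have "x - p = 0"
    using assms(2,5) p(2)[OF closure_subset[THEN subsetD]] by (intro triv subspace_diff) auto
  with p(1) show ?thesis by simp
qed

section \<open>Square roots by iterating polynomials with nonnegative coefficients\<close>

text \<open>Read as T = p(X) and s = p(1) for a polynomial p with nonnegative coefficients and p(0)
  = 0; the polynomial itself is never formed. Since no cancellation occurs among the coefficients,
  p(1) bounds the norm of p(X) as soon as X is a contraction.\<close>

inductive nonneg_poly :: "('a::real_normed_vector \<Rightarrow>\<^sub>L 'a) \<Rightarrow> ('a \<Rightarrow>\<^sub>L 'a) \<Rightarrow> real \<Rightarrow> bool"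
  for X where
  gen: "nonneg_poly X X 1"
| zero: "nonneg_poly X 0 0"
| add: "nonneg_poly X T s \<Longrightarrow> nonneg_poly X U t \<Longrightarrow> nonneg_poly X (T + U) (s + t)"
| mult: "nonneg_poly X T s \<Longrightarrow> nonneg_poly X U t \<Longrightarrow> nonneg_poly X (T o\<^sub>L U) (s * t)"
| scale: "nonneg_poly X T s \<Longrightarrow> 0 \<le> c \<Longrightarrow> nonneg_poly X (c *\<^sub>R T) (c * s)"

lemma nonneg_poly_norm_le: "nonneg_poly X T s \<Longrightarrow> norm X \<le> 1 \<Longrightarrow> norm T \<le> s \<and> 0 \<le> s"
proof (induction rule: nonneg_poly.induct)
  case (add T s U t)
  then show ?case by (smt (verit) norm_triangle_ineq)
next
  case (mult T s U t)
  then show ?case by (smt (verit) norm_blinfun_compose mult_mono norm_ge_zero mult_nonneg_nonneg)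
next
  case (scale T s c)
  then show ?case by (simp add: mult_left_mono)
qed auto

lemma nonneg_poly_commute:
  "nonneg_poly X T s \<Longrightarrow> (\<And>v. X (C v) = C (X v)) \<Longrightarrow> linear C \<Longrightarrow> T (C v) = C (T v)"
  by (induction arbitrary: v rule: nonneg_poly.induct)
    (simp_all add: blinfun.bilinear_simps linear_0 linear_add linear_cmul)

lemma nonneg_poly_symmetric:
  fixes X :: "'a::real_inner \<Rightarrow>\<^sub>L 'a"
  shows "nonneg_poly X T s \<Longrightarrow> (\<And>u v. inner (X u) v = inner u (X v)) \<Longrightarrow> inner (T u) v = inner u (T v)"
proof (induction arbitrary: u v rule: nonneg_poly.induct)
  case (mult T s U t)
  have "T (U w) = U (T w)" for w
    by (rule nonneg_poly_commute[OF mult.hyps(1)])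
      (use nonneg_poly_commute[OF mult.hyps(2)] in \<open>auto simp: bounded_linear.linear[OF blinfun.bounded_linear_right]\<close>)
  then show ?case using mult by simp
qed (simp_all add: blinfun.bilinear_simps inner_add_left inner_add_right)

text \<open>The limit B satisfies 2 B = X + B^2, which is the equation (1 - B)^2 = 1 - X. The
  iteration therefore approximates 1 minus the square root of 1 - X.\<close>

fun sqrt_iter :: "('a::real_normed_vector \<Rightarrow>\<^sub>L 'a) \<Rightarrow> nat \<Rightarrow> 'a \<Rightarrow>\<^sub>L 'a" where
  "sqrt_iter X 0 = 0"
| "sqrt_iter X (Suc n) = (1/2) *\<^sub>R (X + (sqrt_iter X n o\<^sub>L sqrt_iter X n))"

text \<open>The same recursion with the number 1 in place of X, so the values at 1 of the
  polynomials behind \<open>sqrt_iter\<close>.\<close>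

fun sqrt_iter_bound :: "nat \<Rightarrow> real" where
  "sqrt_iter_bound 0 = 0"
| "sqrt_iter_bound (Suc n) = (1/2) * (1 + sqrt_iter_bound n * sqrt_iter_bound n)"

lemma nonneg_poly_sqrt_iter: "nonneg_poly X (sqrt_iter X n) (sqrt_iter_bound n)"
proof (induction n)
  case (Suc n)
  show ?case
    using nonneg_poly.scale[OF nonneg_poly.add[OF nonneg_poly.gen nonneg_poly.mult[OF Suc Suc]], of "1/2"]
    unfolding sqrt_iter.simps sqrt_iter_bound.simps by simp
qed (simp add: nonneg_poly.zero)

lemma nonneg_poly_commute2:
  assumes "nonneg_poly X T s" "nonneg_poly X U t"
  shows "T o\<^sub>L U = U o\<^sub>L T"
proof (rule blinfun_eqI)
  fix v
  have "T (U v) = U (T v)"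
    by (rule nonneg_poly_commute[OF assms(1)])
      (use nonneg_poly_commute[OF assms(2)] in \<open>auto simp: bounded_linear.linear[OF blinfun.bounded_linear_right]\<close>)
  then show "(T o\<^sub>L U) v = (U o\<^sub>L T) v" by simp
qed

text \<open>Consecutive increments satisfy Y'' - Y' = (Y' - Y)(Y' + Y) / 2, because the iterates
  commute; so nonnegativity of the coefficients is inherited. This lets the scalar increments
  dominate the operator increments.\<close>

lemma nonneg_poly_sqrt_iter_diff:
  "nonneg_poly X (sqrt_iter X (Suc n) - sqrt_iter X n) (sqrt_iter_bound (Suc n) - sqrt_iter_bound n)"
proof (induction n)
  case 0
  have "nonneg_poly X ((1/2) *\<^sub>R X) (1/2 * 1)" by (intro nonneg_poly.scale nonneg_poly.gen) auto
  moreover have "(0 :: 'a \<Rightarrow>\<^sub>L 'a) o\<^sub>L 0 = 0" by (rule blinfun_eqI) simp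
  ultimately show ?case by simp
next
  case (Suc n)
  define T U s t where "T = sqrt_iter X (Suc n)" and "U = sqrt_iter X n"
    and "s = sqrt_iter_bound (Suc n)" and "t = sqrt_iter_bound n"
  have c: "T o\<^sub>L U = U o\<^sub>L T"
    unfolding T_def U_def by (rule nonneg_poly_commute2[OF nonneg_poly_sqrt_iter nonneg_poly_sqrt_iter])
  have "(T o\<^sub>L T) - (U o\<^sub>L U) = (T - U) o\<^sub>L (T + U)"
    using c by (simp add: bounded_bilinear.diff_left[OF bounded_bilinear_blinfun_compose]
        bounded_bilinear.add_right[OF bounded_bilinear_blinfun_compose])
  then have "sqrt_iter X (Suc (Suc n)) - sqrt_iter X (Suc n) = (1/2) *\<^sub>R ((T - U) o\<^sub>L (T + U))"
    unfolding sqrt_iter.simps(2)[of X "Suc n"] T_def[symmetric]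
    unfolding T_def sqrt_iter.simps(2)[of X n] U_def[symmetric]
    by (simp add: scaleR_diff_right[symmetric] scaleR_add_right[symmetric] del: scaleR_diff_right)
  moreover have "sqrt_iter_bound (Suc (Suc n)) - sqrt_iter_bound (Suc n) = (1/2) * ((s - t) * (s + t))"
  proof -
    have "s = (1/2) * (1 + t * t)" unfolding s_def t_def by simp
    then show ?thesis
      unfolding sqrt_iter_bound.simps(2)[of "Suc n"] s_def[symmetric] by (simp add: field_simps)
  qed
  moreover have "nonneg_poly X ((1/2) *\<^sub>R ((T - U) o\<^sub>L (T + U))) ((1/2) * ((s - t) * (s + t)))"
    using Suc unfolding T_def U_def s_def t_def
    by (intro nonneg_poly.scale nonneg_poly.mult nonneg_poly.add nonneg_poly_sqrt_iter) auto
  ultimately show ?case by (simp only:)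
qed

text \<open>The increment equals (1 - b)^2 / 2, where b is the current value.\<close>

lemma sqrt_iter_bound_mono: "sqrt_iter_bound n \<le> sqrt_iter_bound (Suc n)"
  using zero_le_power2[of "1 - sqrt_iter_bound n"] by (simp add: power2_eq_square algebra_simps)

lemma sqrt_iter_bound_le_1: "0 \<le> sqrt_iter_bound n \<and> sqrt_iter_bound n \<le> 1"
proof (induction n)
  case (Suc n)
  then show ?case using mult_mono[of "sqrt_iter_bound n" 1 "sqrt_iter_bound n" 1] by simp
qed simp

lemma sqrt_iter_Cauchy_bound:
  assumes "norm X \<le> 1" "m \<le> n"
  shows "norm (sqrt_iter X n - sqrt_iter X m) \<le> sqrt_iter_bound n - sqrt_iter_bound m"
  using assms(2)
proof (induction rule: dec_induct)
  case (step n)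
  have "norm (sqrt_iter X (Suc n) - sqrt_iter X n) \<le> sqrt_iter_bound (Suc n) - sqrt_iter_bound n"
    using nonneg_poly_norm_le[OF nonneg_poly_sqrt_iter_diff assms(1)] by blast
  with step.IH show ?case
    using norm_triangle_ineq[of "sqrt_iter X (Suc n) - sqrt_iter X n" "sqrt_iter X n - sqrt_iter X m"]
    by (simp del: sqrt_iter.simps sqrt_iter_bound.simps)
qed simp

text \<open>The iterates are Cauchy in operator norm because their scalar counterparts form a
  bounded increasing sequence. The last property, commutation with everything that commutes with X,
  is there to recover complex linearity of the root by taking multiplication by a complex scalar for
  C.\<close>

theorem positive_sqrt_exists:
  fixes X :: "'a::{real_inner, banach} \<Rightarrow>\<^sub>L 'a"
  assumes X: "norm X \<le> 1" and sym: "\<And>u v. inner (X u) v = inner u (X v)"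
  obtains A :: "'a \<Rightarrow>\<^sub>L 'a" where
    "\<And>v. A (A v) = v - X v"
    "\<And>u v. inner (A u) v = inner u (A v)"
    "\<And>v. 0 \<le> inner (A v) v"
    "\<And>C v. bounded_linear C \<Longrightarrow> (\<And>v. X (C v) = C (X v)) \<Longrightarrow> A (C v) = C (A v)"
proof -
  have "convergent sqrt_iter_bound"
  proof (rule Bseq_monoseq_convergent)
    show "Bseq sqrt_iter_bound" by (rule BseqI'[of _ 1]) (use sqrt_iter_bound_le_1 in simp)
    show "monoseq sqrt_iter_bound" unfolding monoseq_Suc using sqrt_iter_bound_mono by blast
  qed
  then have cb: "Cauchy sqrt_iter_bound" by (rule convergent_Cauchy)
  have "Cauchy (sqrt_iter X)"
  proof (rule CauchyI')
    fix e :: real assume "e > 0"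
    then obtain M where M: "\<And>m n. m \<ge> M \<Longrightarrow> n \<ge> M \<Longrightarrow> \<bar>sqrt_iter_bound m - sqrt_iter_bound n\<bar> < e"
      using CauchyD[OF cb \<open>e > 0\<close>] unfolding real_norm_def by blast
    have "norm (sqrt_iter X m - sqrt_iter X n) < e" if "m \<ge> M" "m < n" for m n
      using M[of n m] sqrt_iter_Cauchy_bound[OF X, of m n] that
      by (simp add: norm_minus_commute)
    then show "\<exists>M. \<forall>m\<ge>M. \<forall>n>m. dist (sqrt_iter X m) (sqrt_iter X n) < e"
      unfolding dist_norm by blast
  qed
  then obtain B where B: "sqrt_iter X \<longlonglongrightarrow> B" using Cauchy_convergent_iff convergent_def by blast
  have Bv: "(\<lambda>n. sqrt_iter X n v) \<longlonglongrightarrow> B v" for v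
    by (intro blinfun.tendsto B tendsto_const)
  have "(\<lambda>n. sqrt_iter X (Suc n)) \<longlonglongrightarrow> (1/2) *\<^sub>R (X + (B o\<^sub>L B))"
    unfolding sqrt_iter.simps
    by (intro tendsto_intros bounded_bilinear.tendsto[OF bounded_bilinear_blinfun_compose] B)
  with B have Beq: "B = (1/2) *\<^sub>R (X + (B o\<^sub>L B))" using LIMSEQ_unique LIMSEQ_Suc by blast
  have BB: "2 *\<^sub>R B v = X v + B (B v)" for v
    using arg_cong[OF Beq, of "\<lambda>T. 2 *\<^sub>R blinfun_apply T v"]
    by (simp add: blinfun.bilinear_simps)
  have Bn: "norm B \<le> 1"
    by (rule LIMSEQ_le_const2[OF tendsto_norm[OF B]])
      (use nonneg_poly_norm_le[OF nonneg_poly_sqrt_iter X] sqrt_iter_bound_le_1 order_trans in blast)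
  \<comment> \<open>The fixed point equation for B becomes A A = 1 - X, and norm B \<le> 1 makes A
    positive.\<close>
  define A where "A = id_blinfun - B"
  have A: "A v = v - B v" for v by (simp add: A_def blinfun.bilinear_simps)
  show ?thesis
  proof
    show "A (A v) = v - X v" for v
      using BB[of v] by (simp add: A blinfun.bilinear_simps scaleR_2 algebra_simps)
    have Bsym: "inner (B u) v = inner u (B v)" for u v
    proof (rule LIMSEQ_unique)
      show "(\<lambda>n. inner (sqrt_iter X n u) v) \<longlonglongrightarrow> inner (B u) v" by (intro tendsto_intros Bv)
      show "(\<lambda>n. inner (sqrt_iter X n u) v) \<longlonglongrightarrow> inner u (B v)"
        unfolding nonneg_poly_symmetric[OF nonneg_poly_sqrt_iter sym] by (intro tendsto_intros Bv)
    qed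
    then show "inner (A u) v = inner u (A v)" for u v
      by (simp add: A inner_diff_left inner_diff_right)
    show "0 \<le> inner (A v) v" for v
    proof -
      have "inner (B v) v \<le> norm (B v) * norm v" by (rule norm_cauchy_schwarz)
      also have "\<dots> \<le> norm v * norm v"
        by (rule mult_right_mono)
          (use norm_blinfun[of B v] Bn mult_right_mono[of "norm B" 1 "norm v"] in auto)
      finally show ?thesis by (simp add: A inner_diff_left dot_square_norm power2_eq_square)
    qed
    show "A (C v) = C (A v)" if C: "bounded_linear C" "\<And>v. X (C v) = C (X v)" for C v
    proof -
      have "B (C v) = C (B v)"
      proof (rule LIMSEQ_unique)
        show "(\<lambda>n. sqrt_iter X n (C v)) \<longlonglongrightarrow> B (C v)" by (rule Bv)
        show "(\<lambda>n. sqrt_iter X n (C v)) \<longlonglongrightarrow> C (B v)"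
          using nonneg_poly_commute[of X _ _ C, OF nonneg_poly_sqrt_iter C(2)] C(1)
          by (simp add: bounded_linear.linear bounded_linear.tendsto[OF C(1) Bv])
      qed
      then show ?thesis using C(1) by (simp add: A linear_diff bounded_linear.linear)
    qed
  qed
qed


section \<open>The range of a square root of J J^*\<close>

lemma closure_range_seq:
  fixes T :: "'b \<Rightarrow> 'a::metric_space"
  shows "x \<in> closure (range T) \<Longrightarrow> \<exists>y. (\<lambda>n. T (y n)) \<longlonglongrightarrow> x"
  unfolding closure_sequential
proof (elim exE conjE)
  fix f assume f: "\<forall>n. f n \<in> range T" "f \<longlonglongrightarrow> x"
  then obtain y where "\<And>n. f n = T (y n)" unfolding image_iff by metis
  with f(2) have "(\<lambda>n. T (y n)) \<longlonglongrightarrow> x" by (metis (no_types, lifting) ext)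
  then show ?thesis by blast
qed

text \<open>The unitary map between the two ranges is never built as an object: each of its values
  is reached as a limit of a sequence whose images under A and under the adjoint of J converge
  together.\<close>

lemma sqrt_range_decomposition:
  fixes A S S' :: "'a::{real_inner, banach} \<Rightarrow> 'a"
  assumes A: "bounded_linear A" and S: "bounded_linear S" and S': "bounded_linear S'"
    and symA: "\<And>u v. inner (A u) v = inner u (A v)"
    and adj: "\<And>u v. inner (S u) v = inner u (S' v)"
    and iso: "\<And>u. S' (S u) = u"
    and fix0: "\<forall>u. S u = u \<longrightarrow> u = 0"
    and AA: "\<And>v. A (A v) = v - (1/4) *\<^sub>R (v + S v + S' v + S (S' v))"
  shows sqrt_inj: "A x = 0 \<Longrightarrow> x = 0"
    and sqrt_range: "range A = {(1/2) *\<^sub>R (u - S u) + k | u k. S' k = 0}"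
    and sqrt_orthogonal: "A x = (1/2) *\<^sub>R (u - S u) \<Longrightarrow> A y = k \<Longrightarrow> S' k = 0 \<Longrightarrow> inner x y = 0"
    and sqrt_trivial_intersection: "(1/2) *\<^sub>R (u - S u) = k \<Longrightarrow> S' k = 0 \<Longrightarrow> k = 0"
proof -
  \<comment> \<open>The factor 1 / sqrt 2 occurs here and again in J, so that their product
    contributes half of the projection 1 - S S^*.\<close>
  define P where "P v = (1 / sqrt 2) *\<^sub>R (v - S (S' v))" for v
  define W where "W v = ((1/2) *\<^sub>R (v - S' v), P v)" for v
  define J where "J p = (1/2) *\<^sub>R (fst p - S (fst p)) + (1 / sqrt 2) *\<^sub>R snd p" for p
  \<comment> \<open>The domain of J, the direct sum of the whole space and ker S^*, as a closed
    subspace of the product type.\<close>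
  define L where "L = {p::'a \<times> 'a. S' (snd p) = 0}"
  note linS = bounded_linear.linear[OF S] and linS' = bounded_linear.linear[OF S']
    and linA = bounded_linear.linear[OF A]
  note lin = linear_add[OF linS] linear_diff[OF linS] linear_cmul[OF linS] linear_0[OF linS]
    linear_add[OF linS'] linear_diff[OF linS'] linear_cmul[OF linS'] linear_0[OF linS']
  have adj': "inner (S' u) v = inner u (S v)" for u v
    using adj[of v u] by (simp add: inner_commute)
  have isoS: "inner (S u) (S v) = inner u v" for u v by (simp add: adj iso)
  have blP: "bounded_linear P" unfolding P_def
    by (intro bounded_linear_intros S bounded_linear_compose[OF S S'])
  have blW: "bounded_linear W" unfolding W_def
    by (intro bounded_linear_intros bounded_linear_Pair S' blP)
  have blJ: "bounded_linear J" unfolding J_def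
    by (intro bounded_linear_intros bounded_linear_compose[OF S] bounded_linear_fst bounded_linear_snd)
  have JW: "J (W v) = A (A v)" for v
    unfolding J_def W_def P_def AA
    by (simp add: lin algebra_simps iso) (simp add: scaleR_add_left[symmetric])
  \<comment> \<open>W is the adjoint of J on L: for p in L the part S S^* v of P v is orthogonal to
    \<open>snd p\<close>, because S^* annihilates \<open>snd p\<close>.\<close>
  have WJ: "inner p (W v) = inner (J p) v" if "p \<in> L" for p v
    using that unfolding J_def W_def P_def L_def
    by (simp add: inner_prod_def inner_diff_left inner_diff_right inner_add_left adj adj'[symmetric])
  have WL: "W v \<in> L" for v by (simp add: W_def L_def P_def lin iso)
  have WW: "inner (W u) (W v) = inner (A u) (A v)" for u v
    using WJ[OF WL] by (simp add: JW symA)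
  have normWA: "norm (W v) = norm (A v)" for v by (simp add: norm_eq_sqrt_inner WW)
  have subL: "subspace L" unfolding L_def subspace_def by (simp add: lin)
  have clL: "closed L" unfolding L_def
    by (intro closed_Collect_eq continuous_intros bounded_linear.continuous_on[OF S']
        bounded_linear.continuous_on[OF bounded_linear_snd])
  \<comment> \<open>For an isometry, the squared norm of S u - u is 2 (inner u u - inner u (S^* u)),
    so a fixed vector of the adjoint is a fixed vector of S.\<close>
  have fix0': "u = 0" if "S' u = u" for u
  proof -
    have "(norm (S u - u))\<^sup>2 = inner (S u) (S u) - 2 * inner u (S' u) + inner u u"
      using adj[of u u] by (simp add: power2_norm_eq_inner inner_diff_left inner_diff_right inner_commute)
    then show ?thesis using that isoS[of u u] by (intro fix0[rule_format]) simp
  qed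
  \<comment> \<open>Applying S^* to J p removes the second component and turns the first into (S^* u
    - u) / 2.\<close>
  have Jinj: "p = 0" if "p \<in> L" "J p = 0" for p
  proof -
    have k: "S' (snd p) = 0" using that by (simp add: L_def)
    have "S' (J p) = (1/2) *\<^sub>R (S' (fst p) - fst p)" by (simp add: J_def lin k iso)
    then have "fst p = 0" using that by (intro fix0') (simp add: lin)
    then show ?thesis using that by (simp add: J_def lin prod_eq_iff)
  qed
  show Ainj: "x = 0" if "A x = 0" for x
  proof -
    have "W x = 0" using normWA[of x] that by simp
    then have "S' x = x" by (simp add: W_def zero_prod_def)
    then show ?thesis by (rule fix0')
  qed
  have dist_eq: "dist (W u) (W v) = dist (A u) (A v)" for u v
    unfolding dist_norm linear_diff[OF linA, symmetric]
      linear_diff[OF bounded_linear.linear[OF blW], symmetric] by (rule normWA)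
  have denseW: "p \<in> closure (range W)" if "p \<in> L" for p
    by (rule in_closure_range_linear[OF bounded_linear.linear[OF blW] subL clL])
      (use WL that Jinj WJ inner_eq_zero_iff in \<open>auto, metis\<close>)
  have denseA: "x \<in> closure (range A)" for x
  proof (rule in_closure_range_linear[OF linA subspace_UNIV closed_UNIV])
    fix y assume "\<And>z. inner y (A z) = 0"
    then have "A y = 0" using inner_eq_zero_iff[of "A y"] symA by metis
    then show "y = 0" by (rule Ainj)
  qed auto
  \<comment> \<open>Choose y n with W (y n) tending to p. By \<open>dist_eq\<close> the sequence A
    (y n) is Cauchy as well, and A (A (y n)) = J (W (y n)) gives A x = J p in the limit. The
    approximating sequence is kept in the conclusion for computing inner products later;
    \<open>AJ\<close> is the same argument with the roles of A and W exchanged.\<close>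
  have JA: "\<exists>x y. A x = J p \<and> (\<lambda>n. A (y n)) \<longlonglongrightarrow> x \<and> (\<lambda>n. W (y n)) \<longlonglongrightarrow> p" if pL: "p \<in> L" for p
  proof -
    obtain y where y: "(\<lambda>n. W (y n)) \<longlonglongrightarrow> p"
      using denseW[OF pL] closure_range_seq by blast
    have "Cauchy (\<lambda>n. A (y n))"
      using LIMSEQ_imp_Cauchy[OF y] by (simp add: Cauchy_def dist_eq)
    then obtain x where x: "(\<lambda>n. A (y n)) \<longlonglongrightarrow> x" using Cauchy_convergent_iff convergent_def by blast
    have "A x = J p"
      by (rule LIMSEQ_unique[OF bounded_linear.tendsto[OF A x]])
        (use bounded_linear.tendsto[OF blJ y] in \<open>simp add: JW\<close>)
    with x y show ?thesis by blast
  qed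
  have AJ: "\<exists>p\<in>L. A x = J p" for x
  proof -
    obtain y where y: "(\<lambda>n. A (y n)) \<longlonglongrightarrow> x"
      using denseA[of x] closure_range_seq by blast
    have "Cauchy (\<lambda>n. W (y n))"
      using LIMSEQ_imp_Cauchy[OF y] by (simp add: Cauchy_def dist_eq)
    then obtain p where p: "(\<lambda>n. W (y n)) \<longlonglongrightarrow> p" using Cauchy_convergent_iff convergent_def by blast
    have "p \<in> L" by (rule closed_sequentially[OF clL _ p]) (rule WL)
    moreover have "A x = J p"
      by (rule LIMSEQ_unique[OF bounded_linear.tendsto[OF A y]])
        (use bounded_linear.tendsto[OF blJ p] in \<open>simp add: JW\<close>)
    ultimately show ?thesis by blast
  qed
  have J_pair: "J (u, sqrt 2 *\<^sub>R k) = (1/2) *\<^sub>R (u - S u) + k" for u k by (simp add: J_def)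
  show "range A = {(1/2) *\<^sub>R (u - S u) + k | u k. S' k = 0}"
  proof (intro equalityI subsetI)
    fix f assume "f \<in> range A"
    then obtain p where "p \<in> L" "f = J p" using AJ by blast
    then have "f = (1/2) *\<^sub>R (fst p - S (fst p)) + (1 / sqrt 2) *\<^sub>R snd p"
      "S' ((1 / sqrt 2) *\<^sub>R snd p) = 0"
      by (simp_all add: L_def J_def lin(7))
    then show "f \<in> {(1/2) *\<^sub>R (u - S u) + k | u k. S' k = 0}" by blast
  next
    fix f assume "f \<in> {(1/2) *\<^sub>R (u - S u) + k | u k. S' k = 0}"
    then obtain u k where uk: "f = J (u, sqrt 2 *\<^sub>R k)" "S' k = 0"
      using J_pair[symmetric] by blast
    then have "(u, sqrt 2 *\<^sub>R k) \<in> L" by (simp add: L_def lin(7))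
    then show "f \<in> range A" using JA uk(1) by (metis rangeI)
  qed
  have Aeq: "x = x'" if "A x = A x'" for x x'
    using Ainj[of "x - x'"] that by (simp add: linear_diff[OF linA])
  show "inner x y = 0" if "A x = (1/2) *\<^sub>R (u - S u)" "A y = k" "S' k = 0"
  proof -
    have L: "(u, 0) \<in> L" "(0, sqrt 2 *\<^sub>R k) \<in> L" using that by (auto simp: L_def lin)
    obtain x' f where f: "A x' = J (u, 0)" "(\<lambda>n. A (f n)) \<longlonglongrightarrow> x'" "(\<lambda>n. W (f n)) \<longlonglongrightarrow> (u, 0)"
      using JA[OF L(1)] by blast
    obtain y' g where g: "A y' = J (0, sqrt 2 *\<^sub>R k)" "(\<lambda>n. A (g n)) \<longlonglongrightarrow> y'"
      "(\<lambda>n. W (g n)) \<longlonglongrightarrow> (0, sqrt 2 *\<^sub>R k)"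
      using JA[OF L(2)] by blast
    have "x' = x" by (rule Aeq) (simp only: f(1) that(1) J_def fst_conv snd_conv scaleR_zero_right add_0_right)
    moreover have "y' = y" by (rule Aeq) (simp add: g(1) that(2) J_def lin(4))
    ultimately have xy: "x' = x" "y' = y" .
    \<comment> \<open>Both sides are limits of the same numbers, since W and A have equal inner
      products along the approximating sequences. The right side is 0 because the pairs lie in
      different summands.\<close>
    have "inner x y = inner (u, 0) (0, sqrt 2 *\<^sub>R k)"
      using LIMSEQ_unique[OF tendsto_inner[OF f(2) g(2)]] tendsto_inner[OF f(3) g(3)]
      unfolding xy by (simp only: WW)
    then show ?thesis by simp
  qed
  show "k = 0" if "(1/2) *\<^sub>R (u - S u) = k" "S' k = 0"
  proof -
    \<comment> \<open>A common element of both summands yields, with opposite sign in the second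
      place, an element of the kernel of J.\<close>
    have "(u, sqrt 2 *\<^sub>R (- k)) \<in> L"
      unfolding L_def using that(2) by (simp only: snd_conv lin(7) linear_neg[OF linS'] mem_Collect_eq) simp
    moreover have "J (u, sqrt 2 *\<^sub>R (- k)) = 0" unfolding J_pair that(1) by simp
    ultimately have "(u, sqrt 2 *\<^sub>R (- k)) = 0" by (rule Jinj)
    then show ?thesis by (simp add: zero_prod_def)
  qed
qed

section \<open>The Hilbert space of square summable sequences\<close>

text \<open>Sequences of Taylor coefficients, as a type, so that the results for the classes
  \<open>real_inner\<close> and \<open>banach\<close> apply to the Hardy space.\<close>

typedef l2 = "{x::nat \<Rightarrow> complex. summable (\<lambda>n. (norm (x n))\<^sup>2)}"
  morphisms coord Abs_l2
  by (rule exI[of _ "\<lambda>_. 0"]) simp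

setup_lifting type_definition_l2

lemma summable_coord: "summable (\<lambda>n. (norm (coord x n))\<^sup>2)"
  using coord[of x] by simp

lemma l2_eqI: "(\<And>n. coord x n = coord y n) \<Longrightarrow> x = y"
  by (simp add: coord_inject[symmetric] ext)

lemma norm_add_sq_le: "(norm (x + y))\<^sup>2 \<le> 2 * (norm x)\<^sup>2 + 2 * (norm (y::'a::real_inner))\<^sup>2"
proof -
  have "(norm (x + y))\<^sup>2 + (norm (x - y))\<^sup>2 = 2 * (norm x)\<^sup>2 + 2 * (norm y)\<^sup>2"
    by (simp add: power2_norm_eq_inner inner_simps inner_commute)
  then show ?thesis using zero_le_power2[of "norm (x - y)"] by linarith
qed

lemma norm_mult_le_sq: "norm ((x::complex) * y) \<le> (norm x)\<^sup>2 + (norm y)\<^sup>2"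
  using zero_le_power2[of "norm x - norm y"] mult_nonneg_nonneg[OF norm_ge_zero[of x] norm_ge_zero[of y]]
  unfolding power2_diff norm_mult by linarith

lemma summable_sq_add:
  fixes x y :: "nat \<Rightarrow> complex"
  assumes "summable (\<lambda>n. (norm (x n))\<^sup>2)" "summable (\<lambda>n. (norm (y n))\<^sup>2)"
  shows "summable (\<lambda>n. (norm (x n + y n))\<^sup>2)"
  by (rule summable_comparison_test[of _ "\<lambda>n. 2 * (norm (x n))\<^sup>2 + 2 * (norm (y n))\<^sup>2"])
    (use assms norm_add_sq_le in \<open>auto intro!: summable_add summable_mult\<close>)

lemma summable_sq_mult:
  fixes x y :: "nat \<Rightarrow> complex"
  assumes "summable (\<lambda>n. (norm (x n))\<^sup>2)" "summable (\<lambda>n. (norm (y n))\<^sup>2)"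
  shows "summable (\<lambda>n. norm (x n * y n))"
  by (rule summable_comparison_test[of _ "\<lambda>n. (norm (x n))\<^sup>2 + (norm (y n))\<^sup>2"])
    (use assms norm_mult_le_sq in \<open>auto intro!: summable_add\<close>)

lemma summable_cinner: "summable (\<lambda>n. coord x n * cnj (coord y n))"
  using summable_sq_mult[of "coord x" "\<lambda>n. cnj (coord y n)"] summable_coord
  by (auto intro: summable_norm_cancel)

definition cinner :: "l2 \<Rightarrow> l2 \<Rightarrow> complex" where
  "cinner x y = (\<Sum>n. coord x n * cnj (coord y n))"

lift_definition scaleC :: "complex \<Rightarrow> l2 \<Rightarrow> l2" is "\<lambda>c x n. c * x n"
  by (simp add: norm_mult power_mult_distrib summable_mult)

text \<open>The instance registers the underlying real Hilbert space, with the real part of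
  \<open>cinner\<close> as inner product; the complex structure stays available through
  \<open>scaleC\<close> and \<open>cinner\<close>.\<close>

instantiation l2 :: real_inner
begin

lift_definition zero_l2 :: l2 is "\<lambda>_. 0" by simp
lift_definition plus_l2 :: "l2 \<Rightarrow> l2 \<Rightarrow> l2" is "\<lambda>x y n. x n + y n" by (rule summable_sq_add)
lift_definition uminus_l2 :: "l2 \<Rightarrow> l2" is "\<lambda>x n. - x n" by simp
definition minus_l2 :: "l2 \<Rightarrow> l2 \<Rightarrow> l2" where "minus_l2 x y = x + - y"
definition scaleR_l2 :: "real \<Rightarrow> l2 \<Rightarrow> l2" where "scaleR_l2 r = scaleC (of_real r)"
definition inner_l2 :: "l2 \<Rightarrow> l2 \<Rightarrow> real" where "inner_l2 x y = Re (cinner x y)"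
definition norm_l2 :: "l2 \<Rightarrow> real" where "norm_l2 x = sqrt (inner x x)"
definition sgn_l2 :: "l2 \<Rightarrow> l2" where "sgn_l2 x = inverse (norm x) *\<^sub>R x"
definition dist_l2 :: "l2 \<Rightarrow> l2 \<Rightarrow> real" where "dist_l2 x y = norm (x - y)"
definition uniformity_l2 :: "(l2 \<times> l2) filter" where
  "uniformity_l2 = (INF e\<in>{0<..}. principal {(x, y). dist x y < e})"
definition open_l2 :: "l2 set \<Rightarrow> bool" where
  "open_l2 U = (\<forall>x\<in>U. eventually (\<lambda>(x', y). x' = x \<longrightarrow> y \<in> U) uniformity)"

lemma coord_simps [simp]:
  "coord 0 n = 0" "coord (x + y) n = coord x n + coord y n" "coord (- x) n = - coord x n"
  "coord (x - y) n = coord x n - coord y n" "coord (r *\<^sub>R x) n = of_real r * coord x n"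
  "coord (scaleC c x) n = c * coord x n"
  by (simp_all add: zero_l2.rep_eq plus_l2.rep_eq uminus_l2.rep_eq minus_l2_def scaleR_l2_def scaleC.rep_eq)

lemma inner_l2_eq: "inner x y = (\<Sum>n. Re (coord x n * cnj (coord y n)))"
  unfolding inner_l2_def cinner_def by (rule Re_suminf[OF summable_cinner])

lemma summable_inner: "summable (\<lambda>n. Re (coord x n * cnj (coord y n)))"
  by (rule summable_Re[OF summable_cinner])

lemma inner_self_l2: "inner (x::l2) x = (\<Sum>n. (norm (coord x n))\<^sup>2)"
  unfolding inner_l2_eq by (simp add: complex_mult_cnj cmod_power2)

instance
proof
  fix x y z :: l2 and a b r :: real
  show "x + y + z = x + (y + z)" "x + y = y + x" "0 + x = x" "- x + x = 0" "x - y = x + - y"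
    "a *\<^sub>R (x + y) = a *\<^sub>R x + a *\<^sub>R y" "(a + b) *\<^sub>R x = a *\<^sub>R x + b *\<^sub>R x"
    "a *\<^sub>R b *\<^sub>R x = (a * b) *\<^sub>R x" "1 *\<^sub>R x = x"
    by (auto intro!: l2_eqI simp: algebra_simps)
  show "dist x y = norm (x - y)" "sgn x = inverse (norm x) *\<^sub>R x" "norm x = sqrt (inner x x)"
    by (simp_all add: dist_l2_def sgn_l2_def norm_l2_def)
  show "uniformity = (INF e\<in>{0<..}. principal {(x::l2, y). dist x y < e})"
    by (rule uniformity_l2_def)
  show "open U = (\<forall>x\<in>U. \<forall>\<^sub>F (x', y) in uniformity. x' = x \<longrightarrow> y \<in> U)" for U :: "l2 set"
    by (rule open_l2_def)
  show "inner x y = inner y x" unfolding inner_l2_eq by (simp add: mult.commute)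
  show "inner (x + y) z = inner x z + inner y z"
    unfolding inner_l2_eq suminf_add[OF summable_inner summable_inner] by (simp add: algebra_simps)
  show "inner (r *\<^sub>R x) y = r * inner x y"
    unfolding inner_l2_eq suminf_mult[OF summable_inner, symmetric] by (simp add: algebra_simps)
  show "0 \<le> inner x x" unfolding inner_self_l2 by (intro suminf_nonneg summable_coord) simp
  show "inner x x = 0 \<longleftrightarrow> x = 0"
    unfolding inner_self_l2 by (subst suminf_eq_zero_iff[OF summable_coord]) (auto intro: l2_eqI)
qed

end

lemma norm_sq_l2: "(norm (x::l2))\<^sup>2 = (\<Sum>n. (norm (coord x n))\<^sup>2)"
  by (simp add: power2_norm_eq_inner inner_self_l2)

lemma norm_coord_le: "norm (coord x n) \<le> norm x"
proof -
  have "(\<Sum>k\<in>{n}. (norm (coord x k))\<^sup>2) \<le> (norm x)\<^sup>2"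
    unfolding norm_sq_l2 by (rule sum_le_suminf[OF summable_coord]) auto
  then have "(norm (coord x n))\<^sup>2 \<le> (norm x)\<^sup>2" by simp
  then show ?thesis by (rule power2_le_imp_le) simp
qed

lemma norm_l2_leI:
  assumes "\<And>N. (\<Sum>n<N. (norm (coord x n))\<^sup>2) \<le> e\<^sup>2" "e \<ge> 0"
  shows "norm x \<le> e"
proof -
  have "(norm x)\<^sup>2 \<le> e\<^sup>2"
    unfolding norm_sq_l2 by (rule suminf_le_const[OF summable_coord assms(1)])
  then show ?thesis using assms(2) by (rule power2_le_imp_le)
qed

instance l2 :: banach
proof
  fix X :: "nat \<Rightarrow> l2"
  assume X: "Cauchy X"
  have "Cauchy (\<lambda>k. coord (X k) n)" for n
  proof (rule metric_CauchyI)
    fix e :: real assume "e > 0"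
    then obtain M where "\<forall>m\<ge>M. \<forall>k\<ge>M. dist (X m) (X k) < e" using metric_CauchyD[OF X] by blast
    moreover have "dist (coord (X m) n) (coord (X k) n) \<le> dist (X m) (X k)" for m k
      using norm_coord_le[of "X m - X k" n] by (simp add: dist_norm)
    ultimately show "\<exists>M. \<forall>m\<ge>M. \<forall>k\<ge>M. dist (coord (X m) n) (coord (X k) n) < e"
      using le_less_trans by blast
  qed
  then have "\<exists>l. (\<lambda>k. coord (X k) n) \<longlonglongrightarrow> l" for n
    using Cauchy_convergent_iff convergent_def by blast
  then obtain l where l: "\<And>n. (\<lambda>k. coord (X k) n) \<longlonglongrightarrow> l n" by metis
  \<comment> \<open>Finite sums pass to the coordinatewise limit in k, and the bound does not depend
    on N.\<close>
  have partial: "(\<Sum>n<N. (norm (coord (X m) n - l n))\<^sup>2) \<le> e\<^sup>2"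
    if e: "\<And>k. k \<ge> M \<Longrightarrow> norm (X m - X k) \<le> e" for N m M e
  proof (rule LIMSEQ_le_const2)
    show "(\<lambda>k. \<Sum>n<N. (norm (coord (X m) n - coord (X k) n))\<^sup>2) \<longlonglongrightarrow> (\<Sum>n<N. (norm (coord (X m) n - l n))\<^sup>2)"
      by (intro tendsto_intros l)
    show "\<exists>K. \<forall>k\<ge>K. (\<Sum>n<N. (norm (coord (X m) n - coord (X k) n))\<^sup>2) \<le> e\<^sup>2"
    proof (intro exI allI impI)
      fix k assume "k \<ge> M"
      have "(\<Sum>n<N. (norm (coord (X m - X k) n))\<^sup>2) \<le> (norm (X m - X k))\<^sup>2"
        unfolding norm_sq_l2 by (rule sum_le_suminf[OF summable_coord]) auto
      also have "\<dots> \<le> e\<^sup>2" using e[OF \<open>k \<ge> M\<close>] by (rule power_mono) simp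
      finally show "(\<Sum>n<N. (norm (coord (X m) n - coord (X k) n))\<^sup>2) \<le> e\<^sup>2" by simp
    qed
  qed
  obtain M where M: "\<And>m k. m \<ge> M \<Longrightarrow> k \<ge> M \<Longrightarrow> norm (X m - X k) < 1"
    using CauchyD[OF X, of 1] by auto
  have "summable (\<lambda>n. (norm (coord (X M) n - l n))\<^sup>2)"
  proof (rule summableI_nonneg_bounded)
    show "(\<Sum>n<N. (norm (coord (X M) n - l n))\<^sup>2) \<le> 1\<^sup>2" for N
      by (rule partial[of M M 1 N]) (use M[of M] in \<open>simp add: less_imp_le\<close>)
  qed simp
  \<comment> \<open>The limit is written as X M minus the difference X M - l, both of which are
    square summable.\<close>
  then have "summable (\<lambda>n. (norm (coord (X M) n + - (coord (X M) n - l n)))\<^sup>2)"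
    by (intro summable_sq_add summable_coord) (simp only: norm_minus_cancel)
  then have "summable (\<lambda>n. (norm (l n))\<^sup>2)" by simp
  then have coordL: "coord (Abs_l2 l) = l" by (simp add: Abs_l2_inverse)
  have "X \<longlonglongrightarrow> Abs_l2 l"
  proof (rule metric_LIMSEQ_I)
    fix e :: real assume "e > 0"
    then obtain M where M: "\<And>m k. m \<ge> M \<Longrightarrow> k \<ge> M \<Longrightarrow> norm (X m - X k) < e/2"
      using CauchyD[OF X half_gt_zero[OF \<open>e > 0\<close>]] by blast
    have "norm (X m - Abs_l2 l) \<le> e/2" if "m \<ge> M" for m
    proof (rule norm_l2_leI)
      show "(\<Sum>n<N. (norm (coord (X m - Abs_l2 l) n))\<^sup>2) \<le> (e/2)\<^sup>2" for N
        unfolding coord_simps coordL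
        by (rule partial[of M m "e/2" N]) (use M[OF that] in \<open>simp add: less_imp_le\<close>)
    qed (use \<open>e > 0\<close> in simp)
    moreover have "e/2 < e" using \<open>e > 0\<close> by simp
    ultimately show "\<exists>N. \<forall>n\<ge>N. dist (X n) (Abs_l2 l) < e"
      unfolding dist_norm using le_less_trans by blast
  qed
  then show "convergent X" unfolding convergent_def by blast
qed

lemma cinner_add_left: "cinner (x + y) z = cinner x z + cinner y z"
  unfolding cinner_def suminf_add[OF summable_cinner summable_cinner] by (simp add: algebra_simps)

lemma cinner_scaleC_left: "cinner (scaleC c x) y = c * cinner x y"
  unfolding cinner_def suminf_mult[OF summable_cinner, symmetric] by (simp add: algebra_simps)

lemma cinner_commute: "cinner x y = cnj (cinner y x)"
  unfolding cinner_def bounded_linear.suminf[OF bounded_linear_cnj summable_cinner]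
  by (simp add: mult.commute)
    
lemma cinner_self: "cinner x x = of_real ((norm x)\<^sup>2)"
proof -
  have "Im (cinner x x) = 0" using cinner_commute[of x x] by (metis cnj.sel(2) neg_equal_zero)
  then show ?thesis by (simp add: complex_eq_iff power2_norm_eq_inner inner_l2_def)
qed

text \<open>Since cinner x (i y) = -i cinner x y, the imaginary part of \<open>cinner\<close> is a
  real inner product with i y. A real identity that survives this substitution thus becomes a
  complex one.\<close>

lemma cinner_eq_inner: "cinner x y = Complex (inner x y) (inner x (scaleC \<i> y))"
proof -
  have "cinner x (scaleC \<i> y) = - \<i> * cinner x y"
    by (subst (1 2) cinner_commute) (simp add: cinner_scaleC_left)
  then show ?thesis by (simp add: inner_l2_def complex_eq_iff)
qed

lemma scaleC_real: "scaleC (of_real r) x = r *\<^sub>R x" by (simp add: scaleR_l2_def)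

lemma norm_scaleC: "norm (scaleC c x) = norm c * norm x"
proof -
  have "(norm (scaleC c x))\<^sup>2 = (norm c * norm x)\<^sup>2"
    unfolding norm_sq_l2 power_mult_distrib suminf_mult[OF summable_coord, symmetric]
    by (simp add: norm_mult power_mult_distrib)
  then show ?thesis by (simp add: power2_eq_iff_nonneg)
qed

lemma bounded_linear_scaleC: "bounded_linear (scaleC c)"
  by (rule bounded_linear_intro[of _ "norm c"])
    (simp_all add: l2_eqI norm_scaleC distrib_left mult.commute mult.left_commute)

section \<open>The circle measure\<close>

abbreviation "circ \<equiv> circle_measure"

lemma space_circle [simp]: "space circ = sphere 0 1"
  by (simp add: circle_measure_def space_restrict_space)

lemma sets_circle [measurable_cong]: "sets circ = sets (restrict_space borel (sphere 0 1))"
  by (simp add: circle_measure_def)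

lemma cis_measurable: "cis \<in> measurable borel (restrict_space borel (sphere 0 1))"
  by (rule measurable_restrict_space2)
    (auto intro!: borel_measurable_continuous_onI continuous_intros)

lemma uniform_arc_eq:
  "uniform_measure lborel {0..2 * pi} = density lborel (\<lambda>t. ennreal (indicator {0..2 * pi} t / (2 * pi)))"
  unfolding uniform_measure_def
  by (rule arg_cong[of _ _ "density lborel"], rule ext)
    (simp add: indicator_def divide_ennreal ennreal_1[symmetric] del: ennreal_1)

text \<open>Pulls integration over the circle back to the interval from 0 to 2 pi; the normalizing
  weight changes integrals by a factor but leaves integrability alone.\<close>

lemma circle_integrable_iff:
  fixes f :: "complex \<Rightarrow> 'a::{banach, second_countable_topology}"
  assumes [measurable]: "f \<in> borel_measurable circ"
  shows "integrable circ f \<longleftrightarrow> set_integrable lborel {0..2 * pi} (\<lambda>t. f (cis t))"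
    (is ?A)
    and "integral\<^sup>L circ f = (1 / (2 * pi)) *\<^sub>R (LINT t:{0..2 * pi}|lborel. f (cis t))" (is ?B)
proof -
  have f: "f \<in> borel_measurable (restrict_space borel (sphere 0 1))" using assms by measurable
  have fc: "(\<lambda>t. f (cis t)) \<in> borel_measurable borel" using measurable_compose[OF cis_measurable f] .
  have cis: "cis \<in> measurable (density lborel (\<lambda>t. ennreal (indicator {0..2 * pi} t / (2 * pi))))
      (restrict_space borel (sphere 0 1))"
    using cis_measurable by simp
  have eq: "(indicator {0..2 * pi} t / (2 * pi)) *\<^sub>R f (cis t) =
      (1 / (2 * pi)) *\<^sub>R (indicator {0..2 * pi} t *\<^sub>R f (cis t))" for t by simp
  have scale: "integrable lborel (\<lambda>t. c *\<^sub>R h t) \<longleftrightarrow> integrable lborel h"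
    if "c \<noteq> 0" for c :: real and h :: "real \<Rightarrow> 'a"
    using integrable_scaleR_right[of "1/c" lborel "\<lambda>t. c *\<^sub>R h t"] that by auto
  have fc': "(\<lambda>t. f (cis t)) \<in> borel_measurable lborel" using fc by simp
  have "integrable (density lborel (\<lambda>t. ennreal (indicator {0..2 * pi} t / (2 * pi)))) (\<lambda>t. f (cis t)) \<longleftrightarrow>
      integrable lborel (\<lambda>t. (indicator {0..2 * pi} t / (2 * pi)) *\<^sub>R f (cis t))"
    by (rule integrable_density[OF fc']) auto
  also have "\<dots> \<longleftrightarrow> integrable lborel (\<lambda>t. indicator {0..2 * pi} t *\<^sub>R f (cis t))"
    unfolding eq by (rule scale) simp
  finally show ?A
    unfolding circle_measure_def uniform_arc_eq integrable_distr_eq[OF cis f] set_integrable_def .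
  have "integral\<^sup>L (density lborel (\<lambda>t. ennreal (indicator {0..2 * pi} t / (2 * pi)))) (\<lambda>t. f (cis t)) =
      (\<integral>t. (indicator {0..2 * pi} t / (2 * pi)) *\<^sub>R f (cis t) \<partial>lborel)"
    by (rule integral_density[OF fc']) auto
  also have "\<dots> = (1 / (2 * pi)) *\<^sub>R (\<integral>t. indicator {0..2 * pi} t *\<^sub>R f (cis t) \<partial>lborel)"
    unfolding eq by (rule integral_scaleR_right)
  finally show ?B
    unfolding circle_measure_def uniform_arc_eq integral_distr[OF cis f] set_lebesgue_integral_def .
qed

lemma emeasure_circle: "emeasure circ (space circ) = 1"
proof -
  have cis: "cis \<in> measurable (uniform_measure lborel {0..2 * pi}) (restrict_space borel (sphere 0 1))"
    using cis_measurable by simp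
  have "emeasure circ (space circ) =
      emeasure (uniform_measure lborel {0..2 * pi}) (space (uniform_measure lborel {0..2 * pi}))"
    unfolding circle_measure_def space_distr
    by (subst emeasure_distr[OF cis sets.top])
      (rule arg_cong[of _ _ "emeasure _"], auto simp: space_restrict_space)
  also have "\<dots> = 1" by (simp add: emeasure_uniform_measure divide_ennreal)
  finally show ?thesis .
qed

interpretation circ: finite_measure circ
  by (rule finite_measureI) (simp only: emeasure_circle, simp)

lemma measure_circle [simp]: "measure circ (sphere 0 1) = 1"
  using emeasure_circle by (simp add: measure_def)

lemma circle_continuous_measurable:
  "continuous_on (sphere 0 1) f \<Longrightarrow> f \<in> borel_measurable circ"
  using borel_measurable_continuous_on_restrict[of "sphere 0 1" f] by measurable

lemma circle_continuous_integrable: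
  fixes f :: "complex \<Rightarrow> 'a::{banach, second_countable_topology}"
  assumes "continuous_on (sphere 0 1) f"
  shows "integrable circ f"
proof -
  have "compact (f ` sphere 0 1)" using assms by (intro compact_continuous_image) auto
  then obtain B where "\<And>z. z \<in> sphere 0 1 \<Longrightarrow> norm (f z) \<le> B"
    by (meson compact_imp_bounded bounded_iff imageI)
  then show ?thesis
    by (intro circ.integrable_const_bound[of _ B] circle_continuous_measurable assms) auto
qed

lemma norm_circle: "z \<in> sphere (0::complex) 1 \<Longrightarrow> norm z = 1" by simp

lemma circle_mult_cnj: "z \<in> sphere (0::complex) 1 \<Longrightarrow> z * cnj z = 1"
  by (simp add: complex_mult_cnj cmod_power2[symmetric])

lemma circle_integral_power: "(\<integral>z. z ^ n \<partial>circ) = (if n = 0 then 1 else 0)"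
proof (cases "n = 0")
  case False
  have "(LINT t:{0..2 * pi}|lborel. cis (real n * t)) =
      - \<i> / of_nat n * cis (real n * (2 * pi)) - - \<i> / of_nat n * cis (real n * 0)"
    unfolding set_lebesgue_integral_def
  proof (rule integral_FTC_Icc)
    fix t :: real
    have "((\<lambda>z. - \<i> / of_nat n * exp (\<i> * of_nat n * z)) has_field_derivative exp (\<i> * of_nat n * of_real t)) (at (of_real t))"
      using False by (auto intro!: derivative_eq_intros)
    from has_vector_derivative_real_field[OF this]
    show "((\<lambda>t. - \<i> / of_nat n * cis (real n * t)) has_vector_derivative cis (real n * t)) (at t within {0..2 * pi})"
      by (simp add: cis_conv_exp has_vector_derivative_at_within mult_ac)
  qed (auto intro!: continuous_intros)
  also have "cis (real n * (2 * pi)) = 1" by (metis cis_multiple_2pi Ints_of_nat mult.commute)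
  finally have "(LINT t:{0..2 * pi}|lborel. cis (real n * t)) = 0" by simp
  then have "(LINT t:{0..2 * pi}|lborel. cis t ^ n) = 0" by (simp only: Complex.DeMoivre)
  then show ?thesis using False
    by (subst circle_integrable_iff(2)) (auto intro!: circle_continuous_measurable continuous_intros)
qed simp

lemma circle_integral_power_cnj: "(\<integral>z. z ^ m * cnj z ^ n \<partial>circ) = (if m = n then 1 else 0)"
proof (cases "n \<le> m")
  case True
  then obtain k where k: "m = k + n" by (metis add.commute le_Suc_ex)
  have "(\<integral>z. z ^ m * cnj z ^ n \<partial>circ) = (\<integral>z. z ^ k \<partial>circ)"
    by (rule Bochner_Integration.integral_cong)
      (simp_all add: k power_add mult.assoc circle_mult_cnj flip: power_mult_distrib)
  then show ?thesis by (simp add: circle_integral_power k)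
next
  case False
  then obtain k where k: "n = k + m" by (metis add.commute le_Suc_ex nat_le_linear)
  have "(\<integral>z. z ^ m * cnj z ^ n \<partial>circ) = (\<integral>z. cnj (z ^ k) \<partial>circ)"
    by (rule Bochner_Integration.integral_cong)
      (simp_all add: k power_add mult.left_commute circle_mult_cnj flip: power_mult_distrib)
  also have "\<dots> = cnj (\<integral>z. z ^ k \<partial>circ)"
    by (rule integral_bounded_linear[OF bounded_linear_cnj])
      (intro circle_continuous_integrable continuous_intros)
  finally show ?thesis using False k by (simp add: circle_integral_power)
qed

lemma circle_integral_sum_product:
  assumes "finite A" "finite B"
  shows "(\<integral>z. (\<Sum>n\<in>A. c n * z ^ n) * cnj (\<Sum>n\<in>B. d n * z ^ n) \<partial>circ) = (\<Sum>n\<in>A \<inter> B. c n * cnj (d n))"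
proof -
  have "(\<integral>z. (\<Sum>n\<in>A. c n * z ^ n) * cnj (\<Sum>n\<in>B. d n * z ^ n) \<partial>circ) =
      (\<integral>z. (\<Sum>m\<in>A. \<Sum>n\<in>B. c m * cnj (d n) * (z ^ m * cnj z ^ n)) \<partial>circ)"
    by (simp add: sum_product cnj_sum mult_ac)
  also have "\<dots> = (\<Sum>m\<in>A. \<Sum>n\<in>B. c m * cnj (d n) * (\<integral>z. z ^ m * cnj z ^ n \<partial>circ))"
    by (subst Bochner_Integration.integral_sum Bochner_Integration.integral_mult_right_zero,
        (intro circle_continuous_integrable continuous_intros)?)+ simp
  also have "\<dots> = (\<Sum>n\<in>A \<inter> B. c n * cnj (d n))"
    by (simp add: circle_integral_power_cnj sum.inter_restrict[OF assms(1)] assms(2) if_distrib cong: if_cong)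
  finally show ?thesis .
qed

lemma circle_integral_norm_sum:
  assumes "finite A"
  shows "(\<integral>z. (norm (\<Sum>n\<in>A. c n * z ^ n))\<^sup>2 \<partial>circ) = (\<Sum>n\<in>A. (norm (c n))\<^sup>2)"
proof -
  have "complex_of_real (\<integral>z. (norm (\<Sum>n\<in>A. c n * z ^ n))\<^sup>2 \<partial>circ) =
      (\<integral>z. (\<Sum>n\<in>A. c n * z ^ n) * cnj (\<Sum>n\<in>A. c n * z ^ n) \<partial>circ)"
    unfolding complex_norm_square[symmetric]
    by (rule integral_bounded_linear[OF bounded_linear_of_real, symmetric])
      (intro circle_continuous_integrable continuous_intros)
  also have "\<dots> = of_real (\<Sum>n\<in>A. (norm (c n))\<^sup>2)"
    unfolding circle_integral_sum_product[OF assms assms] by (simp only: of_real_sum complex_norm_square Int_absorb)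
  finally show ?thesis by (simp only: of_real_eq_iff)
qed

section \<open>Square integrable functions on the circle\<close>

text \<open>Elements of L^2 are kept as functions rather than classes, because radial limits are
  concrete functions; equality almost everywhere is carried explicitly.\<close>

definition sq_int :: "(complex \<Rightarrow> complex) \<Rightarrow> bool" where
  "sq_int g \<longleftrightarrow> g \<in> borel_measurable circ \<and> integrable circ (\<lambda>z. (norm (g z))\<^sup>2)"

lemma sq_int_measurable: "sq_int g \<Longrightarrow> g \<in> borel_measurable circ" by (simp add: sq_int_def)

lemma sq_int_continuous: "continuous_on (sphere 0 1) g \<Longrightarrow> sq_int g"
  unfolding sq_int_def
  by (auto intro!: circle_continuous_measurable circle_continuous_integrable continuous_intros)

lemma sq_int_add:
  assumes "sq_int g" "sq_int h" shows "sq_int (\<lambda>z. g z + h z)"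
  unfolding sq_int_def
proof
  show [measurable]: "(\<lambda>z. g z + h z) \<in> borel_measurable circ"
    using assms by (auto simp: sq_int_def)
  show "integrable circ (\<lambda>z. (norm (g z + h z))\<^sup>2)"
    by (rule Bochner_Integration.integrable_bound[of _ "\<lambda>z. 2 * (norm (g z))\<^sup>2 + 2 * (norm (h z))\<^sup>2"])
      (use assms norm_add_sq_le in \<open>auto simp: sq_int_def\<close>)
qed

lemma sq_int_bounded_mult:
  assumes "sq_int g" "h \<in> borel_measurable circ" "AE z in circ. norm (h z) \<le> C"
  shows "sq_int (\<lambda>z. h z * g z)"
  unfolding sq_int_def
proof
  show [measurable]: "(\<lambda>z. h z * g z) \<in> borel_measurable circ"
    using assms by (auto simp: sq_int_def)
  have le: "(norm (x * y))\<^sup>2 \<le> C\<^sup>2 * (norm y)\<^sup>2" if "norm x \<le> C" for x y :: complex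
    unfolding norm_mult power_mult_distrib using that by (intro mult_right_mono power_mono) auto
  show "integrable circ (\<lambda>z. (norm (h z * g z))\<^sup>2)"
  proof (rule Bochner_Integration.integrable_bound)
    show "integrable circ (\<lambda>z. C\<^sup>2 * (norm (g z))\<^sup>2)" using assms(1) by (simp add: sq_int_def)
    show "AE z in circ. norm ((norm (h z * g z))\<^sup>2) \<le> norm (C\<^sup>2 * (norm (g z))\<^sup>2)"
      using assms(3) by eventually_elim (use le in simp)
  qed measurable
qed

lemma sq_int_scale: "sq_int g \<Longrightarrow> sq_int (\<lambda>z. c * g z)"
  by (rule sq_int_bounded_mult[where C = "norm c"]) auto

lemma sq_int_diff: "sq_int g \<Longrightarrow> sq_int h \<Longrightarrow> sq_int (\<lambda>z. g z - h z)"
  using sq_int_add[of g "\<lambda>z. -1 * h z"] sq_int_scale[of h "-1"] by simp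

lemma sq_int_cnj: "sq_int g \<Longrightarrow> sq_int (\<lambda>z. cnj (g z))"
  using measurable_compose[of g circ borel cnj borel] borel_measurable_continuous_onI[OF continuous_on_cnj[OF continuous_on_id]]
  by (simp add: sq_int_def)

lemma sq_int_product:
  assumes "sq_int g" "sq_int h" shows "integrable circ (\<lambda>z. g z * h z)"
  by (rule Bochner_Integration.integrable_bound[of _ "\<lambda>z. (norm (g z))\<^sup>2 + (norm (h z))\<^sup>2"])
    (use assms norm_mult_le_sq in \<open>auto simp: sq_int_def\<close>)

lemma sq_int_integrable: "sq_int g \<Longrightarrow> integrable circ g"
  using sq_int_product[of g "\<lambda>_. 1"] sq_int_continuous[of "\<lambda>_. 1"] by simp

section \<open>Parseval's identity and the Riesz--Fischer theorem\<close>

lemma circle_suminf: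
  fixes c :: "nat \<Rightarrow> complex" and \<phi> :: "nat \<Rightarrow> complex \<Rightarrow> complex"
  assumes c: "summable (\<lambda>n. norm (c n))"
    and \<phi>: "\<And>n. continuous_on (sphere 0 1) (\<phi> n)" "\<And>n z. z \<in> sphere 0 1 \<Longrightarrow> norm (\<phi> n z) \<le> B"
  shows "(\<lambda>n. c n * (\<integral>z. \<phi> n z \<partial>circ)) sums (\<integral>z. (\<Sum>n. c n * \<phi> n z) \<partial>circ)"
proof -
  have int: "integrable circ (\<lambda>z. c n * \<phi> n z)" for n
    by (intro circle_continuous_integrable continuous_intros \<phi>)
  have le: "norm (c n * \<phi> n z) \<le> norm (c n) * B" if "z \<in> sphere 0 1" for n z
    unfolding norm_mult by (intro mult_left_mono \<phi>(2) that) auto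
  have "(\<lambda>n. \<integral>z. c n * \<phi> n z \<partial>circ) sums (\<integral>z. (\<Sum>n. c n * \<phi> n z) \<partial>circ)"
  proof (rule sums_integral[OF int])
    have "summable (\<lambda>n. norm (c n * \<phi> n z))" if "z \<in> sphere 0 1" for z
      by (rule summable_comparison_test'[of "\<lambda>n. norm (c n) * B" 0])
        (use le[OF that] c in \<open>auto intro: summable_mult2\<close>)
    then show "AE z in circ. summable (\<lambda>n. norm (c n * \<phi> n z))" by (intro AE_I2) simp
    show "summable (\<lambda>n. \<integral>z. norm (c n * \<phi> n z) \<partial>circ)"
    proof (rule summable_comparison_test'[of "\<lambda>n. norm (c n) * B" 0])
      fix n
      have "(\<integral>z. norm (c n * \<phi> n z) \<partial>circ) \<le> (\<integral>z. norm (c n) * B \<partial>circ)"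
        by (intro Bochner_Integration.integral_mono int integrable_norm) (use le in auto)
      then show "norm (\<integral>z. norm (c n * \<phi> n z) \<partial>circ) \<le> norm (c n) * B" by simp
    qed (intro summable_mult2 c)
  qed
  then show ?thesis by simp
qed

lemma power_series_continuous_on_disc:
  fixes c :: "nat \<Rightarrow> complex"
  assumes "summable (\<lambda>n. norm (c n))"
  shows "continuous_on (cball 0 1) (\<lambda>z. \<Sum>n. c n * z ^ n)"
proof -
  have "uniform_limit (cball 0 1) (\<lambda>N z. \<Sum>n<N. c n * z ^ n) (\<lambda>z. \<Sum>n. c n * z ^ n) sequentially"
    by (rule Weierstrass_m_test[OF _ assms])
      (auto simp: norm_mult norm_power intro!: mult_left_le power_le_one)
  then show ?thesis
    by (rule uniform_limit_theorem[rotated]) (auto intro!: always_eventually continuous_intros)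
qed

text \<open>Absolute summability lets dominated convergence pass from the trigonometric polynomials
  to the series. This case covers the circles of radius below 1; general square summable
  coefficients are reached through L^2 limits.\<close>

lemma circle_parseval:
  fixes c :: "nat \<Rightarrow> complex"
  assumes c: "summable (\<lambda>n. norm (c n))"
  shows "(\<lambda>n. (norm (c n))\<^sup>2) sums (\<integral>z. (norm (\<Sum>n. c n * z ^ n))\<^sup>2 \<partial>circ)"
  unfolding sums_def circle_integral_norm_sum[OF finite_lessThan, symmetric]
proof (rule integral_dominated_convergence)
  let ?M = "\<Sum>n. norm (c n)"
  have cz: "summable (\<lambda>n. norm (c n * z ^ n))" if "z \<in> sphere 0 1" for z
    using that c by (simp add: norm_mult norm_power)
  show "(\<lambda>z. (norm (\<Sum>n. c n * z ^ n))\<^sup>2) \<in> borel_measurable circ"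
    by (intro circle_continuous_measurable continuous_intros
        continuous_on_subset[OF power_series_continuous_on_disc[OF c]]) auto
  show "(\<lambda>z. (norm (\<Sum>n<N. c n * z ^ n))\<^sup>2) \<in> borel_measurable circ" for N
    by (intro circle_continuous_measurable continuous_intros)
  show "integrable circ (\<lambda>_. ?M\<^sup>2)" by simp
  show "AE z in circ. (\<lambda>N. (norm (\<Sum>n<N. c n * z ^ n))\<^sup>2) \<longlonglongrightarrow> (norm (\<Sum>n. c n * z ^ n))\<^sup>2"
    by (intro AE_I2 tendsto_intros summable_LIMSEQ summable_norm_cancel[OF cz]) simp
  show "AE z in circ. norm ((norm (\<Sum>n<N. c n * z ^ n))\<^sup>2) \<le> ?M\<^sup>2" for N
  proof (intro AE_I2)
    fix z :: complex assume "z \<in> space circ"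
    then have z: "norm z = 1" by simp
    have "norm (\<Sum>n<N. c n * z ^ n) \<le> (\<Sum>n<N. norm (c n))"
      using norm_sum[of "\<lambda>n. c n * z ^ n" "{..<N}"] by (simp add: norm_mult norm_power z)
    also have "\<dots> \<le> ?M" by (rule sum_le_suminf[OF c]) auto
    finally show "norm ((norm (\<Sum>n<N. c n * z ^ n))\<^sup>2) \<le> ?M\<^sup>2" by (simp add: power_mono)
  qed
qed

text \<open>AM-GM with weight \<open>2^k\<close> turns geometric decay in \<open>L\<^sup>2\<close> into geometric decay in \<open>L\<^sup>1\<close>.\<close>

lemma riesz_fischer:
  fixes a :: "nat \<Rightarrow> complex"
  assumes a: "summable (\<lambda>n. (norm (a n))\<^sup>2)"
  obtains g where "sq_int g" "(\<lambda>N. \<integral>z. (norm ((\<Sum>n<N. a n * z ^ n) - g z))\<^sup>2 \<partial>circ) \<longlonglongrightarrow> 0"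
proof -
  define s where "s N z = (\<Sum>n<N. a n * z ^ n)" for N z
  define T where "T N = (\<Sum>n. (norm (a (n + N)))\<^sup>2)" for N
  have T0: "T \<longlonglongrightarrow> 0" unfolding T_def by (rule suminf_exist_split2[OF a])
  have s_cont: "continuous_on A (s N)" for N A unfolding s_def by (intro continuous_intros)
  have s_meas [measurable]: "s N \<in> borel_measurable circ" for N
    by (rule circle_continuous_measurable[OF s_cont])
  have s_diff: "(\<integral>z. (norm (s N z - s M z))\<^sup>2 \<partial>circ) \<le> T M" if "M \<le> N" for M N
  proof -
    have "s N z - s M z = (\<Sum>n\<in>{M..<N}. a n * z ^ n)" for z
      unfolding s_def using sum_diff_nat_ivl[of 0 M N "\<lambda>n. a n * z ^ n"] that
      by (simp add: atLeast0LessThan)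
    then have "(\<integral>z. (norm (s N z - s M z))\<^sup>2 \<partial>circ) = (\<Sum>n\<in>{M..<N}. (norm (a n))\<^sup>2)"
      by (simp add: circle_integral_norm_sum)
    also have "\<dots> = (\<Sum>n<N - M. (norm (a (n + M)))\<^sup>2)"
      using sum.shift_bounds_nat_ivl[of "\<lambda>n. (norm (a n))\<^sup>2" 0 M "N - M"] that
      by (simp add: atLeast0LessThan)
    also have "\<dots> \<le> T M"
      unfolding T_def by (intro sum_le_suminf summable_ignore_initial_segment a) auto
    finally show ?thesis .
  qed
  have "\<exists>N. \<forall>n\<ge>N. T n < (1/4) ^ k" for k
    using order_tendstoD(2)[OF T0, of "(1/4) ^ k"] by (simp add: eventually_sequentially)
  then obtain m where m: "\<And>k n. n \<ge> m k \<Longrightarrow> T n < (1/4) ^ k" by metis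
  \<comment> \<open>Adding up the thresholds gives a monotone subsequence that still lies beyond m
    k, along which the squared L^2 tails are below 4^(-k).\<close>
  define M where "M k = (\<Sum>i\<le>k. m i)" for k
  have MT: "T (M k) < (1/4) ^ k" for k
    by (rule m) (simp add: M_def member_le_sum)
  have Mmono: "M k \<le> M (Suc k)" for k by (simp add: M_def)
  define d where "d k z = s (M (Suc k)) z - s (M k) z" for k z
  have d_meas [measurable]: "d k \<in> borel_measurable circ" for k unfolding d_def by measurable
  have d_int: "integrable circ (\<lambda>z. norm (d k z))" "integrable circ (\<lambda>z. (norm (d k z))\<^sup>2)" for k
    unfolding d_def by (intro circle_continuous_integrable continuous_intros s_cont)+
  have dL1: "(\<integral>z. norm (d k z) \<partial>circ) \<le> 2 * (1/2) ^ k" for k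
  proof -
    have amgm: "x \<le> 2 ^ k * x\<^sup>2 + (1/2) ^ k" for x :: real
    proof -
      have "0 \<le> 2 ^ k * (x - (1/2) ^ k / 2)\<^sup>2" by simp
      also have "\<dots> = 2 ^ k * x\<^sup>2 - x + (1/2) ^ k / 4"
        by (simp add: power2_eq_square field_simps flip: power_mult_distrib)
      finally have "0 \<le> 2 ^ k * x\<^sup>2 - x + (1/2) ^ k / 4" .
      moreover have "(0::real) < (1/2) ^ k" by simp
      ultimately show ?thesis by linarith
    qed
    have "(\<integral>z. norm (d k z) \<partial>circ) \<le> (\<integral>z. 2 ^ k * (norm (d k z))\<^sup>2 + (1/2) ^ k \<partial>circ)"
      using d_int[of k] amgm by (intro Bochner_Integration.integral_mono) auto
    also have "\<dots> = 2 ^ k * (\<integral>z. (norm (d k z))\<^sup>2 \<partial>circ) + (1/2) ^ k"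
      using d_int[of k] by simp
    also have "\<dots> \<le> 2 ^ k * (1/4) ^ k + (1/2) ^ k"
      using s_diff[OF Mmono, of k] MT[of k] unfolding d_def by (intro add_right_mono mult_left_mono) auto
    also have "\<dots> = 2 * (1/2) ^ k" by (simp flip: power_mult_distrib)
    finally show ?thesis .
  qed
  have "AE z in circ. summable (\<lambda>k. norm (d k z))"
  proof -
    have "(\<integral>\<^sup>+z. (\<Sum>k. ennreal (norm (d k z))) \<partial>circ) = (\<Sum>k. \<integral>\<^sup>+z. ennreal (norm (d k z)) \<partial>circ)"
      by (rule nn_integral_suminf) measurable
    also have "\<dots> = (\<Sum>k. ennreal (\<integral>z. norm (d k z) \<partial>circ))"
      using d_int(1) by (intro suminf_cong nn_integral_eq_integral) auto
    also have "\<dots> \<le> (\<Sum>k. ennreal (2 * (1/2) ^ k))"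
      by (intro suminf_le) (auto intro!: ennreal_leI dL1)
    also have "\<dots> = ennreal (\<Sum>k. 2 * (1/2) ^ k)"
      by (intro suminf_ennreal2 summable_mult summable_geometric) auto
    also have "\<dots> < \<infinity>" by simp
    finally have "AE z in circ. (\<Sum>k. ennreal (norm (d k z))) \<noteq> \<infinity>"
      by (intro nn_integral_noteq_infinite) auto
    then show ?thesis
      by eventually_elim (auto intro!: summable_suminf_not_top)
  qed
  \<comment> \<open>\<open>lim\<close> is total and measurable; it is the true limit wherever the
    telescoping series converges, hence almost everywhere.\<close>
  define g where "g z = lim (\<lambda>k. s (M k) z)" for z
  have g_meas [measurable]: "g \<in> borel_measurable circ" unfolding g_def by measurable
  have lim_g: "AE z in circ. (\<lambda>k. s (M k) z) \<longlonglongrightarrow> g z"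
    using \<open>AE z in circ. summable (\<lambda>k. norm (d k z))\<close>
  proof eventually_elim
    fix z assume "summable (\<lambda>k. norm (d k z))"
    then have "summable (\<lambda>k. d k z)" by (rule summable_norm_cancel)
    then have "convergent (\<lambda>n. \<Sum>k<n. d k z)" by (simp add: summable_iff_convergent)
    then have "convergent (\<lambda>n. (\<Sum>k<n. d k z) + s (M 0) z)" by (intro convergent_add convergent_const)
    also have "(\<lambda>n. (\<Sum>k<n. d k z) + s (M 0) z) = (\<lambda>n. s (M n) z)"
      unfolding d_def using sum_lessThan_telescope[of "\<lambda>k. s (M k) z"] by simp
    finally show "(\<lambda>k. s (M k) z) \<longlonglongrightarrow> g z"
      by (simp add: g_def convergent_LIMSEQ_iff)
  qed
  \<comment> \<open>Fatou's lemma turns the pointwise limit along the subsequence into an L^2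
    estimate for the whole sequence of partial sums.\<close>
  have bound: "(\<integral>\<^sup>+z. ennreal ((norm (s N z - g z))\<^sup>2) \<partial>circ) \<le> ennreal (T N)" for N
  proof -
    have "(\<integral>\<^sup>+z. ennreal ((norm (s N z - g z))\<^sup>2) \<partial>circ) =
        (\<integral>\<^sup>+z. liminf (\<lambda>k. ennreal ((norm (s N z - s (M k) z))\<^sup>2)) \<partial>circ)"
    proof (rule nn_integral_cong_AE, use lim_g in eventually_elim)
      fix z assume "(\<lambda>k. s (M k) z) \<longlonglongrightarrow> g z"
      then have "(\<lambda>k. ennreal ((norm (s N z - s (M k) z))\<^sup>2)) \<longlonglongrightarrow> ennreal ((norm (s N z - g z))\<^sup>2)"
        by (intro tendsto_ennrealI tendsto_intros)
      then show "ennreal ((norm (s N z - g z))\<^sup>2) = liminf (\<lambda>k. ennreal ((norm (s N z - s (M k) z))\<^sup>2))"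
        by (intro lim_imp_Liminf[symmetric]) simp_all
    qed
    also have "\<dots> \<le> liminf (\<lambda>k. \<integral>\<^sup>+z. ennreal ((norm (s N z - s (M k) z))\<^sup>2) \<partial>circ)"
      by (rule nn_integral_liminf) measurable
    \<comment> \<open>The maximum covers both orders of N and M k; its second argument tends to
      0.\<close>
    also have "\<dots> \<le> liminf (\<lambda>k. ennreal (max (T N) (T (M k))))"
    proof (intro Liminf_mono always_eventually allI)
      fix k
      have "(\<integral>\<^sup>+z. ennreal ((norm (s N z - s (M k) z))\<^sup>2) \<partial>circ) =
          ennreal (\<integral>z. (norm (s N z - s (M k) z))\<^sup>2 \<partial>circ)"
        by (intro nn_integral_eq_integral circle_continuous_integrable continuous_intros s_cont) auto
      also have "(\<integral>z. (norm (s N z - s (M k) z))\<^sup>2 \<partial>circ) \<le> max (T N) (T (M k))"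
        using s_diff[of N "M k"] s_diff[of "M k" N]
        by (cases "N \<le> M k") (auto simp: norm_minus_commute[of "s N _"] max_def)
      finally show "(\<integral>\<^sup>+z. ennreal ((norm (s N z - s (M k) z))\<^sup>2) \<partial>circ) \<le> ennreal (max (T N) (T (M k)))"
        by (simp add: ennreal_leI)
    qed
    also have "\<dots> = ennreal (T N)"
    proof (rule lim_imp_Liminf)
      have "(\<lambda>k. T (M k)) \<longlonglongrightarrow> 0"
      proof (rule tendsto_sandwich[OF _ _ tendsto_const])
        show "\<forall>\<^sub>F k in sequentially. 0 \<le> T (M k)"
          unfolding T_def by (intro always_eventually allI suminf_nonneg summable_ignore_initial_segment a) auto
        show "\<forall>\<^sub>F k in sequentially. T (M k) \<le> (1/4) ^ k" using MT by (simp add: less_imp_le)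
        show "(\<lambda>k. (1/4::real) ^ k) \<longlonglongrightarrow> 0" by (rule LIMSEQ_realpow_zero) auto
      qed
      then have "(\<lambda>k. ennreal (max (T N) (T (M k)))) \<longlonglongrightarrow> ennreal (max (T N) 0)"
        by (intro tendsto_ennrealI tendsto_intros)
      moreover have "T N \<ge> 0"
        unfolding T_def by (intro suminf_nonneg summable_ignore_initial_segment a) auto
      ultimately show "(\<lambda>k. ennreal (max (T N) (T (M k)))) \<longlonglongrightarrow> ennreal (T N)"
        by (simp add: max_def)
    qed simp
    finally show ?thesis .
  qed
  have int: "integrable circ (\<lambda>z. (norm (s N z - g z))\<^sup>2)" for N
    by (rule integrableI_bounded) (use bound[of N] in \<open>auto simp: le_less_trans\<close>)
  have Tpos: "0 \<le> T N" for N
    unfolding T_def by (intro suminf_nonneg summable_ignore_initial_segment a) auto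
  have le: "(\<integral>z. (norm (s N z - g z))\<^sup>2 \<partial>circ) \<le> T N" for N
    using bound[of N] Tpos[of N] nn_integral_eq_integral[OF int[of N]] by simp
  have "sq_int g"
    using int[of 0] by (simp add: sq_int_def s_def)
  moreover have "(\<lambda>N. \<integral>z. (norm (s N z - g z))\<^sup>2 \<partial>circ) \<longlonglongrightarrow> 0"
    by (rule tendsto_sandwich[OF _ _ tendsto_const T0]) (use le in auto)
  ultimately show ?thesis using that unfolding s_def by blast
qed

lemma amgm_mult:
  fixes x y :: complex
  assumes "e > 0"
  shows "norm (x * y) \<le> (norm x)\<^sup>2 / e + e * (norm y)\<^sup>2"
proof -
  have "0 \<le> (norm x / sqrt e - sqrt e * norm y)\<^sup>2" by simp
  also have "\<dots> = (norm x)\<^sup>2 / e + e * (norm y)\<^sup>2 - 2 * (norm x * norm y)"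
    using assms by (simp add: power2_diff power_divide power_mult_distrib)
  finally have "2 * (norm x * norm y) \<le> (norm x)\<^sup>2 / e + e * (norm y)\<^sup>2" by simp
  moreover have "0 \<le> norm x * norm y" by simp
  ultimately show ?thesis unfolding norm_mult by linarith
qed

text \<open>Plays the part of the Cauchy-Schwarz inequality: by weighted AM-GM the integral is at
  most (integral of |u|^2) / d + d V, where d is fixed first and N then grows.\<close>

lemma L2_null_product:
  assumes u: "\<And>N. sq_int (u N)" and v: "sq_int v"
    and lim: "(\<lambda>N. \<integral>z. (norm (u N z))\<^sup>2 \<partial>circ) \<longlonglongrightarrow> 0"
  shows "(\<lambda>N. \<integral>z. norm (u N z * v z) \<partial>circ) \<longlonglongrightarrow> 0"
proof (rule LIMSEQ_I)
  fix e :: real assume "e > 0"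
  define V where "V = (\<integral>z. (norm (v z))\<^sup>2 \<partial>circ)"
  have V: "V \<ge> 0" unfolding V_def by simp
  \<comment> \<open>With V + 1 in the denominator, d V stays below e / 2 even when V = 0.\<close>
  define d where "d = e / (2 * (V + 1))"
  have d: "d > 0" "d * V < e / 2" using V \<open>e > 0\<close> by (auto simp: d_def field_simps)
  have le: "(\<integral>z. norm (u N z * v z) \<partial>circ) \<le> (\<integral>z. (norm (u N z))\<^sup>2 \<partial>circ) / d + d * V" for N
  proof -
    have "(\<integral>z. norm (u N z * v z) \<partial>circ) \<le> (\<integral>z. (norm (u N z))\<^sup>2 / d + d * (norm (v z))\<^sup>2 \<partial>circ)"
      using u[of N] v amgm_mult[OF d(1)] sq_int_product[OF u v]
      by (intro Bochner_Integration.integral_mono) (auto simp: sq_int_def)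
    also have "\<dots> = (\<integral>z. (norm (u N z))\<^sup>2 \<partial>circ) / d + d * V"
      using u[of N] v by (simp add: sq_int_def V_def)
    finally show ?thesis .
  qed
  have "d * (e/2) > 0" using d \<open>e > 0\<close> by simp
  from LIMSEQ_D[OF lim this] obtain N0 where
    N0: "\<And>N. N \<ge> N0 \<Longrightarrow> \<bar>\<integral>z. (norm (u N z))\<^sup>2 \<partial>circ\<bar> < d * (e/2)" by auto
  have "norm ((\<integral>z. norm (u N z * v z) \<partial>circ) - 0) < e" if "N \<ge> N0" for N
  proof -
    have "(\<integral>z. (norm (u N z))\<^sup>2 \<partial>circ) / d < e/2" using N0[OF that] d(1) by (simp add: field_simps)
    then have "(\<integral>z. norm (u N z * v z) \<partial>circ) < e" using le[of N] d(2) by linarith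
    then show ?thesis by simp
  qed
  then show "\<exists>no. \<forall>n\<ge>no. norm ((\<integral>z. norm (u n z * v z) \<partial>circ) - 0) < e" by blast
qed

text \<open>Expand |s|^2 as |g|^2 + |s - g|^2 + 2 Re ((s - g) conj g); the mixed term tends to 0 by
  \<open>L2_null_product\<close>.\<close>

lemma L2_norm_limit:
  assumes s: "\<And>N. sq_int (s N)" and g: "sq_int g"
    and lim: "(\<lambda>N. \<integral>z. (norm (s N z - g z))\<^sup>2 \<partial>circ) \<longlonglongrightarrow> 0"
  shows "(\<lambda>N. \<integral>z. (norm (s N z))\<^sup>2 \<partial>circ) \<longlonglongrightarrow> (\<integral>z. (norm (g z))\<^sup>2 \<partial>circ)"
proof -
  have sg: "sq_int (\<lambda>z. s N z - g z)" for N by (intro sq_int_diff s g)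
  have eq: "(norm x)\<^sup>2 = (norm y)\<^sup>2 + (norm (x - y))\<^sup>2 + 2 * Re ((x - y) * cnj y)" for x y :: complex
    unfolding cmod_power2 by (simp add: power2_eq_square algebra_simps)
  have "(\<lambda>N. \<integral>z. norm ((s N z - g z) * cnj (g z)) \<partial>circ) \<longlonglongrightarrow> 0"
    by (rule L2_null_product[OF sg sq_int_cnj[OF g] lim])
  then have null: "(\<lambda>N. \<integral>z. Re ((s N z - g z) * cnj (g z)) \<partial>circ) \<longlonglongrightarrow> 0"
  proof (rule Lim_null_comparison[rotated], intro always_eventually allI)
    fix N
    have int: "integrable circ (\<lambda>z. (s N z - g z) * cnj (g z))" by (intro sq_int_product sg sq_int_cnj g)
    have "norm (\<integral>z. Re ((s N z - g z) * cnj (g z)) \<partial>circ) \<le> (\<integral>z. norm (Re ((s N z - g z) * cnj (g z))) \<partial>circ)"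
      by (rule integral_norm_bound)
    also have "\<dots> \<le> (\<integral>z. norm ((s N z - g z) * cnj (g z)) \<partial>circ)"
      by (intro Bochner_Integration.integral_mono integrable_norm integrable_Re int)
        (simp only: real_norm_def abs_Re_le_cmod)
    finally show "norm (\<integral>z. Re ((s N z - g z) * cnj (g z)) \<partial>circ) \<le>
      (\<integral>z. norm ((s N z - g z) * cnj (g z)) \<partial>circ)" .
  qed
  have "(\<integral>z. (norm (s N z))\<^sup>2 \<partial>circ) = (\<integral>z. (norm (g z))\<^sup>2 \<partial>circ) +
      (\<integral>z. (norm (s N z - g z))\<^sup>2 \<partial>circ) + 2 * (\<integral>z. Re ((s N z - g z) * cnj (g z)) \<partial>circ)" for N
  proof -
    have "integrable circ (\<lambda>z. Re ((s N z - g z) * cnj (g z)))"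
      by (intro integrable_Re sq_int_product sg sq_int_cnj g)
    moreover have "integrable circ (\<lambda>z. (norm (s N z - g z))\<^sup>2)" "integrable circ (\<lambda>z. (norm (g z))\<^sup>2)"
      using sg g by (auto simp: sq_int_def)
    moreover have "(\<integral>z. (norm (s N z))\<^sup>2 \<partial>circ) =
        (\<integral>z. (norm (g z))\<^sup>2 + (norm (s N z - g z))\<^sup>2 + 2 * Re ((s N z - g z) * cnj (g z)) \<partial>circ)"
      by (intro Bochner_Integration.integral_cong refl eq)
    ultimately show ?thesis by (simp del: times_complex.simps minus_complex.simps)
  qed
  moreover have "(\<lambda>N. (\<integral>z. (norm (g z))\<^sup>2 \<partial>circ) +
      (\<integral>z. (norm (s N z - g z))\<^sup>2 \<partial>circ) + 2 * (\<integral>z. Re ((s N z - g z) * cnj (g z)) \<partial>circ))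
      \<longlonglongrightarrow> (\<integral>z. (norm (g z))\<^sup>2 \<partial>circ) + 0 + 2 * 0"
    by (intro tendsto_intros lim null)
  ultimately show ?thesis by simp
qed

section \<open>The derivative of the Poisson kernel\<close>

lemma of_nat_power_sums:
  fixes w :: "'a::{real_normed_field, banach}"
  assumes "norm w < 1"
  shows "(\<lambda>n. of_nat n * w ^ n) sums (w / (1 - w)\<^sup>2)"
proof -
  have "(\<lambda>n. w * (of_nat (Suc n) * w ^ n)) sums (w * (1 / (1 - w)\<^sup>2))"
    by (rule sums_mult[OF geometric_deriv_sums[OF assms]])
  then have "(\<lambda>n. of_nat (Suc n) * w ^ Suc n) sums (w / (1 - w)\<^sup>2)" by (simp add: mult_ac)
  then show ?thesis by (subst (asm) sums_Suc_iff) simp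
qed

text \<open>Up to the factor \<open>-\<i>\<close> this is the angular derivative of the Poisson kernel.\<close>

definition dpoisson :: "complex \<Rightarrow> complex \<Rightarrow> complex" where
  "dpoisson z \<zeta> = z * cnj \<zeta> / (1 - z * cnj \<zeta>)\<^sup>2 - cnj (z * cnj \<zeta> / (1 - z * cnj \<zeta>)\<^sup>2)"

lemma one_minus_nonzero: "norm (w::complex) < 1 \<Longrightarrow> 1 - w \<noteq> 0" by auto

lemma norm_mult_cnj_circle: "\<zeta> \<in> sphere 0 1 \<Longrightarrow> norm (z * cnj \<zeta>) = norm z"
  by (simp add: norm_mult)

lemma mult_cnj_circle_neq_1: "norm z < 1 \<Longrightarrow> \<zeta> \<in> sphere 0 1 \<Longrightarrow> z * cnj \<zeta> \<noteq> 1"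
  using norm_mult_cnj_circle[of \<zeta> z] by auto

lemma dpoisson_continuous:
  assumes "norm z < 1"
  shows "continuous_on (sphere 0 1) (dpoisson z)"
  unfolding dpoisson_def
  by (intro continuous_intros) (use mult_cnj_circle_neq_1[OF assms] in auto)

lemma summable_norm_of_nat_power:
  fixes z :: complex
  assumes "norm z < 1"
  shows "summable (\<lambda>n. norm (of_nat n * z ^ n))"
  using sums_summable[OF of_nat_power_sums[of "norm z"]] assms by (simp add: norm_mult norm_power)

text \<open>Expanding both fractions of the kernel in powers, orthonormality picks n z^n from the
  first one, while the conjugate one contains just nonnegative powers of \<zeta> and contributes
  nothing.\<close>

lemma integral_power_dpoisson:
  assumes z: "norm z < 1"
  shows "(\<integral>\<zeta>. \<zeta> ^ n * dpoisson z \<zeta> \<partial>circ) = of_nat n * z ^ n"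
proof -
  define k where "k \<zeta> = z * cnj \<zeta> / (1 - z * cnj \<zeta>)\<^sup>2" for \<zeta>
  have kc: "continuous_on (sphere 0 1) k"
    unfolding k_def
    by (intro continuous_intros) (use mult_cnj_circle_neq_1[OF assms] in auto)
  have k_sums: "(\<lambda>m. of_nat m * z ^ m * cnj \<zeta> ^ m) sums k \<zeta>" if "\<zeta> \<in> sphere 0 1" for \<zeta>
    using of_nat_power_sums[of "z * cnj \<zeta>"] z norm_mult_cnj_circle[OF that, of z]
    by (simp add: k_def power_mult_distrib mult_ac)
  have "(\<lambda>m. of_nat m * z ^ m * (\<integral>\<zeta>. \<zeta> ^ n * cnj \<zeta> ^ m \<partial>circ)) sums
      (\<integral>\<zeta>. (\<Sum>m. of_nat m * z ^ m * (\<zeta> ^ n * cnj \<zeta> ^ m)) \<partial>circ)"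
    by (rule circle_suminf[where B = 1, OF summable_norm_of_nat_power[OF z]])
      (auto intro!: continuous_intros simp: norm_mult norm_power)
  moreover have "(\<integral>\<zeta>. (\<Sum>m. of_nat m * z ^ m * (\<zeta> ^ n * cnj \<zeta> ^ m)) \<partial>circ) = (\<integral>\<zeta>. \<zeta> ^ n * k \<zeta> \<partial>circ)"
  proof (rule Bochner_Integration.integral_cong[OF refl])
    fix \<zeta> :: complex assume "\<zeta> \<in> space circ"
    then have "(\<lambda>m. \<zeta> ^ n * (of_nat m * z ^ m * cnj \<zeta> ^ m)) sums (\<zeta> ^ n * k \<zeta>)"
      by (intro sums_mult k_sums) simp
    then show "(\<Sum>m. of_nat m * z ^ m * (\<zeta> ^ n * cnj \<zeta> ^ m)) = \<zeta> ^ n * k \<zeta>"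
      by (simp add: sums_iff mult_ac)
  qed
  moreover have "(\<lambda>m. of_nat m * z ^ m * (\<integral>\<zeta>. \<zeta> ^ n * cnj \<zeta> ^ m \<partial>circ)) sums (of_nat n * z ^ n)"
    using sums_single[of n "\<lambda>m. of_nat m * z ^ m"]
    by (simp add: circle_integral_power_cnj if_distrib eq_commute[of n] cong: if_cong)
  ultimately have A: "(\<integral>\<zeta>. \<zeta> ^ n * k \<zeta> \<partial>circ) = of_nat n * z ^ n"
    by (simp add: sums_iff)
  have zc: "norm (cnj z) < 1" using z by simp
  have "(\<lambda>m. of_nat m * cnj z ^ m * (\<integral>\<zeta>. \<zeta> ^ (n + m) \<partial>circ)) sums
      (\<integral>\<zeta>. (\<Sum>m. of_nat m * cnj z ^ m * \<zeta> ^ (n + m)) \<partial>circ)"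
    by (rule circle_suminf[where B = 1, OF summable_norm_of_nat_power[OF zc]])
      (auto intro!: continuous_intros simp: norm_mult norm_power)
  moreover have "(\<integral>\<zeta>. (\<Sum>m. of_nat m * cnj z ^ m * \<zeta> ^ (n + m)) \<partial>circ) = (\<integral>\<zeta>. \<zeta> ^ n * cnj (k \<zeta>) \<partial>circ)"
  proof (rule Bochner_Integration.integral_cong[OF refl])
    fix \<zeta> :: complex assume "\<zeta> \<in> space circ"
    then have "(\<lambda>m. \<zeta> ^ n * cnj (of_nat m * z ^ m * cnj \<zeta> ^ m)) sums (\<zeta> ^ n * cnj (k \<zeta>))"
      by (intro sums_mult) (simp only: sums_cnj k_sums space_circle)
    then show "(\<Sum>m. of_nat m * cnj z ^ m * \<zeta> ^ (n + m)) = \<zeta> ^ n * cnj (k \<zeta>)"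
      by (simp add: sums_iff mult_ac power_add)
  qed
  \<comment> \<open>For m = 0 the coefficient vanishes, which covers n = 0; for m > 0 the exponent n
    + m is positive.\<close>
  moreover have "of_nat m * cnj z ^ m * (\<integral>\<zeta>. \<zeta> ^ (n + m) \<partial>circ) = 0" for m
    by (simp add: circle_integral_power)
  ultimately have B: "(\<integral>\<zeta>. \<zeta> ^ n * cnj (k \<zeta>) \<partial>circ) = 0"
    by (simp add: sums_iff)
  have "(\<integral>\<zeta>. \<zeta> ^ n * dpoisson z \<zeta> \<partial>circ) = (\<integral>\<zeta>. \<zeta> ^ n * k \<zeta> - \<zeta> ^ n * cnj (k \<zeta>) \<partial>circ)"
    by (simp add: dpoisson_def k_def algebra_simps)
  also have "\<dots> = (\<integral>\<zeta>. \<zeta> ^ n * k \<zeta> \<partial>circ) - (\<integral>\<zeta>. \<zeta> ^ n * cnj (k \<zeta>) \<partial>circ)"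
    by (intro Bochner_Integration.integral_diff circle_continuous_integrable continuous_intros kc)
  finally show ?thesis by (simp add: A B)
qed

text \<open>For coefficients of the form a_n / n this recovers the series of a_n z^n except for its
  constant term.\<close>

lemma integral_series_dpoisson:
  fixes c :: "nat \<Rightarrow> complex"
  assumes c: "summable (\<lambda>n. norm (c n))" and z: "norm z < 1"
  shows "(\<lambda>n. of_nat n * c n * z ^ n) sums (\<integral>\<zeta>. (\<Sum>n. c n * \<zeta> ^ n) * dpoisson z \<zeta> \<partial>circ)"
proof -
  have "compact (dpoisson z ` sphere 0 1)"
    using dpoisson_continuous[OF z] by (intro compact_continuous_image) auto
  then obtain B where B: "\<And>\<zeta>. \<zeta> \<in> sphere 0 1 \<Longrightarrow> norm (dpoisson z \<zeta>) \<le> B"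
    by (meson compact_imp_bounded bounded_iff imageI)
  have "(\<lambda>n. c n * (\<integral>\<zeta>. \<zeta> ^ n * dpoisson z \<zeta> \<partial>circ)) sums
      (\<integral>\<zeta>. (\<Sum>n. c n * (\<zeta> ^ n * dpoisson z \<zeta>)) \<partial>circ)"
    by (rule circle_suminf[where B = B, OF c])
      (auto intro!: continuous_intros dpoisson_continuous[OF z] B simp: norm_mult norm_power)
  moreover have "(\<integral>\<zeta>. (\<Sum>n. c n * (\<zeta> ^ n * dpoisson z \<zeta>)) \<partial>circ) =
      (\<integral>\<zeta>. (\<Sum>n. c n * \<zeta> ^ n) * dpoisson z \<zeta> \<partial>circ)"
  proof (rule Bochner_Integration.integral_cong[OF refl])
    fix \<zeta> :: complex assume "\<zeta> \<in> space circ"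
    then have "summable (\<lambda>n. norm (c n * \<zeta> ^ n))" using c by (simp add: norm_mult norm_power)
    then have "summable (\<lambda>n. c n * \<zeta> ^ n)" by (rule summable_norm_cancel)
    then show "(\<Sum>n. c n * (\<zeta> ^ n * dpoisson z \<zeta>)) = (\<Sum>n. c n * \<zeta> ^ n) * dpoisson z \<zeta>"
      unfolding mult.assoc[symmetric] by (rule suminf_mult2[symmetric])
  qed
  ultimately show ?thesis unfolding integral_power_dpoisson[OF z] by (simp only: mult_ac)
qed

text \<open>With w = z conj \<zeta>, the two fractions combine to (w - conj w)(1 - |w|^2) / |1 -
  w|^4, and |w - conj w| is at most 2 norm (\<zeta> - \<zeta>0). This factor, vanishing at \<zeta>0,
  is what makes the kernel integrable against functions of order o(norm (\<zeta> - \<zeta>0)),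
  uniformly in r.\<close>

lemma norm_dpoisson_le:
  assumes r: "0 \<le> r" "r < 1" and \<zeta>: "norm \<zeta> = 1" "norm \<zeta>0 = 1"
  shows "norm (dpoisson (of_real r * \<zeta>0) \<zeta>) \<le>
    2 * (1 - r\<^sup>2) * norm (\<zeta> - \<zeta>0) / (norm (\<zeta> - of_real r * \<zeta>0)) ^ 4"
proof -
  define u where "u = \<zeta>0 * cnj \<zeta>"
  define w where "w = of_real r * u"
  have u: "norm u = 1" by (simp add: u_def norm_mult \<zeta>)
  have w: "norm w = r" using r by (simp add: w_def norm_mult u)
  have ne: "1 - w \<noteq> 0" using w r one_minus_nonzero by simp
  have ww: "w * cnj w = of_real (r\<^sup>2)" by (metis complex_norm_square w)
  have ne': "1 - cnj w \<noteq> 0" using ne by (metis complex_cnj_cancel_iff complex_cnj_diff complex_cnj_one complex_cnj_zero)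
  have "dpoisson (of_real r * \<zeta>0) \<zeta> = w / (1 - w)\<^sup>2 - cnj w / (1 - cnj w)\<^sup>2"
    by (simp add: dpoisson_def w_def u_def mult_ac)
  also have "\<dots> = (w * (1 - cnj w)\<^sup>2 - cnj w * (1 - w)\<^sup>2) / ((1 - w)\<^sup>2 * (1 - cnj w)\<^sup>2)"
    using ne ne' by (simp add: diff_frac_eq)
  also have "w * (1 - cnj w)\<^sup>2 - cnj w * (1 - w)\<^sup>2 = (w - cnj w) * (1 - w * cnj w)"
    by (simp add: power2_eq_square algebra_simps)
  finally have "norm (dpoisson (of_real r * \<zeta>0) \<zeta>) =
      norm (w - cnj w) * norm (1 - complex_of_real (r\<^sup>2)) / (norm (1 - w) ^ 2 * norm (1 - cnj w) ^ 2)"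
    by (simp add: norm_mult norm_divide norm_power ww)
  also have "norm (1 - complex_of_real (r\<^sup>2)) = 1 - r\<^sup>2"
    using r by (metis abs_of_nonneg diff_ge_0_iff_ge norm_of_real of_real_1 of_real_diff power_le_one less_imp_le)
  also have "norm (1 - cnj w) = norm (1 - w)"
    by (metis complex_cnj_diff complex_cnj_one complex_mod_cnj)
  also have "norm (1 - w) = norm (\<zeta> - of_real r * \<zeta>0)"
  proof -
    have "\<zeta> * (1 - w) = \<zeta> - of_real r * \<zeta>0"
      using circle_mult_cnj[of \<zeta>] \<zeta> by (simp add: w_def u_def algebra_simps)
    then show ?thesis by (metis \<zeta>(1) mult_1 norm_mult)
  qed
  finally have eq: "norm (dpoisson (of_real r * \<zeta>0) \<zeta>) =
    norm (w - cnj w) * (1 - r\<^sup>2) / norm (\<zeta> - of_real r * \<zeta>0) ^ 4"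
    by (simp flip: power_add)
  have "norm (w - cnj w) = r * norm ((u - 1) - cnj (u - 1))"
    using r by (simp add: w_def norm_mult flip: right_diff_distrib)
  also have "\<dots> \<le> 1 * (norm (u - 1) + norm (cnj (u - 1)))"
    using r by (intro mult_mono norm_triangle_ineq4) auto
  also have "\<dots> = 2 * norm (u - 1)" unfolding complex_mod_cnj by simp
  also have "u - 1 = (\<zeta>0 - \<zeta>) * cnj \<zeta>"
    using circle_mult_cnj[of \<zeta>] \<zeta> by (simp add: u_def algebra_simps)
  finally have "norm (w - cnj w) \<le> 2 * norm (\<zeta> - \<zeta>0)"
    using \<zeta> by (simp add: norm_mult norm_minus_commute)
  then have "norm (w - cnj w) * (1 - r\<^sup>2) \<le> 2 * norm (\<zeta> - \<zeta>0) * (1 - r\<^sup>2)"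
    using r by (intro mult_right_mono) (auto simp: power_le_one)
  then have "norm (w - cnj w) * (1 - r\<^sup>2) \<le> 2 * (1 - r\<^sup>2) * norm (\<zeta> - \<zeta>0)"
    by (simp only: mult_ac)
  then show ?thesis unfolding eq by (intro divide_right_mono) simp_all
qed

text \<open>Parseval for the geometric series with coefficients (conj z)^n, whose sum 1 / (1 - conj
  z \<zeta>) has modulus 1 / norm (\<zeta> - z) on the circle.\<close>

lemma poisson_integral:
  assumes z: "norm z < 1"
  shows "(\<integral>\<zeta>. 1 / (norm (\<zeta> - z))\<^sup>2 \<partial>circ) = 1 / (1 - (norm z)\<^sup>2)"
    and "continuous_on (sphere 0 1) (\<lambda>\<zeta>. 1 / (norm (\<zeta> - z))\<^sup>2)"
proof -
  have c: "summable (\<lambda>n. norm (cnj z ^ n))" using z by (simp add: norm_power summable_geometric)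
  have z2: "norm ((norm z)\<^sup>2) < 1" using z by (simp add: power_less_one_iff)
  have "(norm (\<Sum>n. cnj z ^ n * \<zeta> ^ n))\<^sup>2 = 1 / (norm (\<zeta> - z))\<^sup>2" if "\<zeta> \<in> sphere 0 1" for \<zeta>
  proof -
    have "norm (cnj z * \<zeta>) < 1" using z that by (simp add: norm_mult)
    then have "(\<Sum>n. cnj z ^ n * \<zeta> ^ n) = 1 / (1 - cnj z * \<zeta>)"
      by (simp add: suminf_geometric flip: power_mult_distrib)
    moreover have "norm (1 - cnj z * \<zeta>) = norm (\<zeta> - z)"
    proof -
      have "cnj (1 - cnj z * \<zeta>) * \<zeta> = \<zeta> - z"
        using circle_mult_cnj[OF that] by (simp add: algebra_simps)
      then show ?thesis using that by (metis complex_mod_cnj mult.right_neutral norm_mult norm_circle)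
    qed
    ultimately show ?thesis by (simp add: norm_divide power_divide)
  qed
  then have "(\<integral>\<zeta>. (norm (\<Sum>n. cnj z ^ n * \<zeta> ^ n))\<^sup>2 \<partial>circ) = (\<integral>\<zeta>. 1 / (norm (\<zeta> - z))\<^sup>2 \<partial>circ)"
    by (intro Bochner_Integration.integral_cong) auto
  moreover have "(\<lambda>n. (norm (cnj z ^ n))\<^sup>2) sums (1 / (1 - (norm z)\<^sup>2))"
    using geometric_sums[OF z2] by (simp add: norm_power power_commutes flip: power_mult)
       (simp add: power_mult mult.commute)
  ultimately show "(\<integral>\<zeta>. 1 / (norm (\<zeta> - z))\<^sup>2 \<partial>circ) = 1 / (1 - (norm z)\<^sup>2)"
    using circle_parseval[OF c] by (simp add: sums_iff)
  show "continuous_on (sphere 0 1) (\<lambda>\<zeta>. 1 / (norm (\<zeta> - z))\<^sup>2)"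
    by (intro continuous_intros) (use z in auto)
qed

section \<open>Fatou's theorem\<close>

text \<open>The assumption \<open>deriv\<close> says that the boundary series has derivative 0 along
  the circle at \<zeta>0. Near \<zeta>0 the integrand is then at most a small multiple of the
  Poisson kernel; away from \<zeta>0 the derivative of the kernel is O(1 - r^2).\<close>

lemma radial_dpoisson_limit:
  fixes c :: "nat \<Rightarrow> complex" and \<zeta>0 d :: complex
  assumes c: "summable (\<lambda>n. norm (c n))" and \<zeta>0: "norm \<zeta>0 = 1"
    and deriv: "\<And>e. e > 0 \<Longrightarrow> \<exists>\<delta>>0. \<forall>\<zeta>\<in>sphere 0 1. norm (\<zeta> - \<zeta>0) < \<delta> \<longrightarrow>
      norm ((\<Sum>n. c n * \<zeta> ^ n) - (\<Sum>n. c n * \<zeta>0 ^ n)) \<le> e * norm (\<zeta> - \<zeta>0)"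
  shows "((\<lambda>r. \<Sum>n. of_nat n * c n * (of_real r * \<zeta>0) ^ n) \<longlongrightarrow> 0) (at_left 1)"
proof -
  define H where "H \<zeta> = (\<Sum>n. c n * \<zeta> ^ n)" for \<zeta>
  \<comment> \<open>Makes the boundary function vanish at \<zeta>0; the change of the coefficient
    with index 0 is invisible after multiplication by n.\<close>
  define c' where "c' n = c n - (if n = 0 then H \<zeta>0 else 0)" for n
  define R where "R \<zeta> = (\<Sum>n. c' n * \<zeta> ^ n)" for \<zeta>
  have c'_norm: "summable (\<lambda>n. norm (c' n))"
    using summable_ignore_initial_segment[OF c, of 1]
    by (subst summable_Suc_iff[symmetric]) (simp add: c'_def)
  have R: "R \<zeta> = H \<zeta> - H \<zeta>0" if "norm \<zeta> = 1" for \<zeta>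
  proof -
    have "summable (\<lambda>n. norm (c n * \<zeta> ^ n))" using c that by (simp add: norm_mult norm_power)
    then have "(\<lambda>n. c n * \<zeta> ^ n) sums H \<zeta>"
      unfolding H_def by (intro summable_sums) (rule summable_norm_cancel)
    then have "(\<lambda>n. c n * \<zeta> ^ n - (if n = 0 then H \<zeta>0 else 0)) sums (H \<zeta> - H \<zeta>0)"
      by (rule sums_diff) (rule sums_single[of 0 "\<lambda>_. H \<zeta>0"])
    moreover have "(\<lambda>n. c n * \<zeta> ^ n - (if n = 0 then H \<zeta>0 else 0)) = (\<lambda>n. c' n * \<zeta> ^ n)"
      by (auto simp: c'_def algebra_simps)
    ultimately show ?thesis by (simp add: R_def sums_iff)
  qed
  define M where "M = (\<Sum>n. norm (c' n))"
  have M: "norm (R \<zeta>) \<le> M" if "norm \<zeta> = 1" for \<zeta>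
  proof -
    have "summable (\<lambda>n. norm (c' n * \<zeta> ^ n))" using c'_norm that by (simp add: norm_mult norm_power)
    then show ?thesis
      using summable_norm[of "\<lambda>n. c' n * \<zeta> ^ n"] that by (simp add: R_def M_def norm_mult norm_power)
  qed
  have M0: "M \<ge> 0" unfolding M_def by (intro suminf_nonneg c'_norm) simp
  have Rcont: "continuous_on (sphere 0 1) R"
    unfolding R_def by (rule continuous_on_subset[OF power_series_continuous_on_disc[OF c'_norm]]) auto
  show ?thesis
  proof (rule tendstoI)
    fix e :: real assume "e > 0"
    \<comment> \<open>The constant 16 absorbs the 2 of \<open>norm_dpoisson_le\<close> and the 4
      from x \<le> 2 y, leaving e / 2.\<close>
    then obtain \<delta> where \<delta>: "\<delta> > 0" and near:
      "\<And>\<zeta>. norm \<zeta> = 1 \<Longrightarrow> norm (\<zeta> - \<zeta>0) < \<delta> \<Longrightarrow> norm (R \<zeta>) \<le> (e/16) * norm (\<zeta> - \<zeta>0)"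
      using deriv[of "e/16"] R unfolding H_def by fastforce
    \<comment> \<open>For x \<ge> \<delta> one has y \<ge> \<delta> / 2 and x \<le> 2, so the far
      bound is M * 2 * 2 * (2 / \<delta>)^4 times 1 - r^2.\<close>
    define C where "C = 64 * M / \<delta> ^ 4"
    have C: "C \<ge> 0" using M0 \<delta> by (simp add: C_def)
    have main: "norm (\<Sum>n. of_nat n * c n * (of_real r * \<zeta>0) ^ n) \<le> e/2 + C * (1 - r\<^sup>2)"
      if r: "0 \<le> r" "r < 1" for r :: real
    proof -
      define z where "z = of_real r * \<zeta>0"
      have nz: "norm z = r" using r \<zeta>0 by (simp add: z_def norm_mult)
      then have z: "norm z < 1" using r by simp
      have r2: "0 < 1 - r\<^sup>2" using r by (simp add: power_less_one_iff)
      have pt: "norm (R \<zeta> * dpoisson z \<zeta>) \<le> (e/2) * (1 - r\<^sup>2) * (1 / (norm (\<zeta> - z))\<^sup>2) + C * (1 - r\<^sup>2)"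
        if \<zeta>: "norm \<zeta> = 1" for \<zeta>
      proof -
        define x y where "x = norm (\<zeta> - \<zeta>0)" and "y = norm (\<zeta> - z)"
        have ypos: "y > 0" using z \<zeta> unfolding y_def by auto
        have "norm (z - \<zeta>0) = 1 - r"
        proof -
          have "z - \<zeta>0 = of_real (r - 1) * \<zeta>0" by (simp add: z_def algebra_simps)
          then show ?thesis using r \<zeta>0 by (simp add: norm_mult del: of_real_diff)
        qed
        moreover have "1 - r \<le> y" using norm_triangle_ineq2[of \<zeta> z] \<zeta> nz by (simp add: y_def)
        moreover have "x \<le> y + norm (z - \<zeta>0)"
          unfolding x_def y_def using norm_triangle_ineq[of "\<zeta> - z" "z - \<zeta>0"] by simp
        \<comment> \<open>The point z lies at distance 1 - r from \<zeta>0, and no point of the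
          circle is closer to z than that.\<close>
        ultimately have xy: "x \<le> 2 * y" by linarith
        have x2: "x \<le> 2" using norm_triangle_ineq4[of \<zeta> \<zeta>0] \<zeta> \<zeta>0 by (simp add: x_def)
        have x0: "x \<ge> 0" by (simp add: x_def)
        have K: "norm (dpoisson z \<zeta>) \<le> 2 * (1 - r\<^sup>2) * x / y ^ 4"
          unfolding z_def x_def y_def by (rule norm_dpoisson_le[OF r \<zeta> \<zeta>0])
        show ?thesis
        proof (cases "x < \<delta>")
          case True
          have "norm (R \<zeta> * dpoisson z \<zeta>) \<le> ((e/16) * x) * (2 * (1 - r\<^sup>2) * x / y ^ 4)"
            unfolding norm_mult using near[OF \<zeta>] True K \<open>e > 0\<close> x0
            by (intro mult_mono) (auto simp: x_def)
          also have "\<dots> = (e/8) * (1 - r\<^sup>2) * (x\<^sup>2 / y ^ 4)"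
            using ypos by (simp add: power2_eq_square field_simps)
          also have "x\<^sup>2 / y ^ 4 \<le> (2 * y)\<^sup>2 / y ^ 4"
            using xy x0 ypos by (intro divide_right_mono power_mono) auto
          also have "(2 * y)\<^sup>2 / y ^ 4 = 4 * (1 / y\<^sup>2)"
            using ypos by (simp add: power2_eq_square power4_eq_xxxx)
          finally have "norm (R \<zeta> * dpoisson z \<zeta>) \<le> (e/8) * (1 - r\<^sup>2) * (4 * (1 / y\<^sup>2))"
            using \<open>e > 0\<close> r2 by (simp add: mult_left_mono)
          moreover have "0 \<le> C * (1 - r\<^sup>2)" using C r2 by simp
          ultimately show ?thesis by (simp add: y_def)
        next
          case False
          then have "\<delta> / 2 \<le> y" using xy by simp
          then have "(\<delta> / 2) ^ 4 \<le> y ^ 4" using \<delta> by (intro power_mono) auto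
          then have y4: "1 / y ^ 4 \<le> 1 / (\<delta> / 2) ^ 4" using \<delta> ypos by (intro divide_left_mono) auto
          have "norm (R \<zeta> * dpoisson z \<zeta>) \<le> M * (2 * (1 - r\<^sup>2) * x / y ^ 4)"
            unfolding norm_mult using M[OF \<zeta>] K M0 by (intro mult_mono) auto
          also have "\<dots> = 2 * M * (1 - r\<^sup>2) * (x * (1 / y ^ 4))" by simp
          also have "\<dots> \<le> 2 * M * (1 - r\<^sup>2) * (2 * (1 / (\<delta> / 2) ^ 4))"
            using M0 r2 x0 x2 y4 by (intro mult_left_mono mult_mono) auto
          also have "\<dots> = C * (1 - r\<^sup>2)" by (simp add: C_def power_divide)
          moreover have "0 \<le> (e/2) * (1 - r\<^sup>2) * (1 / (norm (\<zeta> - z))\<^sup>2)" using \<open>e > 0\<close> r2 by simp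
          ultimately show ?thesis by linarith
        qed
      qed
      have sums: "(\<lambda>n. of_nat n * c' n * z ^ n) sums (\<integral>\<zeta>. R \<zeta> * dpoisson z \<zeta> \<partial>circ)"
        unfolding R_def by (rule integral_series_dpoisson[OF c'_norm z])
      moreover have "(\<lambda>n. of_nat n * c' n * z ^ n) = (\<lambda>n. of_nat n * c n * z ^ n)"
        by (auto simp: c'_def)
      ultimately have "(\<Sum>n. of_nat n * c n * z ^ n) = (\<integral>\<zeta>. R \<zeta> * dpoisson z \<zeta> \<partial>circ)"
        by (simp add: sums_iff)
      also have "norm \<dots> \<le> (\<integral>\<zeta>. norm (R \<zeta> * dpoisson z \<zeta>) \<partial>circ)" by (rule integral_norm_bound)
      also have "\<dots> \<le> (\<integral>\<zeta>. (e/2) * (1 - r\<^sup>2) * (1 / (norm (\<zeta> - z))\<^sup>2) + C * (1 - r\<^sup>2) \<partial>circ)"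
      proof (rule Bochner_Integration.integral_mono)
        show "integrable circ (\<lambda>\<zeta>. norm (R \<zeta> * dpoisson z \<zeta>))"
          by (intro circle_continuous_integrable continuous_intros Rcont dpoisson_continuous z)
        show "integrable circ (\<lambda>\<zeta>. (e/2) * (1 - r\<^sup>2) * (1 / (norm (\<zeta> - z))\<^sup>2) + C * (1 - r\<^sup>2))"
          by (intro circle_continuous_integrable continuous_on_add continuous_on_mult_left
              continuous_on_const poisson_integral(2) z)
      qed (use pt in auto)
      also have "\<dots> = (\<integral>\<zeta>. (e/2) * (1 - r\<^sup>2) * (1 / (norm (\<zeta> - z))\<^sup>2) \<partial>circ) + C * (1 - r\<^sup>2)"
      proof (subst Bochner_Integration.integral_add)
        show "integrable circ (\<lambda>\<zeta>. (e/2) * (1 - r\<^sup>2) * (1 / (norm (\<zeta> - z))\<^sup>2))"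
          by (intro circle_continuous_integrable continuous_on_mult_left poisson_integral(2) z)
      qed simp_all
      also have "\<dots> = (e/2) * (1 - r\<^sup>2) * (1 / (1 - r\<^sup>2)) + C * (1 - r\<^sup>2)"
        unfolding integral_mult_right_zero poisson_integral(1)[OF z] nz ..
      also have "\<dots> = e/2 + C * (1 - r\<^sup>2)"
      proof -
        have "(e/2) * y * (1 / y) = e/2" if "y > 0" for y using that by simp
        from this[OF r2] show ?thesis by (rule arg_cong)
      qed
      finally show ?thesis unfolding z_def .
    qed
    have "((\<lambda>r::real. e/2 + C * (1 - r\<^sup>2)) \<longlongrightarrow> e/2 + C * (1 - 1\<^sup>2)) (at_left 1)"
      by (intro tendsto_intros)
    then have "\<forall>\<^sub>F r in at_left (1::real). e/2 + C * (1 - r\<^sup>2) < e"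
      by (rule order_tendstoD) (use \<open>e > 0\<close> in simp)
    moreover have "\<forall>\<^sub>F r in at_left (1::real). r \<in> {0<..<1}"
      by (rule eventually_at_left_real) simp
    ultimately show "\<forall>\<^sub>F r in at_left 1. dist (\<Sum>n. of_nat n * c n * (of_real r * \<zeta>0) ^ n) 0 < e"
    proof eventually_elim
      case (elim r)
      then show ?case using main[of r] by simp
    qed
  qed
qed

text \<open>Near an angle strictly between 0 and 2 pi, \<open>Arg2pi\<close> is a continuous inverse
  of \<open>cis\<close>, and the derivative of \<open>cis\<close> has modulus 1, so angle
  differences and chords are comparable. A zero derivative in the angle thus becomes the estimate in
  \<zeta> that \<open>radial_dpoisson_limit\<close> takes.\<close>

lemma circle_local_derivative:
  assumes F: "((\<lambda>t. F (cis t)) has_vector_derivative 0) (at t0)" and t0: "0 < t0" "t0 < 2 * pi"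
    and e: "e > 0"
  shows "\<exists>\<delta>>0. \<forall>\<zeta>\<in>sphere 0 1. norm (\<zeta> - cis t0) < \<delta> \<longrightarrow>
    norm (F \<zeta> - F (cis t0)) \<le> e * norm (\<zeta> - cis t0)"
proof -
  have cis': "(cis has_vector_derivative (\<i> * cis t0)) (at t0)"
    unfolding cis_conv_exp
    by (rule has_vector_derivative_real_field) (auto intro!: derivative_eq_intros)
  obtain d1 where d1: "d1 > 0" "\<And>t. norm (t - t0) < d1 \<Longrightarrow>
      norm (F (cis t) - F (cis t0) - (t - t0) *\<^sub>R 0) \<le> (e/2) * norm (t - t0)"
    using F e unfolding has_vector_derivative_def has_derivative_at_alt by (meson half_gt_zero)
  obtain d2 where d2: "d2 > 0" "\<And>t. norm (t - t0) < d2 \<Longrightarrow>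
      norm (cis t - cis t0 - (t - t0) *\<^sub>R (\<i> * cis t0)) \<le> (1/2) * norm (t - t0)"
    using cis' unfolding has_vector_derivative_def has_derivative_at_alt by (meson half_gt_zero zero_less_one)
  have arg: "Arg2pi (cis t0) = t0"
    using t0 Arg2pi_unique[of 1 t0 "cis t0"] by (simp add: cis_conv_exp)
  then have "cis t0 \<notin> \<real>\<^sub>\<ge>\<^sub>0"
    using t0 Arg2pi_eq_0[of "cis t0"] by (auto simp: complex_nonneg_Reals_iff complex_is_Real_iff)
  then have "isCont Arg2pi (cis t0)" by (rule continuous_at_Arg2pi)
  then obtain \<delta> where \<delta>: "\<delta> > 0" "\<And>\<zeta>. dist \<zeta> (cis t0) < \<delta> \<Longrightarrow> dist (Arg2pi \<zeta>) (Arg2pi (cis t0)) < min d1 d2"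
    unfolding continuous_at_eps_delta using d1(1) d2(1) by (metis min_less_iff_conj)
  show ?thesis
  proof (intro exI[of _ \<delta>] conjI \<delta>(1) ballI impI)
    fix \<zeta> :: complex assume \<zeta>: "\<zeta> \<in> sphere 0 1" "norm (\<zeta> - cis t0) < \<delta>"
    define t where "t = Arg2pi \<zeta>"
    have t: "cis t = \<zeta>" using Arg2pi_eq[of \<zeta>] \<zeta>(1) by (simp add: t_def cis_conv_exp)
    have "norm (t - t0) < min d1 d2" using \<delta>(2)[of \<zeta>] \<zeta>(2) by (simp add: t_def arg dist_norm)
    then have a: "norm (F \<zeta> - F (cis t0)) \<le> (e/2) * norm (t - t0)"
      and b: "norm (\<zeta> - cis t0 - (t - t0) *\<^sub>R (\<i> * cis t0)) \<le> (1/2) * norm (t - t0)"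
      using d1(2)[of t] d2(2)[of t] by (auto simp: t)
    have "norm ((t - t0) *\<^sub>R (\<i> * cis t0)) = norm (t - t0)" by (simp add: norm_mult)
    then have "norm (t - t0) \<le> 2 * norm (\<zeta> - cis t0)"
      using b norm_triangle_ineq2[of "(t - t0) *\<^sub>R (\<i> * cis t0)" "\<zeta> - cis t0"]
        norm_minus_commute[of "(t - t0) *\<^sub>R (\<i> * cis t0)" "\<zeta> - cis t0"]
      by linarith
    then have "(e/2) * norm (t - t0) \<le> (e/2) * (2 * norm (\<zeta> - cis t0))" using e by (intro mult_left_mono) auto
    then show "norm (F \<zeta> - F (cis t0)) \<le> e * norm (\<zeta> - cis t0)" using a by simp
  qed
qed

text \<open>\<open>integrable_ccontinuous_explicit\<close> controls averages over intervals to the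
  right of a point. Applied also to the reflected function, it controls those to the left; outside
  both exceptional null sets the derivative is two-sided.\<close>

lemma lborel_integral_derivative:
  fixes \<gamma> :: "real \<Rightarrow> complex"
  assumes \<gamma>: "integrable lborel \<gamma>"
    and F: "\<And>s t. A \<le> s \<Longrightarrow> s \<le> t \<Longrightarrow> t \<le> B \<Longrightarrow> F t - F s = integral {s..t} \<gamma>"
  shows "AE t in lborel. A < t \<longrightarrow> t < B \<longrightarrow> (F has_vector_derivative \<gamma> t) (at t)"
proof -
  have int: "f integrable_on cbox a b" if "integrable lborel f" for f :: "real \<Rightarrow> complex" and a b
    using integrable_on_lborel[OF that] integrable_on_subcbox by blast
  have \<gamma>': "integrable lborel (\<lambda>t. \<gamma> (- t))"
    using lborel_integrable_real_affine[OF \<gamma>, of "-1" 0] by simp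
  obtain N1 where N1: "negligible N1" "\<And>x e. x \<notin> N1 \<Longrightarrow> 0 < e \<Longrightarrow>
      \<exists>d>0. \<forall>h. 0 < h \<and> h < d \<longrightarrow> norm (integral (cbox x (x + h *\<^sub>R One)) \<gamma> /\<^sub>R h ^ DIM(real) - \<gamma> x) < e"
    using integrable_ccontinuous_explicit[OF int[OF \<gamma>]] by metis
  obtain N2 where N2: "negligible N2" "\<And>x e. x \<notin> N2 \<Longrightarrow> 0 < e \<Longrightarrow>
      \<exists>d>0. \<forall>h. 0 < h \<and> h < d \<longrightarrow>
        norm (integral (cbox x (x + h *\<^sub>R One)) (\<lambda>t. \<gamma> (- t)) /\<^sub>R h ^ DIM(real) - \<gamma> (- x)) < e"
    using integrable_ccontinuous_explicit[OF int[OF \<gamma>']] by metis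
  have "(F has_vector_derivative \<gamma> t) (at t)" if t: "A < t" "t < B" "t \<notin> N1" "- t \<notin> N2" for t
    unfolding has_vector_derivative_def has_derivative_at_alt
  proof (intro conjI allI impI)
    show "bounded_linear (\<lambda>x. x *\<^sub>R \<gamma> t)" by (rule bounded_linear_scaleR_left)
    fix e :: real assume e: "e > 0"
    obtain d1 where d1: "d1 > 0" "\<And>h. 0 < h \<Longrightarrow> h < d1 \<Longrightarrow> norm (integral {t..t + h} \<gamma> /\<^sub>R h - \<gamma> t) < e"
      using N1(2)[OF t(3) e] by auto
    obtain d2 where d2: "d2 > 0"
      "\<And>h. 0 < h \<Longrightarrow> h < d2 \<Longrightarrow> norm (integral {- t..- t + h} (\<lambda>t. \<gamma> (- t)) /\<^sub>R h - \<gamma> t) < e"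
      using N2(2)[OF t(4) e] by auto
    define d where "d = min (min d1 d2) (min (t - A) (B - t))"
    have "norm (F y - F t - (y - t) *\<^sub>R \<gamma> t) \<le> e * norm (y - t)" if y: "norm (y - t) < d" for y
    proof (cases "y = t")
      case False
      define h where "h = \<bar>y - t\<bar>"
      have h: "0 < h" "h < d1" "h < d2" "h < t - A" "h < B - t" using False y by (auto simp: h_def d_def)
      have scale: "norm (X - h *\<^sub>R \<gamma> t) \<le> e * h" if "norm (X /\<^sub>R h - \<gamma> t) < e" for X
      proof -
        have "X - h *\<^sub>R \<gamma> t = h *\<^sub>R (X /\<^sub>R h - \<gamma> t)" using h(1) by (simp add: scaleR_diff_right)
        then have "norm (X - h *\<^sub>R \<gamma> t) = h * norm (X /\<^sub>R h - \<gamma> t)" using h(1) by simp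
        then show ?thesis using that h(1) by (simp add: mult.commute)
      qed
      show ?thesis
      proof (cases "t < y")
        case True
        then have y: "y = t + h" by (simp add: h_def)
        have "F y - F t = integral {t..t + h} \<gamma>" using F[of t y] h t by (simp add: y)
        then show ?thesis using scale[OF d1(2)[OF h(1,2)]] h(1) by (simp add: y)
      next
        case False
        then have y: "y = t - h" by (simp add: h_def)
        have "F t - F y = integral {t - h..t} \<gamma>" using F[of y t] h t by (simp add: y)
        also have "\<dots> = integral {- t..- t + h} (\<lambda>t. \<gamma> (- t))"
          using Henstock_Kurzweil_Integration.integral_reflect_real[of t "t - h" \<gamma>] by simp
        finally have "norm ((F t - F y) - h *\<^sub>R \<gamma> t) \<le> e * h" using scale[OF d2(2)[OF h(1,3)]] by simp
        moreover have "F y - F t - (y - t) *\<^sub>R \<gamma> t = - ((F t - F y) - h *\<^sub>R \<gamma> t)" by (simp add: y)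
        ultimately show ?thesis using h(1) by (simp only: norm_minus_cancel) (simp add: y)
      qed
    qed simp
    moreover have "d > 0" using d1 d2 t by (simp add: d_def)
    ultimately show "\<exists>d>0. \<forall>y. norm (y - t) < d \<longrightarrow> norm (F y - F t - (y - t) *\<^sub>R \<gamma> t) \<le> e * norm (y - t)"
      by blast
  qed
  moreover have "negligible (N1 \<union> uminus ` N2)"
    using N1(1) N2(1) 
    by (intro negligible_Un negligible_differentiable_image_negligible)
      (auto intro!: linear_imp_differentiable_on simp: linear_iff)
  then have "AE t in lebesgue. t \<notin> N1 \<union> uminus ` N2"
    unfolding negligible_iff_null_sets by (rule AE_not_in)
  then have "AE t in lborel. t \<notin> N1 \<union> uminus ` N2" by (simp add: AE_completion_iff)
  moreover have "- t \<notin> N2" if "t \<notin> N1 \<union> uminus ` N2" for t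
    using that by (metis UnI2 imageI minus_minus)
  ultimately show ?thesis by (auto elim!: AE_mp)
qed

text \<open>The unitary map from \<open>l2\<close> to the Hardy space: \<open>H2_eq_range\<close>
  gives surjectivity, \<open>H2_inner_hardy\<close> the inner product. The value 0 off the disk
  matches the convention in \<open>H2\<close>.\<close>

definition hardy :: "l2 \<Rightarrow> complex \<Rightarrow> complex" where
  "hardy x z = (if norm z < 1 then \<Sum>n. coord x n * z ^ n else 0)"

lemma summable_norm_hardy:
  assumes "norm z < 1"
  shows "summable (\<lambda>n. norm (coord x n * z ^ n))"
  by (rule summable_comparison_test'[of "\<lambda>n. norm x * norm z ^ n" 0])
    (use assms norm_coord_le in \<open>auto simp: norm_mult norm_power intro!: summable_mult summable_geometric mult_right_mono\<close>)

lemma hardy_sums: "norm z < 1 \<Longrightarrow> (\<lambda>n. coord x n * z ^ n) sums hardy x z"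
  using summable_sums[OF summable_norm_cancel[OF summable_norm_hardy]] by (simp add: hardy_def)

lemma hardy_holomorphic: "hardy x holomorphic_on ball 0 1"
  by (rule power_series_holomorphic[of 0 1 "coord x"]) (simp add: hardy_sums)

text \<open>AM-GM bounds each term by the square of the coefficient plus 1 / n^2. At n = 0 division
  by zero yields 0, so the integrated series has no constant term.\<close>

lemma integrated_summable: "summable (\<lambda>n. norm (coord x n / of_nat n))"
proof (rule summable_comparison_test'[of "\<lambda>n. (norm (coord x n))\<^sup>2 + 1 / (real n)\<^sup>2" 0])
  show "summable (\<lambda>n. (norm (coord x n))\<^sup>2 + 1 / (real n)\<^sup>2)"
    using inverse_power_summable[of 2] summable_coord
    by (intro summable_add) (auto simp: inverse_eq_divide power_one_over)
  show "norm (norm (coord x n / of_nat n)) \<le> (norm (coord x n))\<^sup>2 + 1 / (real n)\<^sup>2" for n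
    using norm_mult_le_sq[of "coord x n" "1 / of_nat n"] by (simp add: norm_divide power_divide)
qed

text \<open>The L^2 limit g of the partial sums is produced before any pointwise limit, and the
  integrated series H then ties the radial limits to this same g, which is what later transfers the
  norm.\<close>

lemma fatou_l2:
  obtains g where "sq_int g"
    "(\<lambda>N. \<integral>z. (norm ((\<Sum>n<N. coord x n * z ^ n) - g z))\<^sup>2 \<partial>circ) \<longlonglongrightarrow> 0"
    "AE t in lborel. 0 < t \<longrightarrow> t < 2 * pi \<longrightarrow>
      ((\<lambda>r. hardy x (of_real r * cis t)) \<longlongrightarrow> g (cis t)) (at_left 1)"
proof -
  define a where "a = coord x"
  define c where "c n = a n / of_nat n" for n
  define H where "H \<zeta> = (\<Sum>n. c n * \<zeta> ^ n)" for \<zeta>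
  define s where "s N z = (\<Sum>n<N. a n * z ^ n)" for N and z :: complex
  obtain g where g: "sq_int g" and lim: "(\<lambda>N. \<integral>z. (norm (s N z - g z))\<^sup>2 \<partial>circ) \<longlonglongrightarrow> 0"
    using riesz_fischer[OF summable_coord[of x]] unfolding s_def a_def by blast
  have c: "summable (\<lambda>n. norm (c n))" using integrated_summable[of x] by (simp add: c_def a_def)
  have Hsums: "(\<lambda>n. c n * \<zeta> ^ n) sums H \<zeta>" if "norm \<zeta> = 1" for \<zeta>
  proof -
    have "summable (\<lambda>n. norm (c n * \<zeta> ^ n))" using c that by (simp add: norm_mult norm_power)
    then show ?thesis unfolding H_def by (intro summable_sums) (rule summable_norm_cancel)
  qed
  have s_sq: "sq_int (s N)" for N
    unfolding s_def by (intro sq_int_continuous continuous_intros)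
  have sg: "sq_int (\<lambda>z. s N z - g z)" for N by (rule sq_int_diff[OF s_sq g])
  have L1: "(\<lambda>N. \<integral>z. norm (s N z - g z) \<partial>circ) \<longlonglongrightarrow> 0"
    using L2_null_product[OF sg sq_int_continuous[of "\<lambda>_. 1"] lim] by simp
  \<comment> \<open>The formal angular derivative of H: the factor i n cancels the division by n,
    and the constant term of the original series is lost. The indicator makes it integrable on the
    whole line.\<close>
  define \<gamma> where "\<gamma> t = indicator {0..2*pi} t *\<^sub>R (\<i> * (g (cis t) - a 0))" for t :: real
  have int_circ: "integrable circ (\<lambda>z. \<i> * (g z - a 0))"
    using sq_int_integrable[OF g] by simp
  then have \<gamma>: "integrable lborel \<gamma>"
    using circle_integrable_iff(1)[of "\<lambda>z. \<i> * (g z - a 0)"]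
    unfolding \<gamma>_def set_integrable_def by (metis borel_measurable_integrable)
  have FTC: "H (cis v) - H (cis u) = integral {u..v} \<gamma>" if uv: "0 \<le> u" "u \<le> v" "v \<le> 2 * pi" for u v
  proof (rule LIMSEQ_unique)
    \<comment> \<open>The derivative of a partial sum of H. The upper index \<open>Suc N\<close>
      lets the term n = 0 be split off.\<close>
    define p where "p N t = (\<Sum>n<Suc N. c n * (\<i> * of_nat n * cis t ^ n))" for N t
    have p: "p N t = \<i> * (s (Suc N) (cis t) - a 0)" for N t
      unfolding p_def s_def sum.lessThan_Suc_shift
      by (simp add: c_def sum_distrib_left mult_ac del: of_nat_Suc)
    show "(\<lambda>N. \<Sum>n<Suc N. c n * (cis v ^ n - cis u ^ n)) \<longlonglongrightarrow> H (cis v) - H (cis u)"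
      using sums_diff[OF Hsums[of "cis v"] Hsums[of "cis u"]]
      unfolding sums_def by (intro LIMSEQ_Suc) (simp add: algebra_simps)
    have "((\<lambda>t. p N t) has_integral (\<Sum>n<Suc N. c n * (cis v ^ n - cis u ^ n))) {u..v}" for N
      unfolding p_def
    proof (intro has_integral_sum has_integral_mult_right finite_lessThan)
      fix n
      have "((\<lambda>t. cis (real n * t)) has_vector_derivative (\<i> * of_nat n * cis t ^ n)) (at t)" for t
      proof -
        have "((\<lambda>z. exp (\<i> * of_nat n * z)) has_field_derivative \<i> * of_nat n * exp (\<i> * of_nat n * of_real t)) (at (of_real t))"
          by (auto intro!: derivative_eq_intros)
        from has_vector_derivative_real_field[OF this]
        show ?thesis unfolding Complex.DeMoivre by (simp add: cis_conv_exp mult_ac)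
      qed
      then have "((\<lambda>t. cis t ^ n) has_vector_derivative (\<i> * of_nat n * cis t ^ n)) (at t within {u..v})" for t
        unfolding Complex.DeMoivre by (rule has_vector_derivative_at_within)
      then show "((\<lambda>t. \<i> * of_nat n * cis t ^ n) has_integral (cis v ^ n - cis u ^ n)) {u..v}"
        using uv(2) by (intro fundamental_theorem_of_calculus) auto
    qed
    then have pi: "integral {u..v} (p N) = (\<Sum>n<Suc N. c n * (cis v ^ n - cis u ^ n))" for N
      by (rule integral_unique)
    have psi: "set_integrable lborel {u..v} (p N)" for N
      unfolding p_def by (intro borel_integrable_atLeastAtMost' continuous_intros)
    have \<gamma>si: "set_integrable lborel {u..v} \<gamma>" using \<gamma> by (simp add: integrable_mult_indicator set_integrable_def)
    \<comment> \<open>Over any subinterval of one period the error is controlled by the L^1 distance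
      on the circle, so integrating p N converges even though p N itself may not converge
      pointwise.\<close>
    have "norm (integral {u..v} (p N) - integral {u..v} \<gamma>) \<le> 2 * pi * (\<integral>z. norm (s (Suc N) z - g z) \<partial>circ)" for N
    proof -
      have si: "set_integrable lborel {0..2*pi} (\<lambda>t. norm (s (Suc N) (cis t) - g (cis t)))"
        using circle_integrable_iff(1)[of "\<lambda>z. norm (s (Suc N) z - g z)"] sq_int_integrable[OF sg[of "Suc N"]]
          sq_int_measurable[OF sg[of "Suc N"]] by simp
      have "integral {u..v} (p N) - integral {u..v} \<gamma> = (LINT t:{u..v}|lborel. p N t - \<gamma> t)"
        using set_borel_integral_eq_integral(2)[OF psi[of N]] set_borel_integral_eq_integral(2)[OF \<gamma>si]
          set_integral_diff(2)[OF psi[of N] \<gamma>si] by simp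
      also have "norm \<dots> \<le> (LINT t:{u..v}|lborel. norm (p N t - \<gamma> t))"
        by (rule set_integral_norm_bound[OF set_integral_diff(1)[OF psi \<gamma>si]])
      also have "\<dots> \<le> (LINT t:{0..2*pi}|lborel. norm (s (Suc N) (cis t) - g (cis t)))"
        unfolding set_lebesgue_integral_def
      proof (rule Bochner_Integration.integral_mono)
        show "integrable lborel (\<lambda>t. indicator {u..v} t *\<^sub>R norm (p N t - \<gamma> t))"
          using set_integrable_norm[OF set_integral_diff(1)[OF psi \<gamma>si]] by (simp add: set_integrable_def)
        show "integrable lborel (\<lambda>t. indicator {0..2*pi} t *\<^sub>R norm (s (Suc N) (cis t) - g (cis t)))"
          using si by (simp add: set_integrable_def)
        fix t
        have "norm (p N t - \<gamma> t) = norm (s (Suc N) (cis t) - g (cis t))" if "t \<in> {u..v}"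
        proof -
          have "p N t - \<gamma> t = \<i> * (s (Suc N) (cis t) - g (cis t))"
            using that uv by (simp add: p \<gamma>_def algebra_simps)
          then show ?thesis by (simp add: norm_mult)
        qed
        then show "indicator {u..v} t *\<^sub>R norm (p N t - \<gamma> t) \<le>
          indicator {0..2*pi} t *\<^sub>R norm (s (Suc N) (cis t) - g (cis t))"
          using uv by (auto simp: indicator_def)
      qed
      also have "\<dots> = 2 * pi * (\<integral>z. norm (s (Suc N) z - g z) \<partial>circ)"
        using sq_int_measurable[OF sg[of "Suc N"]] by (subst circle_integrable_iff(2)) auto
      finally show ?thesis .
    qed
    then have "(\<lambda>N. integral {u..v} (p N) - integral {u..v} \<gamma>) \<longlonglongrightarrow> 0"
      by (intro Lim_null_comparison[OF _ tendsto_mult_right_zero[OF LIMSEQ_Suc[OF L1], of "2 * pi"]]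
          always_eventually allI)
    then show "(\<lambda>N. \<Sum>n<Suc N. c n * (cis v ^ n - cis u ^ n)) \<longlonglongrightarrow> integral {u..v} \<gamma>"
      unfolding pi[symmetric] by (simp add: LIM_zero_iff)
  qed
  have "AE t in lborel. 0 < t \<longrightarrow> t < 2 * pi \<longrightarrow> ((\<lambda>t. H (cis t)) has_vector_derivative \<gamma> t) (at t)"
    by (rule lborel_integral_derivative[OF \<gamma> FTC])
  then have "AE t in lborel. 0 < t \<longrightarrow> t < 2 * pi \<longrightarrow>
      ((\<lambda>r. hardy x (of_real r * cis t)) \<longlongrightarrow> g (cis t)) (at_left 1)"
  proof (eventually_elim, intro impI)
    fix t :: real assume t: "0 < t" "t < 2 * pi"
      and "0 < t \<longrightarrow> t < 2 * pi \<longrightarrow> ((\<lambda>t. H (cis t)) has_vector_derivative \<gamma> t) (at t)"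
    then have der: "((\<lambda>t. H (cis t)) has_vector_derivative \<gamma> t) (at t)" by simp
    define \<zeta>0 where "\<zeta>0 = cis t"
    define d where "d = g \<zeta>0 - a 0"
    have \<zeta>0: "norm \<zeta>0 = 1" "\<zeta>0 \<noteq> 0" by (auto simp: \<zeta>0_def)
    have \<gamma>t: "\<gamma> t = \<i> * d" using t by (simp add: \<gamma>_def d_def \<zeta>0_def)
    \<comment> \<open>Subtracting the monomial (d / \<zeta>0) \<zeta>, whose angular derivative at t
      is i d, reduces to derivative 0.\<close>
    define e where "e n = c n - (if n = 1 then d / \<zeta>0 else 0)" for n
    have e_norm: "summable (\<lambda>n. norm (e n))"
      using summable_ignore_initial_segment[OF c, of 2]
      by (subst summable_iff_shift[symmetric, of _ 2]) (simp add: e_def)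
    have e_sums: "(\<Sum>n. e n * \<zeta> ^ n) = H \<zeta> - d / \<zeta>0 * \<zeta>" if "norm \<zeta> = 1" for \<zeta>
    proof -
      have "(\<lambda>n. c n * \<zeta> ^ n - (if n = 1 then d / \<zeta>0 * \<zeta> ^ n else 0)) sums (H \<zeta> - d / \<zeta>0 * \<zeta> ^ 1)"
        by (intro sums_diff Hsums that sums_single)
      moreover have "(\<lambda>n. c n * \<zeta> ^ n - (if n = 1 then d / \<zeta>0 * \<zeta> ^ n else 0)) = (\<lambda>n. e n * \<zeta> ^ n)"
        by (auto simp: e_def algebra_simps)
      ultimately show ?thesis by (simp add: sums_iff)
    qed
    have cis': "(cis has_vector_derivative (\<i> * cis t)) (at t)"
      unfolding cis_conv_exp
      by (rule has_vector_derivative_real_field) (auto intro!: derivative_eq_intros)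
    have "((\<lambda>t. H (cis t) - d / \<zeta>0 * cis t) has_vector_derivative (\<gamma> t - d / \<zeta>0 * (\<i> * cis t))) (at t)"
      by (intro has_vector_derivative_diff der has_vector_derivative_mult_right cis')
    moreover have "\<gamma> t - d / \<zeta>0 * (\<i> * cis t) = 0" using \<zeta>0 by (simp add: \<gamma>t \<zeta>0_def[symmetric])
    ultimately have der0: "((\<lambda>t. (\<Sum>n. e n * cis t ^ n)) has_vector_derivative 0) (at t)"
      by (simp add: e_sums)
    have "((\<lambda>r. \<Sum>n. of_nat n * e n * (of_real r * \<zeta>0) ^ n) \<longlongrightarrow> 0) (at_left 1)"
      by (rule radial_dpoisson_limit[OF e_norm \<zeta>0(1)])
        (use circle_local_derivative[of "\<lambda>\<zeta>. \<Sum>n. e n * \<zeta> ^ n", OF der0 t] in \<open>simp add: \<zeta>0_def\<close>)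
    \<comment> \<open>Adding a 0 and d r restores the constant term and the subtracted monomial at r
      \<zeta>0; the limit a 0 + d is g \<zeta>0.\<close>
    then have "((\<lambda>r. (\<Sum>n. of_nat n * e n * (of_real r * \<zeta>0) ^ n) + a 0 + d * of_real r) \<longlongrightarrow> 0 + a 0 + d * of_real 1) (at_left 1)"
      by (intro tendsto_intros)
    moreover have "\<forall>\<^sub>F r in at_left (1::real). r \<in> {0<..<1}"
      by (rule eventually_at_left_real) simp
    then have "\<forall>\<^sub>F r in at_left (1::real).
        (\<Sum>n. of_nat n * e n * (of_real r * \<zeta>0) ^ n) + a 0 + d * of_real r = hardy x (of_real r * \<zeta>0)"
    proof eventually_elim
      case (elim r)
      define z where "z = of_real r * \<zeta>0"
      have z: "norm z < 1" using elim \<zeta>0 by (simp add: z_def norm_mult)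
      have "(\<lambda>n. a n * z ^ n - (if n = 0 then a n else 0) - (if n = 1 then d / \<zeta>0 * z ^ n else 0))
          sums (hardy x z - a 0 - d / \<zeta>0 * z ^ 1)"
        unfolding a_def by (intro sums_diff hardy_sums z sums_single)
      moreover have "(\<lambda>n. a n * z ^ n - (if n = 0 then a n else 0) - (if n = 1 then d / \<zeta>0 * z ^ n else 0)) =
          (\<lambda>n. of_nat n * e n * z ^ n)"
        by (rule ext) (simp add: e_def c_def algebra_simps)
      ultimately have "(\<Sum>n. of_nat n * e n * z ^ n) = hardy x z - a 0 - d / \<zeta>0 * z" by (simp add: sums_iff)
      then show ?case using \<zeta>0 unfolding z_def by simp
    qed
    ultimately have "((\<lambda>r. hardy x (of_real r * \<zeta>0)) \<longlongrightarrow> 0 + a 0 + d * of_real 1) (at_left 1)"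
      by (rule Lim_transform_eventually)
    then show "((\<lambda>r. hardy x (of_real r * cis t)) \<longlongrightarrow> g (cis t)) (at_left 1)"
      by (simp add: d_def \<zeta>0_def)
  qed
  with g lim show ?thesis using that unfolding s_def a_def by blast
qed

section \<open>Boundary functions of the Hardy space\<close>

definition has_radial_limit :: "(complex \<Rightarrow> complex) \<Rightarrow> complex \<Rightarrow> bool" where
  "has_radial_limit f \<zeta> \<longleftrightarrow> (\<exists>l. ((\<lambda>r::real. f (of_real r * \<zeta>)) \<longlongrightarrow> l) (at_left 1))"

lemma radial_limitI:
  "((\<lambda>r::real. f (of_real r * \<zeta>)) \<longlongrightarrow> l) (at_left 1) \<Longrightarrow> radial_limit f \<zeta> = l"
  unfolding radial_limit_def by (rule tendsto_Lim) simp_all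

lemma has_radial_limitD:
  "has_radial_limit f \<zeta> \<Longrightarrow> ((\<lambda>r::real. f (of_real r * \<zeta>)) \<longlongrightarrow> radial_limit f \<zeta>) (at_left 1)"
  unfolding has_radial_limit_def using radial_limitI by blast

lemma eventually_radius: "\<forall>\<^sub>F r in at_left (1::real). 0 < r \<and> r < 1"
  using eventually_at_left_real[of 0 "1::real"] by simp

lemma radius_sequence: "filterlim (\<lambda>n. 1 - 1 / real (Suc (Suc n))) (at_left 1) sequentially"
proof (rule tendsto_imp_filterlim_at_left)
  have "(\<lambda>n. 1 - 1 / real (Suc (Suc n))) \<longlonglongrightarrow> 1 - 0"
    by (intro tendsto_intros LIMSEQ_Suc lim_1_over_n)
  then show "(\<lambda>n. 1 - 1 / real (Suc (Suc n))) \<longlonglongrightarrow> 1" by simp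
qed simp

text \<open>A Cauchy criterion over rational radii: all its quantifiers are countable, so it
  exhibits the set of points with a radial limit as measurable.\<close>

lemma has_radial_limit_iff_Cauchy:
  assumes f: "continuous_on (ball 0 1) f" and \<zeta>: "norm \<zeta> = 1"
  shows "has_radial_limit f \<zeta> \<longleftrightarrow>
    (\<forall>k. \<exists>m. \<forall>p\<in>\<rat> \<inter> {1 - 1 / real (Suc m)<..<1}. \<forall>q\<in>\<rat> \<inter> {1 - 1 / real (Suc m)<..<1}.
      dist (f (of_real p * \<zeta>)) (f (of_real q * \<zeta>)) \<le> 1 / real (Suc k))"
    (is "?L \<longleftrightarrow> (\<forall>k. \<exists>m. ?C k m)")
proof
  assume ?L
  then obtain l where l: "((\<lambda>r::real. f (of_real r * \<zeta>)) \<longlongrightarrow> l) (at_left 1)"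
    unfolding has_radial_limit_def by blast
  show "\<forall>k. \<exists>m. ?C k m"
  proof
    fix k
    have "\<forall>\<^sub>F r in at_left (1::real). dist (f (of_real r * \<zeta>)) l < 1 / real (Suc k) / 2"
      by (rule tendstoD[OF l]) simp
    then obtain b :: real where b: "b < 1" "\<And>r. b < r \<Longrightarrow> r < 1 \<Longrightarrow> dist (f (of_real r * \<zeta>)) l < 1 / real (Suc k) / 2"
      unfolding eventually_at_left_field by blast
    obtain m where m: "1 / real (Suc m) < 1 - b"
      using b(1) nat_approx_posE[of "1 - b"] by auto
    have "dist (f (of_real p * \<zeta>)) (f (of_real q * \<zeta>)) \<le> 1 / real (Suc k)"
      if "p \<in> {1 - 1 / real (Suc m)<..<1}" "q \<in> {1 - 1 / real (Suc m)<..<1}" for p q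
    proof -
      have "b < p" "p < 1" "b < q" "q < 1" using m that by auto
      then show ?thesis
        using b(2)[of p] b(2)[of q] dist_triangle2[of "f (of_real p * \<zeta>)" "f (of_real q * \<zeta>)" l]
        by linarith
    qed
    then show "\<exists>m. ?C k m" by blast
  qed
next
  assume C: "\<forall>k. \<exists>m. ?C k m"
  \<comment> \<open>Continuity in the radius extends the bound from rational to real radii in one
    argument; using it twice frees both.\<close>
  have ext: "dist (f (of_real p * \<zeta>)) (f (of_real q * \<zeta>)) \<le> e"
    if le: "\<forall>p\<in>\<rat> \<inter> {b<..<1}. dist (f (of_real p * \<zeta>)) (f (of_real q * \<zeta>)) \<le> e"
      and b: "0 \<le> b" "b < p" "p < 1" for b p q e
  proof (rule ccontr)
    assume "\<not> ?thesis"
    then have gt: "e < dist (f (of_real p * \<zeta>)) (f (of_real q * \<zeta>))" by simp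
    have "isCont (\<lambda>r::real. f (of_real r * \<zeta>)) p"
    proof -
      have "continuous_on {0<..<1::real} (\<lambda>r. f (of_real r * \<zeta>))"
        by (rule continuous_on_compose2[OF f]) (auto intro!: continuous_intros simp: norm_mult \<zeta>)
      then show ?thesis using b by (simp add: continuous_on_eq_continuous_at)
    qed
    then have "((\<lambda>r. dist (f (of_real r * \<zeta>)) (f (of_real q * \<zeta>))) \<longlongrightarrow> dist (f (of_real p * \<zeta>)) (f (of_real q * \<zeta>))) (at p)"
      unfolding isCont_def by (intro tendsto_intros)
    then have "((\<lambda>r. dist (f (of_real r * \<zeta>)) (f (of_real q * \<zeta>))) \<longlongrightarrow> dist (f (of_real p * \<zeta>)) (f (of_real q * \<zeta>))) (at_right p)"
      using filterlim_at_split by blast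
    then have "\<forall>\<^sub>F r in at_right p. e < dist (f (of_real r * \<zeta>)) (f (of_real q * \<zeta>))"
      using gt by (rule order_tendstoD)
    then obtain c where c: "p < c" "\<And>r. p < r \<Longrightarrow> r < c \<Longrightarrow> e < dist (f (of_real r * \<zeta>)) (f (of_real q * \<zeta>))"
      unfolding eventually_at_right_field by blast
    obtain r where r: "r \<in> \<rat>" "p < r" "r < min c 1" using Rats_dense_in_real[of p "min c 1"] c(1) b by auto
    then have "dist (f (of_real r * \<zeta>)) (f (of_real q * \<zeta>)) \<le> e" using le b by auto
    then show False using c(2)[of r] r by auto
  qed
  have C': "\<exists>m. \<forall>p\<in>{1 - 1 / real (Suc m)<..<1}. \<forall>q\<in>{1 - 1 / real (Suc m)<..<1}.
      dist (f (of_real p * \<zeta>)) (f (of_real q * \<zeta>)) \<le> 1 / real (Suc k)" for k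
  proof -
    obtain m where m: "?C k m" using C by blast
    define b where "b = 1 - 1 / real (Suc m)"
    have b0: "0 \<le> b" by (simp add: b_def)
    have "dist (f (of_real p * \<zeta>)) (f (of_real q * \<zeta>)) \<le> 1 / real (Suc k)"
      if p: "b < p" "p < 1" and q: "b < q" "q < 1" for p q
    proof (rule ext[OF _ b0 p], rule ballI)
      fix p' assume p': "p' \<in> \<rat> \<inter> {b<..<1}"
      have "dist (f (of_real q * \<zeta>)) (f (of_real p' * \<zeta>)) \<le> 1 / real (Suc k)"
        by (rule ext[OF _ b0 q]) (use m p' in \<open>auto simp: b_def\<close>)
      then show "dist (f (of_real p' * \<zeta>)) (f (of_real q * \<zeta>)) \<le> 1 / real (Suc k)" by (simp add: dist_commute)
    qed
    then show ?thesis unfolding b_def by (metis greaterThanLessThan_iff)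
  qed
  define x where "x n = 1 - 1 / real (Suc (Suc n))" for n
  have x: "x n > 1 - 1 / real (Suc m)" "x n < 1" if "n \<ge> m" for n m
    using that by (auto simp: x_def field_simps)
  have "Cauchy (\<lambda>n. f (of_real (x n) * \<zeta>))"
  proof (rule metric_CauchyI)
    fix e :: real assume "e > 0"
    then obtain k where k: "1 / real (Suc k) < e" using nat_approx_posE by blast
    obtain m where m: "\<forall>p\<in>{1 - 1 / real (Suc m)<..<1}. \<forall>q\<in>{1 - 1 / real (Suc m)<..<1}.
      dist (f (of_real p * \<zeta>)) (f (of_real q * \<zeta>)) \<le> 1 / real (Suc k)" using C' by blast
    have "dist (f (of_real (x i) * \<zeta>)) (f (of_real (x j) * \<zeta>)) < e" if "i \<ge> m" "j \<ge> m" for i j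
      using m x[OF that(1)] x[OF that(2)] k by (meson greaterThanLessThan_iff le_less_trans)
    then show "\<exists>M. \<forall>i\<ge>M. \<forall>j\<ge>M. dist (f (of_real (x i) * \<zeta>)) (f (of_real (x j) * \<zeta>)) < e" by blast
  qed
  then obtain l where l: "(\<lambda>n. f (of_real (x n) * \<zeta>)) \<longlonglongrightarrow> l" using Cauchy_convergent_iff convergent_def by blast
  have "((\<lambda>r::real. f (of_real r * \<zeta>)) \<longlongrightarrow> l) (at_left 1)"
  proof (rule tendstoI)
    fix e :: real assume "e > 0"
    then obtain k where k: "1 / real (Suc k) < e" using nat_approx_posE by blast
    obtain m where m: "\<forall>p\<in>{1 - 1 / real (Suc m)<..<1}. \<forall>q\<in>{1 - 1 / real (Suc m)<..<1}.
      dist (f (of_real p * \<zeta>)) (f (of_real q * \<zeta>)) \<le> 1 / real (Suc k)" using C' by blast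
    have "dist (f (of_real r * \<zeta>)) l < e" if r: "1 - 1 / real (Suc m) < r" "r < 1" for r
    proof -
      have "(\<lambda>n. dist (f (of_real r * \<zeta>)) (f (of_real (x n) * \<zeta>))) \<longlonglongrightarrow> dist (f (of_real r * \<zeta>)) l"
        by (intro tendsto_intros l)
      then have "dist (f (of_real r * \<zeta>)) l \<le> 1 / real (Suc k)"
        by (rule LIMSEQ_le_const2) (use m r x in \<open>auto intro!: exI[of _ m]\<close>)
      then show ?thesis using k by simp
    qed
    then show "\<forall>\<^sub>F r in at_left 1. dist (f (of_real r * \<zeta>)) l < e"
      unfolding eventually_at_left_field by (intro exI[of _ "1 - 1 / real (Suc m)"]) simp
  qed
  then show ?L unfolding has_radial_limit_def by blast
qed

lemma radial_measurable_point:
  assumes f: "continuous_on (ball 0 1) f" and r: "\<bar>r\<bar> < 1"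
  shows "(\<lambda>\<zeta>. f (of_real r * \<zeta>)) \<in> borel_measurable circ"
  by (intro circle_continuous_measurable continuous_on_compose2[OF f])
    (use r in \<open>auto intro!: continuous_intros simp: norm_mult\<close>)

lemma has_radial_limit_sets:
  assumes f: "continuous_on (ball 0 1) f"
  shows "{\<zeta> \<in> space circ. has_radial_limit f \<zeta>} \<in> sets circ"
proof -
  have Q: "countable (\<rat> \<inter> {a<..<1::real})" for a using countable_rat by auto
  have meas: "{\<zeta> \<in> space circ. dist (f (of_real p * \<zeta>)) (f (of_real q * \<zeta>)) \<le> 1 / real (Suc k)} \<in> sets circ"
    if "p \<in> \<rat> \<inter> {1 - 1 / real (Suc m)<..<1}" "q \<in> \<rat> \<inter> {1 - 1 / real (Suc m)<..<1}" for p q k m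
  proof -
    have "0 \<le> 1 - 1 / real (Suc m)" by simp
    then have "\<bar>p\<bar> < 1" "\<bar>q\<bar> < 1"
      using that unfolding Int_iff greaterThanLessThan_iff by linarith+
    then have [measurable]: "(\<lambda>\<zeta>. f (of_real p * \<zeta>)) \<in> borel_measurable circ" "(\<lambda>\<zeta>. f (of_real q * \<zeta>)) \<in> borel_measurable circ"
      using radial_measurable_point[OF f] by auto
    show ?thesis by measurable
  qed
  have "{\<zeta> \<in> space circ. \<forall>k. \<exists>m. \<forall>p\<in>\<rat> \<inter> {1 - 1 / real (Suc m)<..<1}. \<forall>q\<in>\<rat> \<inter> {1 - 1 / real (Suc m)<..<1}.
      dist (f (of_real p * \<zeta>)) (f (of_real q * \<zeta>)) \<le> 1 / real (Suc k)} \<in> sets circ"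
    by (intro sets.sets_Collect_countable_All sets.sets_Collect_countable_Ex sets.sets_Collect_countable_All' Q meas)
  also have "{\<zeta> \<in> space circ. \<forall>k. \<exists>m. \<forall>p\<in>\<rat> \<inter> {1 - 1 / real (Suc m)<..<1}. \<forall>q\<in>\<rat> \<inter> {1 - 1 / real (Suc m)<..<1}.
      dist (f (of_real p * \<zeta>)) (f (of_real q * \<zeta>)) \<le> 1 / real (Suc k)} =
      {\<zeta> \<in> space circ. has_radial_limit f \<zeta>}"
    using has_radial_limit_iff_Cauchy[OF f] by auto
  finally show ?thesis .
qed

text \<open>Where the radial limit does not exist, \<^const>\<open>radial_limit\<close> has the constant value \<open>THE l. False\<close>.\<close>

lemma radial_limit_measurable:
  assumes f: "continuous_on (ball 0 1) f"
  shows "radial_limit f \<in> borel_measurable circ"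
proof -
  have [measurable]: "{\<zeta> \<in> space circ. has_radial_limit f \<zeta>} \<in> sets circ"
    by (rule has_radial_limit_sets[OF f])
  have [measurable]: "(\<lambda>\<zeta>. f (of_real (1 - 1 / real (Suc (Suc n))) * \<zeta>)) \<in> borel_measurable circ" for n
    by (rule radial_measurable_point[OF f]) simp
  have eq: "radial_limit f \<zeta> = (if has_radial_limit f \<zeta>
      then lim (\<lambda>n. f (of_real (1 - 1 / real (Suc (Suc n))) * \<zeta>)) else (THE l. False))" for \<zeta>
  proof (cases "has_radial_limit f \<zeta>")
    case True
    then show ?thesis
      using limI[OF filterlim_compose[OF has_radial_limitD radius_sequence]] by simp
  next
    case False
    then have "(\<lambda>l. ((\<lambda>r::real. f (of_real r * \<zeta>)) \<longlongrightarrow> l) (at_left 1)) = (\<lambda>_. False)"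
      unfolding has_radial_limit_def by blast
    with False show ?thesis unfolding radial_limit_def Topological_Spaces.Lim_def by simp
  qed
  show ?thesis unfolding eq[abs_def] by measurable
qed

text \<open>The two angles 0 and 2 pi, excluded because \<open>Arg2pi\<close> jumps there, form a
  null set.\<close>

lemma circle_AE_I:
  assumes P: "{z \<in> space circ. P z} \<in> sets circ"
    and AE: "AE t in lborel. 0 < t \<longrightarrow> t < 2 * pi \<longrightarrow> P (cis t)"
  shows "AE z in circ. P z"
proof -
  have cis: "cis \<in> measurable (uniform_measure lborel {0..2 * pi}) (restrict_space borel (sphere 0 1))"
    using cis_measurable by simp
  have "AE t in lborel. t \<noteq> 0" "AE t in lborel. t \<noteq> 2 * pi" by (rule AE_lborel_singleton)+
  with AE have "AE t in lborel. t \<in> {0..2 * pi} \<longrightarrow> P (cis t)"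
    by eventually_elim auto
  then have "AE t in uniform_measure lborel {0..2 * pi}. P (cis t)"
    by (subst AE_uniform_measure) auto
  then show ?thesis
    unfolding circle_measure_def
    by (subst AE_distr_iff[OF cis]) (use P in \<open>auto simp: sets_circle space_restrict_space\<close>)
qed

lemma hardy_continuous: "continuous_on (ball 0 1) (hardy x)"
  by (rule holomorphic_on_imp_continuous_on[OF hardy_holomorphic])

abbreviation bdry :: "l2 \<Rightarrow> complex \<Rightarrow> complex" where "bdry x \<equiv> radial_limit (hardy x)"

lemma bdry_measurable [measurable]: "bdry x \<in> borel_measurable circ"
  by (rule radial_limit_measurable[OF hardy_continuous])

text \<open>The function g of \<open>fatou_l2\<close> agrees almost everywhere with
  \<open>bdry x\<close>, so square integrability and the norm pass from the L^2 limit of the partial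
  sums to the radial limits.\<close>

lemma hardy_boundary:
  "AE z in circ. has_radial_limit (hardy x) z" (is ?A)
  "sq_int (bdry x)" (is ?B)
  "(\<integral>z. (norm (bdry x z))\<^sup>2 \<partial>circ) = (norm x)\<^sup>2" (is ?C)
proof -
  obtain g where g: "sq_int g"
    "(\<lambda>N. \<integral>z. (norm ((\<Sum>n<N. coord x n * z ^ n) - g z))\<^sup>2 \<partial>circ) \<longlonglongrightarrow> 0"
    "AE t in lborel. 0 < t \<longrightarrow> t < 2 * pi \<longrightarrow>
      ((\<lambda>r. hardy x (of_real r * cis t)) \<longlongrightarrow> g (cis t)) (at_left 1)"
    by (rule fatou_l2[of x])
  have [measurable]: "g \<in> borel_measurable circ" by (rule sq_int_measurable[OF g(1)])
  have [measurable]: "{\<zeta> \<in> space circ. has_radial_limit (hardy x) \<zeta>} \<in> sets circ"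
    by (rule has_radial_limit_sets[OF hardy_continuous])
  have ae: "AE z in circ. has_radial_limit (hardy x) z \<and> bdry x z = g z"
  proof (rule circle_AE_I)
    show "{z \<in> space circ. has_radial_limit (hardy x) z \<and> bdry x z = g z} \<in> sets circ" by measurable
    show "AE t in lborel. 0 < t \<longrightarrow> t < 2 * pi \<longrightarrow> has_radial_limit (hardy x) (cis t) \<and> bdry x (cis t) = g (cis t)"
      using g(3) by eventually_elim (auto simp: has_radial_limit_def radial_limitI)
  qed
  then show ?A by eventually_elim simp
  have sq: "AE z in circ. (norm (bdry x z))\<^sup>2 = (norm (g z))\<^sup>2" using ae by eventually_elim simp
  have "integrable circ (\<lambda>z. (norm (bdry x z))\<^sup>2) \<longleftrightarrow> integrable circ (\<lambda>z. (norm (g z))\<^sup>2)"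
    by (rule integrable_cong_AE[OF _ _ sq]) measurable
  then show ?B using g(1) by (simp add: sq_int_def)
  have "(\<integral>z. (norm (bdry x z))\<^sup>2 \<partial>circ) = (\<integral>z. (norm (g z))\<^sup>2 \<partial>circ)"
    by (rule integral_cong_AE[OF _ _ sq]) measurable
  moreover have "(\<lambda>N. \<Sum>n<N. (norm (coord x n))\<^sup>2) \<longlonglongrightarrow> (\<integral>z. (norm (g z))\<^sup>2 \<partial>circ)"
    unfolding circle_integral_norm_sum[OF finite_lessThan, symmetric]
    by (rule L2_norm_limit[OF sq_int_continuous g(1,2)]) (intro continuous_intros)
  moreover have "(\<lambda>N. \<Sum>n<N. (norm (coord x n))\<^sup>2) \<longlonglongrightarrow> (norm x)\<^sup>2"
    unfolding norm_sq_l2 by (rule summable_LIMSEQ[OF summable_coord])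
  ultimately show ?C using LIMSEQ_unique by metis
qed

lemma hardy_add: "hardy (x + y) = (\<lambda>z. hardy x z + hardy y z)"
  by (rule ext, rename_tac z, case_tac "norm z < 1")
    (use hardy_sums in \<open>auto simp: hardy_def[of "x + y"] ring_distribs suminf_add[symmetric] sums_iff hardy_def\<close>)

lemma hardy_scaleC: "hardy (scaleC c x) = (\<lambda>z. c * hardy x z)"
proof
  fix z show "hardy (scaleC c x) z = c * hardy x z"
  proof (cases "norm z < 1")
    case True
    have "(\<lambda>n. c * (coord x n * z ^ n)) sums (c * hardy x z)" by (intro sums_mult hardy_sums True)
    then show ?thesis using hardy_sums[OF True, of "scaleC c x"] by (simp add: sums_iff mult.assoc)
  qed (simp add: hardy_def)
qed

lemma bdry_add: "AE z in circ. bdry (x + y) z = bdry x z + bdry y z"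
  using hardy_boundary(1)[of x] hardy_boundary(1)[of y]
  by eventually_elim (auto intro!: radial_limitI tendsto_add has_radial_limitD simp: hardy_add)

lemma bdry_scaleC: "AE z in circ. bdry (scaleC c x) z = c * bdry x z"
  using hardy_boundary(1)[of x]
  by eventually_elim (auto intro!: radial_limitI tendsto_mult_left has_radial_limitD simp: hardy_scaleC)

text \<open>Polarization: the squared norm of x + y is expanded once in \<open>l2\<close> and once
  as an integral over the circle. \<open>H2_inner_hardy\<close> then obtains the imaginary part by
  replacing x with -i x.\<close>

lemma Re_H2_inner_hardy: "Re (H2_inner (hardy x) (hardy y)) = inner x y"
proof -
  note sx = hardy_boundary(2)[of x] and sy = hardy_boundary(2)[of y]
  have int: "integrable circ (\<lambda>z. bdry x z * cnj (bdry y z))" by (intro sq_int_product sq_int_cnj sx sy)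
  have i2: "integrable circ (\<lambda>z. (norm (bdry x z))\<^sup>2)" "integrable circ (\<lambda>z. (norm (bdry y z))\<^sup>2)"
    using sx sy by (auto simp: sq_int_def)
  have eq: "(norm (a + b))\<^sup>2 = (norm a)\<^sup>2 + (norm b)\<^sup>2 + 2 * Re (a * cnj b)" for a b :: complex
    unfolding cmod_power2 by (simp add: power2_eq_square algebra_simps)
  have "(norm (x + y))\<^sup>2 = (\<integral>z. (norm (bdry (x + y) z))\<^sup>2 \<partial>circ)" by (simp add: hardy_boundary(3))
  also have "\<dots> = (\<integral>z. (norm (bdry x z))\<^sup>2 + (norm (bdry y z))\<^sup>2 + 2 * Re (bdry x z * cnj (bdry y z)) \<partial>circ)"
  proof (rule integral_cong_AE)
    show "AE z in circ. (norm (bdry (x + y) z))\<^sup>2 =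
        (norm (bdry x z))\<^sup>2 + (norm (bdry y z))\<^sup>2 + 2 * Re (bdry x z * cnj (bdry y z))"
      using bdry_add[of x y] by eventually_elim (simp add: eq)
    have "(\<lambda>z. Re (bdry x z * cnj (bdry y z))) \<in> borel_measurable circ"
      using integrable_Re[OF int] by (rule borel_measurable_integrable)
    then show "(\<lambda>z. (norm (bdry x z))\<^sup>2 + (norm (bdry y z))\<^sup>2 + 2 * Re (bdry x z * cnj (bdry y z))) \<in> borel_measurable circ"
      by measurable
  qed measurable
  also have "\<dots> = (norm x)\<^sup>2 + (norm y)\<^sup>2 + 2 * (\<integral>z. Re (bdry x z * cnj (bdry y z)) \<partial>circ)"
    using i2 integrable_Re[OF int]
    by (simp add: hardy_boundary(3) del: times_complex.simps cnj.simps)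
  also have "(\<integral>z. Re (bdry x z * cnj (bdry y z)) \<partial>circ) = Re (H2_inner (hardy x) (hardy y))"
    unfolding H2_inner_def circle_inner_def by (rule integral_Re[OF int])
  finally show ?thesis
    by (simp add: power2_norm_eq_inner inner_add_left inner_add_right inner_commute)
qed

lemma H2_inner_hardy: "H2_inner (hardy x) (hardy y) = cinner x y"
proof -
  have "H2_inner (hardy (scaleC (- \<i>) x)) (hardy y) = - \<i> * H2_inner (hardy x) (hardy y)"
  proof -
    have "(\<integral>z. bdry (scaleC (- \<i>) x) z * cnj (bdry y z) \<partial>circ) = (\<integral>z. - \<i> * (bdry x z * cnj (bdry y z)) \<partial>circ)"
    proof (rule integral_cong_AE)
      show "AE z in circ. bdry (scaleC (- \<i>) x) z * cnj (bdry y z) = - \<i> * (bdry x z * cnj (bdry y z))"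
        using bdry_scaleC[of "- \<i>" x] by eventually_elim simp
    qed (intro borel_measurable_integrable integrable_mult_right impI sq_int_product sq_int_cnj hardy_boundary(2))+
    also have "\<dots> = - \<i> * (\<integral>z. bdry x z * cnj (bdry y z) \<partial>circ)" by (rule integral_mult_right_zero)
    finally show ?thesis unfolding H2_inner_def circle_inner_def .
  qed
  then have "Im (H2_inner (hardy x) (hardy y)) = inner (scaleC (- \<i>) x) y"
    using Re_H2_inner_hardy[of "scaleC (- \<i>) x" y] by simp
  also have "\<dots> = Im (cinner x y)" by (simp add: inner_l2_def cinner_scaleC_left)
  finally show ?thesis using Re_H2_inner_hardy[of x y] by (simp add: complex_eq_iff inner_l2_def)
qed

text \<open>An isometry has closed range, so v can be projected onto the range; the adjoint sends v
  to the preimage of that projection.\<close>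

lemma isometry_adjoint:
  fixes S :: "'a::{real_inner, banach} \<Rightarrow> 'a"
  assumes S: "bounded_linear S" and iso: "\<And>u v. inner (S u) (S v) = inner u v"
  obtains S' where "bounded_linear S'" "\<And>u v. inner (S u) v = inner u (S' v)" "\<And>u. S' (S u) = u"
proof -
  note linS = bounded_linear.linear[OF S]
  have normS: "norm (S u) = norm u" for u by (simp add: norm_eq_sqrt_inner iso)
  have distS: "dist (S u) (S v) = dist u v" for u v
    unfolding dist_norm linear_diff[OF linS, symmetric] by (rule normS)
  have "closed (range S)"
    unfolding closed_sequential_limits
  proof (intro allI impI, elim conjE)
    fix f p assume "\<forall>n. f n \<in> range S" and fp: "f \<longlonglongrightarrow> p"
    then obtain y where y: "\<And>n. f n = S (y n)" unfolding image_iff by metis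
    have "Cauchy y" using LIMSEQ_imp_Cauchy[OF fp] unfolding Cauchy_def y distS .
    then obtain u where "y \<longlonglongrightarrow> u" using Cauchy_convergent_iff convergent_def by blast
    then have "f \<longlonglongrightarrow> S u" unfolding y[abs_def] by (rule bounded_linear.tendsto[OF S])
    then show "p \<in> range S" using fp LIMSEQ_unique by blast
  qed
  then have "\<exists>u. \<forall>w. inner (v - S u) (S w) = 0" for v
    using closest_point_exists_complete[of "range S" v] linear_subspace_image[OF linS subspace_UNIV] by blast
  then obtain S' where S': "\<And>v w. inner (v - S (S' v)) (S w) = 0" by metis
  have adj: "inner (S u) v = inner u (S' v)" for u v
    using S'[of v u] unfolding inner_diff_left iso by (simp add: inner_commute)
  have eqI: "x = y" if "\<And>u::'a. inner u x = inner u y" for x y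
    using that[of "x - y"] by (metis eq_iff_diff_eq_0 inner_diff_right inner_eq_zero_iff)
  have "bounded_linear S'"
  proof (rule bounded_linear_intro[of _ 1])
    show "S' (x + y) = S' x + S' y" for x y by (rule eqI) (simp add: adj[symmetric] inner_add_right)
    show "S' (r *\<^sub>R x) = r *\<^sub>R S' x" for r x by (rule eqI) (simp add: adj[symmetric])
    show "norm (S' x) \<le> norm x * 1" for x
    proof -
      have "(norm (S' x))\<^sup>2 = inner (S (S' x)) x" by (simp add: adj power2_norm_eq_inner)
      also have "\<dots> \<le> norm (S' x) * norm x" using norm_cauchy_schwarz[of "S (S' x)" x] by (simp add: normS)
      finally show ?thesis by (cases "S' x = 0") (auto simp: power2_eq_square)
    qed
  qed
  moreover have "S' (S u) = u" for u by (rule eqI) (simp add: adj[symmetric] iso)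
  ultimately show ?thesis using that adj by blast
qed

lemma cinner_add_right: "cinner x (y + z) = cinner x y + cinner x z"
  by (subst (1 2 3) cinner_commute) (simp add: cinner_add_left)

lemma cinner_scaleC_right: "cinner x (scaleC c y) = cnj c * cinner x y"
  by (subst (1 2) cinner_commute) (simp add: cinner_scaleC_left)

lemma cinner_0_right [simp]: "cinner x 0 = 0" by (simp add: cinner_def)

lemma inner_i_left: "inner (scaleC \<i> x) y = - inner x (scaleC \<i> y)"
  by (simp add: inner_l2_def cinner_scaleC_left cinner_scaleC_right)

lemma cinner_eq_0_imp: "(\<And>u. cinner x u = 0) \<Longrightarrow> x = 0"
  using cinner_self[of x] by simp

lemma l2_eq_cinnerI:
  assumes "\<And>u. cinner x u = cinner y u"
  shows "x = y"
proof -
  have "x - y = x + scaleC (-1) y" by (rule l2_eqI) simp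
  moreover have "x + scaleC (-1) y = 0"
    using assms by (intro cinner_eq_0_imp) (simp add: cinner_add_left cinner_scaleC_left)
  ultimately have "x - y = 0" by simp
  then show ?thesis by simp
qed

lemma hardy_0: "hardy 0 = (\<lambda>z. 0)"
  by (auto simp: hardy_def)

lemma hardy_outside: "norm z \<ge> 1 \<Longrightarrow> hardy x z = 0" by (simp add: hardy_def)

lemma circle_integral_hardy:
  assumes r: "0 \<le> r" "r < 1"
  shows "(\<lambda>n. (norm (coord x n))\<^sup>2 * r ^ (2 * n)) sums (\<integral>\<zeta>. (norm (hardy x (of_real r * \<zeta>)))\<^sup>2 \<partial>circ)"
proof -
  have "norm (complex_of_real r) < 1" using r by simp
  from circle_parseval[OF summable_norm_hardy[OF this]]
  have "(\<lambda>n. (norm (coord x n * of_real r ^ n))\<^sup>2) sums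
      (\<integral>\<zeta>. (norm (\<Sum>n. coord x n * of_real r ^ n * \<zeta> ^ n))\<^sup>2 \<partial>circ)" .
  moreover have "(\<integral>\<zeta>. (norm (\<Sum>n. coord x n * of_real r ^ n * \<zeta> ^ n))\<^sup>2 \<partial>circ) =
      (\<integral>\<zeta>. (norm (hardy x (of_real r * \<zeta>)))\<^sup>2 \<partial>circ)"
    by (intro Bochner_Integration.integral_cong refl)
      (use r in \<open>simp add: hardy_def norm_mult power_mult_distrib mult.assoc\<close>)
  moreover have "(norm (coord x n * of_real r ^ n))\<^sup>2 = (norm (coord x n))\<^sup>2 * r ^ (2 * n)" for n
    using r by (simp add: norm_mult norm_power power_mult_distrib mult.commute flip: power_mult)
  ultimately show ?thesis by simp
qed

lemma H2_iff:
  "f \<in> H2 \<longleftrightarrow> f holomorphic_on ball 0 1 \<and> (\<forall>z. z \<notin> ball 0 1 \<longrightarrow> f z = 0) \<and>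
    (\<exists>B. \<forall>r. 0 \<le> r \<longrightarrow> r < 1 \<longrightarrow> (\<integral>\<zeta>. (norm (f (of_real r * \<zeta>)))\<^sup>2 \<partial>circ) \<le> B)"
  unfolding H2_def bdd_above_def
  by (simp, simp only: Ball_def atLeastLessThan_iff imp_conjL)

lemma hardy_in_H2: "hardy x \<in> H2"
proof -
  have "(\<integral>\<zeta>. (norm (hardy x (of_real r * \<zeta>)))\<^sup>2 \<partial>circ) \<le> (norm x)\<^sup>2" if r: "r \<in> {0..<1}" for r :: real
    unfolding norm_sq_l2
  proof (rule sums_le[OF _ circle_integral_hardy summable_sums[OF summable_coord]])
    show "(norm (coord x n))\<^sup>2 * r ^ (2 * n) \<le> (norm (coord x n))\<^sup>2" for n
      using r by (simp add: mult_left_le power_le_one)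
  qed (use r in auto)
  then show ?thesis
    unfolding H2_iff by (auto intro: hardy_holomorphic hardy_outside)
qed

text \<open>Parseval on the circle of radius r bounds each finite sum of |a_n|^2 r^(2n) by B, and r
  can tend to 1 in a finite sum.\<close>

lemma H2_eq_hardy:
  assumes f: "f \<in> H2"
  obtains x where "f = hardy x"
proof -
  define a where "a n = (deriv ^^ n) f 0 / fact n" for n
  have hol: "f holomorphic_on ball 0 1" and out: "\<And>z. z \<notin> ball 0 1 \<Longrightarrow> f z = 0"
    using f by (auto simp: H2_def)
  obtain B where B: "\<And>r. 0 \<le> r \<Longrightarrow> r < 1 \<Longrightarrow> (\<integral>\<zeta>. (norm (f (of_real r * \<zeta>)))\<^sup>2 \<partial>circ) \<le> B"
    using f unfolding H2_iff by blast
  have sums: "(\<lambda>n. a n * z ^ n) sums f z" if "norm z < 1" for z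
    using holomorphic_power_series[OF hol, of z] that by (simp add: a_def)
  have part: "(\<Sum>n<N. (norm (a n))\<^sup>2 * r ^ (2 * n)) \<le> B" if r: "0 \<le> r" "r < 1" for r :: real and N
  proof -
    \<comment> \<open>Convergence at the larger radius q gives absolute convergence at r, as
      \<open>circle_parseval\<close> requires.\<close>
    obtain q where q: "r < q" "q < 1" using dense[OF r(2)] by blast
    have "summable (\<lambda>n. norm (a n * of_real r ^ n))"
      by (rule powser_insidea[of a "of_real q"])
        (use sums_summable[OF sums[of "of_real q"]] q r in \<open>simp_all add: norm_mult\<close>)
    from circle_parseval[OF this]
    have "(\<lambda>n. (norm (a n * of_real r ^ n))\<^sup>2) sums (\<integral>\<zeta>. (norm (\<Sum>n. a n * of_real r ^ n * \<zeta> ^ n))\<^sup>2 \<partial>circ)" .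
    moreover have "(\<integral>\<zeta>. (norm (\<Sum>n. a n * of_real r ^ n * \<zeta> ^ n))\<^sup>2 \<partial>circ) =
        (\<integral>\<zeta>. (norm (f (of_real r * \<zeta>)))\<^sup>2 \<partial>circ)"
    proof (intro Bochner_Integration.integral_cong refl)
      fix \<zeta> :: complex assume "\<zeta> \<in> space circ"
      then have "norm (of_real r * \<zeta>) < 1" using r by (simp add: norm_mult)
      from sums[OF this] have "(\<Sum>n. a n * of_real r ^ n * \<zeta> ^ n) = f (of_real r * \<zeta>)"
        by (simp add: sums_iff power_mult_distrib mult.assoc)
      then show "(norm (\<Sum>n. a n * of_real r ^ n * \<zeta> ^ n))\<^sup>2 = (norm (f (of_real r * \<zeta>)))\<^sup>2" by simp
    qed
    moreover have eq: "(norm (a n * of_real r ^ n))\<^sup>2 = (norm (a n))\<^sup>2 * r ^ (2 * n)" for n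
      using r by (simp add: norm_mult norm_power power_mult_distrib mult.commute flip: power_mult)
    ultimately have s: "(\<lambda>n. (norm (a n))\<^sup>2 * r ^ (2 * n)) sums (\<integral>\<zeta>. (norm (f (of_real r * \<zeta>)))\<^sup>2 \<partial>circ)"
      by simp
    have "(\<Sum>n<N. (norm (a n))\<^sup>2 * r ^ (2 * n)) \<le> (\<Sum>n. (norm (a n))\<^sup>2 * r ^ (2 * n))"
      by (rule sum_le_suminf[OF sums_summable[OF s]]) (use r in auto)
    also have "\<dots> \<le> B" using B[OF r] s by (simp add: sums_iff)
    finally show ?thesis .
  qed
  have "(\<Sum>n<N. (norm (a n))\<^sup>2) \<le> B" for N
  proof (rule tendsto_upperbound)
    show "((\<lambda>r::real. \<Sum>n<N. (norm (a n))\<^sup>2 * r ^ (2 * n)) \<longlongrightarrow> (\<Sum>n<N. (norm (a n))\<^sup>2)) (at_left 1)"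
      by (rule tendsto_eq_intros refl | simp)+
    show "\<forall>\<^sub>F r in at_left (1::real). (\<Sum>n<N. (norm (a n))\<^sup>2 * r ^ (2 * n)) \<le> B"
      using eventually_radius by eventually_elim (simp add: part)
  qed simp
  then have "summable (\<lambda>n. (norm (a n))\<^sup>2)"
    by (intro summableI_nonneg_bounded[where x = B]) auto
  then have "coord (Abs_l2 a) = a" by (simp add: Abs_l2_inverse)
  then have "f = hardy (Abs_l2 a)"
    using sums out by (auto simp: hardy_def fun_eq_iff sums_iff)
  then show ?thesis using that by blast
qed

lemma hardy_inject [simp]: "hardy x = hardy y \<longleftrightarrow> x = y"
proof
  assume "hardy x = hardy y"
  then have "hardy (x + scaleC (-1) y) = (\<lambda>z. 0)" by (simp add: hardy_add hardy_scaleC)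
  then have "bdry (x + scaleC (-1) y) z = 0" for z by (intro radial_limitI) simp
  then have "(norm (x + scaleC (-1) y))\<^sup>2 = 0" using hardy_boundary(3)[of "x + scaleC (-1) y"] by simp
  then have "coord x n + -1 * coord y n = 0" for n by (metis coord_simps(1,2,6) norm_eq_zero zero_eq_power2)
  then show "x = y" by (intro l2_eqI) simp
qed simp

lemma H2_norm_hardy: "H2_norm (hardy x) = norm x"
  by (simp add: H2_norm_def H2_inner_hardy cinner_self)

text \<open>Reduces the definite description to pairings: the projection is identified as soon as
  its pairings with all boundary functions are known as values of \<open>cinner\<close>.\<close>

lemma P_plus_eqI:
  assumes G: "sq_int G" and x: "\<And>u. circle_inner G (bdry u) = cinner x u"
  shows "P_plus G = hardy x"
proof -
  have diff: "circle_inner (\<lambda>\<zeta>. G \<zeta> - bdry w \<zeta>) (bdry u) = circle_inner G (bdry u) - cinner w u" for w u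
  proof -
    have "(\<integral>\<zeta>. (G \<zeta> - bdry w \<zeta>) * cnj (bdry u \<zeta>) \<partial>circ) =
        (\<integral>\<zeta>. G \<zeta> * cnj (bdry u \<zeta>) - bdry w \<zeta> * cnj (bdry u \<zeta>) \<partial>circ)"
      by (simp add: left_diff_distrib)
    also have "\<dots> = circle_inner G (bdry u) - H2_inner (hardy w) (hardy u)"
      unfolding circle_inner_def H2_inner_def
      by (intro Bochner_Integration.integral_diff sq_int_product sq_int_cnj G hardy_boundary(2))
    finally show ?thesis unfolding circle_inner_def[symmetric] H2_inner_hardy .
  qed
  show ?thesis
    unfolding P_plus_def
  proof (rule the_equality)
    show "hardy x \<in> H2 \<and> (\<forall>f\<in>H2. circle_inner (\<lambda>\<zeta>. G \<zeta> - bdry x \<zeta>) (radial_limit f) = 0)"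
      using hardy_in_H2 by (auto elim!: H2_eq_hardy simp: diff x)
    fix h assume h: "h \<in> H2 \<and> (\<forall>f\<in>H2. circle_inner (\<lambda>\<zeta>. G \<zeta> - radial_limit h \<zeta>) (radial_limit f) = 0)"
    then obtain w where w: "h = hardy w" using H2_eq_hardy by blast
    have "cinner w u = cinner x u" for u
      using h hardy_in_H2[of u] diff[of w u] x[of u] by (simp add: w)
    then show "h = hardy x" unfolding w by (simp add: l2_eq_cinnerI)
  qed
qed

lemma bounded_mult_H2:
  assumes \<phi>: "\<phi> holomorphic_on ball 0 1" "\<And>z. z \<in> ball 0 1 \<Longrightarrow> norm (\<phi> z) \<le> C" and f: "f \<in> H2"
  shows "(\<lambda>z. \<phi> z * f z) \<in> H2"
proof -
  have hol: "f holomorphic_on ball 0 1" and out: "\<And>z. z \<notin> ball 0 1 \<Longrightarrow> f z = 0"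
    using f by (auto simp: H2_def)
  obtain B where B: "\<And>r. 0 \<le> r \<Longrightarrow> r < 1 \<Longrightarrow> (\<integral>\<zeta>. (norm (f (of_real r * \<zeta>)))\<^sup>2 \<partial>circ) \<le> B"
    using f unfolding H2_iff by blast
  have "(\<integral>\<zeta>. (norm (\<phi> (of_real r * \<zeta>) * f (of_real r * \<zeta>)))\<^sup>2 \<partial>circ) \<le> C\<^sup>2 * B"
    if r: "0 \<le> r" "r < 1" for r :: real
  proof -
    have in_ball: "of_real r * \<zeta> \<in> ball 0 1" if "\<zeta> \<in> sphere 0 1" for \<zeta> :: complex
      using r that by (simp add: norm_mult)
    have cont: "continuous_on (sphere 0 1) (\<lambda>\<zeta>. g (of_real r * \<zeta>))" if "g holomorphic_on ball 0 1" for g :: "complex \<Rightarrow> complex"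
      by (rule continuous_on_compose2[OF holomorphic_on_imp_continuous_on[OF that]])
        (use in_ball in \<open>auto intro!: continuous_intros\<close>)
    have "(\<integral>\<zeta>. (norm (\<phi> (of_real r * \<zeta>) * f (of_real r * \<zeta>)))\<^sup>2 \<partial>circ) \<le>
        (\<integral>\<zeta>. C\<^sup>2 * (norm (f (of_real r * \<zeta>)))\<^sup>2 \<partial>circ)"
    proof (rule Bochner_Integration.integral_mono)
      show "integrable circ (\<lambda>\<zeta>. (norm (\<phi> (of_real r * \<zeta>) * f (of_real r * \<zeta>)))\<^sup>2)"
        by (intro circle_continuous_integrable continuous_intros cont \<phi> hol)
      show "integrable circ (\<lambda>\<zeta>. C\<^sup>2 * (norm (f (of_real r * \<zeta>)))\<^sup>2)"
        by (intro circle_continuous_integrable continuous_intros cont hol)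
      show "(norm (\<phi> (of_real r * \<zeta>) * f (of_real r * \<zeta>)))\<^sup>2 \<le> C\<^sup>2 * (norm (f (of_real r * \<zeta>)))\<^sup>2"
        if "\<zeta> \<in> space circ" for \<zeta>
        unfolding norm_mult power_mult_distrib
        using \<phi>(2)[OF in_ball] that by (intro mult_right_mono power_mono) auto
    qed
    also have "\<dots> = C\<^sup>2 * (\<integral>\<zeta>. (norm (f (of_real r * \<zeta>)))\<^sup>2 \<partial>circ)" by simp
    also have "\<dots> \<le> C\<^sup>2 * B" using B[OF r] by (intro mult_left_mono) auto
    finally show ?thesis .
  qed
  then show ?thesis
    unfolding H2_iff using out by (auto intro!: holomorphic_intros \<phi> hol)
qed

text \<open>\<open>H2_positive_operator\<close> speaks of positivity, not symmetry. Over the complex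
  numbers symmetry follows, since realness of the form at i x + y compares the two mixed
  terms.\<close>

lemma symmetric_if_positive:
  assumes add: "\<And>x y. A (x + y) = A x + A y" and scale: "\<And>c x. A (scaleC c x) = scaleC c (A x)"
    and real: "\<And>x. Im (cinner (A x) x) = 0"
  shows "inner (A x) y = inner x (A y)"
proof -
  have "Im (cinner (A (scaleC \<i> x + y)) (scaleC \<i> x + y)) = Re (cinner (A x) y) - Re (cinner (A y) x)"
    using real[of x] real[of y]
    by (simp add: add scale cinner_add_left cinner_add_right cinner_scaleC_left cinner_scaleC_right)
  then have "Re (cinner (A x) y) = Re (cinner (A y) x)" using real[of "scaleC \<i> x + y"] by simp
  then show ?thesis unfolding inner_l2_def[symmetric] by (simp add: inner_commute)
qed

section \<open>The decomposition\<close>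

lemma H2_eq_range: "H2 = range hardy"
  using hardy_in_H2 by (auto elim: H2_eq_hardy)

locale inner_mult =
  fixes I :: "complex \<Rightarrow> complex"
  assumes I: "inner_function I" and I0: "I 0 = 0"
begin

lemma holI: "I holomorphic_on ball 0 1" using I by (simp add: inner_function_def)

lemma contI: "continuous_on (ball 0 1) I" by (rule holomorphic_on_imp_continuous_on[OF holI])

lemma boundary_I: "AE z in circ. has_radial_limit I z \<and> norm (radial_limit I z) = 1"
proof -
  have "AE z in circ. \<exists>l. ((\<lambda>r::real. I (of_real r * z)) \<longlongrightarrow> l) (at_left 1) \<and> norm l = 1"
    using I by (simp add: inner_function_def)
  then show ?thesis by eventually_elim (auto simp: has_radial_limit_def radial_limitI)
qed

lemma mult_exists: "\<exists>y. hardy y = (\<lambda>z. I z * hardy x z)"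
proof -
  obtain C where "\<And>z. z \<in> ball 0 1 \<Longrightarrow> norm (I z) \<le> C"
    using I unfolding inner_function_def bounded_iff by blast
  from bounded_mult_H2[OF holI this hardy_in_H2]
  show ?thesis by (metis H2_eq_hardy)
qed

text \<open>Multiplication by I, transported to coefficient sequences.\<close>

definition S :: "l2 \<Rightarrow> l2" where "S x = (SOME y. hardy y = (\<lambda>z. I z * hardy x z))"

lemma hardy_S: "hardy (S x) = (\<lambda>z. I z * hardy x z)"
  unfolding S_def by (rule someI_ex[OF mult_exists])

lemma S_add: "S (x + y) = S x + S y"
  by (rule hardy_inject[THEN iffD1]) (simp add: hardy_S hardy_add distrib_left)

lemma S_scaleC: "S (scaleC c x) = scaleC c (S x)"
  by (rule hardy_inject[THEN iffD1]) (simp add: hardy_S hardy_scaleC mult_ac)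

lemma bdry_S: "AE z in circ. bdry (S x) z = radial_limit I z * bdry x z"
  using boundary_I hardy_boundary(1)[of x]
  by eventually_elim (auto intro!: radial_limitI tendsto_mult has_radial_limitD simp: hardy_S)

lemma rI_measurable [measurable]: "radial_limit I \<in> borel_measurable circ"
  by (rule radial_limit_measurable[OF contI])

text \<open>On the boundary I has modulus 1 almost everywhere, and the norm is computed
  there.\<close>

lemma norm_S: "norm (S x) = norm x"
proof -
  have "(\<integral>z. (norm (bdry (S x) z))\<^sup>2 \<partial>circ) = (\<integral>z. (norm (bdry x z))\<^sup>2 \<partial>circ)"
  proof (rule integral_cong_AE)
    show "AE z in circ. (norm (bdry (S x) z))\<^sup>2 = (norm (bdry x z))\<^sup>2"
      using bdry_S[of x] boundary_I by eventually_elim (simp add: norm_mult)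
  qed measurable
  then have "(norm (S x))\<^sup>2 = (norm x)\<^sup>2" by (simp only: hardy_boundary(3))
  then show ?thesis by (simp add: power2_eq_iff_nonneg)
qed

lemma bounded_linear_S: "bounded_linear S"
  by (rule bounded_linear_intro[of _ 1]) (simp_all add: S_add S_scaleC[of "of_real _", unfolded scaleC_real] norm_S)

lemma S_isometry: "inner (S u) (S v) = inner u v"
proof -
  have "4 * inner a b = (norm (a + b))\<^sup>2 - (norm (a - b))\<^sup>2" for a b :: l2
    by (simp add: power2_norm_eq_inner inner_simps inner_commute)
  from this[of "S u" "S v"] this[of u v] show ?thesis
    by (simp add: linear_diff[OF bounded_linear.linear[OF bounded_linear_S], symmetric] S_add[symmetric] norm_S)
qed

definition S' :: "l2 \<Rightarrow> l2" where
  "S' = (SOME T. bounded_linear T \<and> (\<forall>u v. inner (S u) v = inner u (T v)) \<and> (\<forall>u. T (S u) = u))"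

lemma S': "bounded_linear S'" "inner (S u) v = inner u (S' v)" "S' (S u) = u"
proof -
  have "\<exists>T. bounded_linear T \<and> (\<forall>u v. inner (S u) v = inner u (T v)) \<and> (\<forall>u. T (S u) = u)"
    by (rule isometry_adjoint[OF bounded_linear_S S_isometry]) blast
  from someI_ex[OF this, folded S'_def]
  show "bounded_linear S'" "inner (S u) v = inner u (S' v)" "S' (S u) = u" by auto
qed

text \<open>The adjoint S' comes from the real inner product; since S commutes with i, it is the
  complex adjoint too.\<close>

lemma cinner_S: "cinner (S u) v = cinner u (S' v)"
proof -
  have "inner (S u) (scaleC \<i> v) = inner u (scaleC \<i> (S' v))"
    using inner_i_left[of "S u" v] inner_i_left[of u "S' v"] S'(2)[of "scaleC \<i> u" v]
    by (simp add: S_scaleC)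
  then show ?thesis by (simp add: cinner_eq_inner S'(2))
qed

lemma cinner_S_right: "cinner u (S v) = cinner (S' u) v"
  by (subst (1 2) cinner_commute) (simp add: cinner_S)

lemma S'_scaleC: "S' (scaleC c x) = scaleC c (S' x)"
  by (rule l2_eq_cinnerI) (simp add: cinner_S_right[symmetric] cinner_scaleC_left)

text \<open>A fixed vector satisfies (1 - I) u = 0. Here I(0) = 0 enters: I has modulus below 1 near
  the origin, so u vanishes there, and on the whole disk by the identity theorem.\<close>

lemma S_fixed_point:
  assumes "S u = u" shows "u = 0"
proof -
  have eq: "(1 - I z) * hardy u z = 0" for z
    using fun_cong[OF hardy_S[of u], of z] assms by (simp add: algebra_simps)
  have "isCont I 0" using contI by (simp add: continuous_on_eq_continuous_at)
  then obtain d where d: "d > 0" "\<And>z. dist z 0 < d \<Longrightarrow> dist (I z) 0 < 1"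
    unfolding continuous_at_eps_delta I0 by (metis zero_less_one)
  define e where "e = min d 1"
  have e: "e > 0" using d by (simp add: e_def)
  have zero: "hardy u z = 0" if "z \<in> ball 0 e" for z
  proof -
    have "norm (I z) < 1" using d(2)[of z] that by (simp add: e_def)
    then have "1 - I z \<noteq> 0" by auto
    then show ?thesis using eq[of z] by simp
  qed
  have "hardy u z = 0" if "z \<in> ball 0 1" for z
    by (rule analytic_continuation_open[of "ball 0 e" "ball 0 1" "hardy u" "\<lambda>_. 0" z])
      (use e zero that hardy_holomorphic[of u] in \<open>auto simp: e_def\<close>)
  then have "hardy u z = hardy 0 z" for z
    by (cases "norm z < 1") (auto simp: hardy_0 hardy_outside)
  then have "hardy u = hardy 0" by blast
  then show ?thesis by simp
qed

definition X :: "l2 \<Rightarrow> l2" where "X v = (1/4) *\<^sub>R (v + S v + S' v + S (S' v))"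

lemma bounded_linear_X: "bounded_linear X"
  unfolding X_def
  by (intro bounded_linear_add bounded_linear_scaleR_right bounded_linear_const_scaleR
      bounded_linear_compose[OF bounded_linear_scaleR_right] bounded_linear_ident bounded_linear_S S'
      bounded_linear_compose[OF bounded_linear_S S'(1)])

lemma norm_S': "norm (S' x) \<le> norm x"
proof -
  have "(norm (S' x))\<^sup>2 = inner (S (S' x)) x" by (simp add: S'(2) power2_norm_eq_inner)
  also have "\<dots> \<le> norm (S' x) * norm x" using norm_cauchy_schwarz[of "S (S' x)" x] by (simp add: norm_S)
  finally show ?thesis by (cases "S' x = 0") (auto simp: power2_eq_square)
qed

lemma norm_X: "norm (X v) \<le> norm v"
proof -
  have "norm (v + S v + S' v + S (S' v)) \<le> norm v + norm (S v) + norm (S' v) + norm (S (S' v))"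
    by (intro norm_triangle_le add_mono order_refl)
  also have "\<dots> \<le> 4 * norm v" using norm_S' by (simp add: norm_S)
  finally show ?thesis by (simp add: X_def)
qed

lemma X_symmetric: "inner (X u) v = inner u (X v)"
proof -
  have "inner (S' a) b = inner a (S b)" for a b using S'(2)[of b a] by (simp add: inner_commute)
  then show ?thesis by (simp add: X_def inner_add_left inner_add_right S'(2))
qed

lemma X_scaleC: "X (scaleC c v) = scaleC c (X v)"
  unfolding X_def by (rule l2_eqI) (simp add: S_scaleC S'_scaleC algebra_simps)

text \<open>For the analytic symbol the product already is a boundary function of the Hardy space,
  so the projection leaves it alone. For the conjugate symbol, moving b to the other side of the
  pairing reduces to the first case and produces the adjoint.\<close>

lemma toeplitz_b:
  assumes b: "b = (\<lambda>z. (1 + I z) / 2)"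
  shows "toeplitz (radial_limit b) (hardy x) = hardy ((1/2) *\<^sub>R (x + S x))" (is ?A)
    and "toeplitz (\<lambda>\<zeta>. cnj (radial_limit b \<zeta>)) (hardy x) = hardy ((1/2) *\<^sub>R (x + S' x))" (is ?B)
proof -
  have contb: "continuous_on (ball 0 1) b" unfolding b by (intro continuous_intros contI) auto
  have [measurable]: "radial_limit b \<in> borel_measurable circ" by (rule radial_limit_measurable[OF contb])
  have rb: "AE z in circ. radial_limit b z = (1 + radial_limit I z) / 2"
    using boundary_I
  proof eventually_elim
    case (elim z)
    then show ?case
      unfolding b by (intro radial_limitI tendsto_intros has_radial_limitD) auto
  qed
  have nb: "AE z in circ. norm (radial_limit b z) \<le> 1"
    using rb boundary_I
  proof eventually_elim
    case (elim z)
    then show ?case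
      using norm_triangle_ineq[of 1 "radial_limit I z"] unfolding elim(1) norm_divide by simp
  qed
  have [measurable]: "(\<lambda>z. cnj (radial_limit b z)) \<in> borel_measurable circ"
    by (rule measurable_compose[of _ _ borel]) (auto intro!: borel_measurable_continuous_onI continuous_intros)
  have sq: "sq_int (\<lambda>\<zeta>. radial_limit b \<zeta> * bdry y \<zeta>)" "sq_int (\<lambda>\<zeta>. cnj (radial_limit b \<zeta>) * bdry y \<zeta>)" for y
    by (rule sq_int_bounded_mult[where C = 1]; use hardy_boundary(2) nb in simp)+
  have half: "AE z in circ. radial_limit b z * bdry y z = bdry ((1/2) *\<^sub>R (y + S y)) z" for y
  proof -
    have "AE z in circ. bdry (scaleC (1/2) (y + S y)) z = 1/2 * bdry (y + S y) z" by (rule bdry_scaleC)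
    with rb bdry_S[of y] bdry_add[of y "S y"] show ?thesis
      by eventually_elim (use scaleC_real[of "1/2" "y + S y"] in \<open>simp add: algebra_simps add_divide_distrib\<close>)
  qed
  have ci: "circle_inner (\<lambda>\<zeta>. radial_limit b \<zeta> * bdry y \<zeta>) (bdry u) = cinner ((1/2) *\<^sub>R (y + S y)) u" for y u
    unfolding H2_inner_hardy[symmetric] H2_inner_def circle_inner_def
  proof (rule integral_cong_AE)
    show "AE z in circ. radial_limit b z * bdry y z * cnj (bdry u z) = bdry ((1/2) *\<^sub>R (y + S y)) z * cnj (bdry u z)"
      using half[of y] by eventually_elim simp
  qed (intro borel_measurable_integrable sq_int_product sq_int_cnj sq hardy_boundary(2))+
  show ?A unfolding toeplitz_def by (rule P_plus_eqI[OF sq(1) ci])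
  show ?B unfolding toeplitz_def
  proof (rule P_plus_eqI[OF sq(2)])
    fix u
    have "circle_inner (\<lambda>\<zeta>. cnj (radial_limit b \<zeta>) * bdry x \<zeta>) (bdry u) =
        (\<integral>z. cnj (radial_limit b z * bdry u z * cnj (bdry x z)) \<partial>circ)"
      unfolding circle_inner_def by (simp add: mult_ac)
    also have "\<dots> = cnj (circle_inner (\<lambda>\<zeta>. radial_limit b \<zeta> * bdry u \<zeta>) (bdry x))"
      unfolding circle_inner_def by (rule Bochner_Integration.integral_cnj)
    also have "\<dots> = cinner x ((1/2) *\<^sub>R (u + S u))" by (simp add: ci flip: cinner_commute)
    also have "\<dots> = cinner ((1/2) *\<^sub>R (x + S' x)) u"
      unfolding scaleC_real[symmetric] cinner_scaleC_left cinner_scaleC_right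
      by (simp add: cinner_add_left cinner_add_right cinner_S_right)
    finally show "circle_inner (\<lambda>\<zeta>. cnj (radial_limit b \<zeta>) * bdry x \<zeta>) (bdry u) =
        cinner ((1/2) *\<^sub>R (x + S' x)) u" .
  qed
qed

lemma dBR_operator_square:
  assumes b: "b = (\<lambda>z. (1 + I z) / 2)"
  shows "(\<lambda>z. hardy x z - toeplitz (radial_limit b) (toeplitz (\<lambda>\<zeta>. cnj (radial_limit b \<zeta>)) (hardy x)) z)
    = hardy (x - X x)"
proof -
  have "(1/2) *\<^sub>R ((1/2) *\<^sub>R (x + S' x) + S ((1/2) *\<^sub>R (x + S' x))) = X x"
    using linear_cmul[OF bounded_linear.linear[OF bounded_linear_S], of "1/2" "x + S' x"]
    by (intro l2_eqI) (simp add: X_def S_add algebra_simps)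
  moreover have "hardy (x - X x) = (\<lambda>z. hardy x z - hardy (X x) z)"
  proof -
    have "hardy (x - X x) = hardy (x + scaleC (-1) (X x))"
      by (rule arg_cong[of _ _ hardy]) (rule l2_eqI, simp)
    then show ?thesis by (simp add: hardy_add hardy_scaleC)
  qed
  ultimately show ?thesis by (simp only: toeplitz_b[OF b])
qed

text \<open>The predicate under \<open>SOME\<close> in the definition of the operator root, with the
  Toeplitz operators replaced by X. As every element of \<open>H2\<close> is some
  \<open>hardy x\<close>, the two predicates are equal, so the choices coincide.\<close>

definition sqrt_property :: "((complex \<Rightarrow> complex) \<Rightarrow> complex \<Rightarrow> complex) \<Rightarrow> bool" where
  "sqrt_property B \<longleftrightarrow> H2_positive_operator B \<and> (\<forall>x. B (B (hardy x)) = hardy (x - X x))"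

lemma sqrt_property_exists: "\<exists>B. sqrt_property B"
proof -
  have X_apply: "blinfun_apply (Blinfun X) = X" by (rule bounded_linear_Blinfun_apply[OF bounded_linear_X])
  have "norm (Blinfun X) \<le> 1" by (rule norm_blinfun_bound) (simp_all add: X_apply norm_X)
  from positive_sqrt_exists[OF this, unfolded X_apply, OF X_symmetric]
  obtain A :: "l2 \<Rightarrow>\<^sub>L l2" where A: "\<And>v. A (A v) = v - X v" "\<And>u v. inner (A u) v = inner u (A v)"
    "\<And>v. 0 \<le> inner (A v) v"
    "\<And>C v. bounded_linear C \<Longrightarrow> (\<And>v. X (C v) = C (X v)) \<Longrightarrow> A (C v) = C (A v)"
    by blast
  have A_scaleC: "A (scaleC c v) = scaleC c (A v)" for c v
    by (rule A(4)[OF bounded_linear_scaleC X_scaleC])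
  define B where "B f = hardy (A (inv hardy f))" for f
  have inj: "inj hardy" by (simp add: inj_def)
  have B: "B (hardy x) = hardy (A x)" for x by (simp add: B_def inv_f_f[OF inj])
  have "H2_bounded_operator B"
    unfolding H2_bounded_operator_def
  proof (intro conjI ballI allI)
    show "B \<in> H2 \<rightarrow> H2" by (auto simp: B_def hardy_in_H2)
    show "B (\<lambda>z. f z + g z) = (\<lambda>z. B f z + B g z)" if "f \<in> H2" "g \<in> H2" for f g
      using that by (elim H2_eq_hardy) (simp add: hardy_add[symmetric] B blinfun.add_right)
    show "B (\<lambda>z. c * f z) = (\<lambda>z. c * B f z)" if "f \<in> H2" for c f
      using that by (elim H2_eq_hardy) (simp add: hardy_scaleC[symmetric] B A_scaleC)
    show "\<exists>C. \<forall>f\<in>H2. H2_norm (B f) \<le> C * H2_norm f"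
      by (rule exI[of _ "norm A"]) (auto elim!: H2_eq_hardy simp: B H2_norm_hardy norm_blinfun)
  qed
  moreover have "H2_inner (B f) f \<in> \<real>\<^sub>\<ge>\<^sub>0" if f: "f \<in> H2" for f
  proof -
    obtain x where x: "f = hardy x" using H2_eq_hardy[OF f] by blast
    \<comment> \<open>By symmetry and complex linearity of A this number equals its own negative; it
      is the imaginary part of the quadratic form, which is therefore real.\<close>
    have "inner (A x) (scaleC \<i> x) = - inner (A x) (scaleC \<i> x)"
      using A(2)[of x "scaleC \<i> x"] inner_i_left[of x "A x"] by (simp add: A_scaleC inner_commute)
    then show ?thesis using A(3)[of x]
      by (simp add: x B H2_inner_hardy cinner_eq_inner complex_nonneg_Reals_iff)
  qed
  ultimately have "sqrt_property B"
    unfolding sqrt_property_def H2_positive_operator_def by (simp add: B A(1))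
  then show ?thesis by blast
qed

lemma dBR_operator_sqrt:
  assumes b: "b = (\<lambda>z. (1 + I z) / 2)"
  shows "sqrt_property (dBR_operator b)"
proof -
  have "(\<forall>f\<in>H2. B (B f) = (\<lambda>z. f z - toeplitz (radial_limit b) (toeplitz (\<lambda>\<zeta>. cnj (radial_limit b \<zeta>)) f) z)) \<longleftrightarrow>
      (\<forall>x. B (B (hardy x)) = hardy (x - X x))" for B
    using hardy_in_H2 dBR_operator_square[OF b] by (metis H2_eq_hardy)
  then have "dBR_operator b = (SOME B. sqrt_property B)"
    unfolding dBR_operator_def H2_operator_sqrt_def sqrt_property_def by simp
  then show ?thesis using someI_ex[OF sqrt_property_exists] by simp
qed

lemma mult_range_a: "mult_range (\<lambda>z. (1 - I z) / 2) = {hardy ((1/2) *\<^sub>R (u - S u)) | u. True}"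
proof -
  have "hardy ((1/2) *\<^sub>R (u - S u)) = (\<lambda>z. (1 - I z) / 2 * hardy u z)" for u
  proof -
    have "(1/2) *\<^sub>R (u - S u) = scaleC (1/2) (u + scaleC (-1) (S u))" by (rule l2_eqI) simp
    then show ?thesis by (simp add: hardy_scaleC hardy_add hardy_S algebra_simps fun_eq_iff diff_divide_distrib)
  qed
  moreover have "mult_range (\<lambda>z. (1 - I z) / 2) = {(\<lambda>z. (1 - I z) / 2 * hardy u z) | u. True}"
    unfolding mult_range_def using hardy_in_H2 by (auto elim!: H2_eq_hardy)
  ultimately show ?thesis by simp
qed

text \<open>Orthogonality to every I u moves to the adjoint, so the model space is the kernel of
  S'.\<close>

lemma model_space_eq: "model_space I = {hardy k | k. S' k = 0}"
proof -
  have "(\<forall>g\<in>mult_range I. H2_inner (hardy k) g = 0) \<longleftrightarrow> S' k = 0" for k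
  proof -
    have "mult_range I = {hardy (S u) | u. True}"
      unfolding mult_range_def hardy_S using hardy_in_H2 by (auto elim!: H2_eq_hardy)
    then have "(\<forall>g\<in>mult_range I. H2_inner (hardy k) g = 0) \<longleftrightarrow> (\<forall>u. cinner (S' k) u = 0)"
      by (auto simp: H2_inner_hardy cinner_S_right)
    also have "\<dots> \<longleftrightarrow> S' k = 0" by (metis cinner_eq_0_imp cinner_commute cinner_0_right complex_cnj_zero)
    finally show ?thesis .
  qed
  then show ?thesis
    unfolding model_space_def H2_ominus_def using hardy_in_H2 by (auto elim!: H2_eq_hardy)
qed

lemma decomposition:
  assumes b: "b = (\<lambda>z. (1 + I z) / 2)"
  shows "orthogonal_direct_sum (dBR_inner b) (dBR_space b) (mult_range (\<lambda>z. (1 - I z) / 2)) (model_space I)"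
proof -
  define B where "B = dBR_operator b"
  have pos: "H2_positive_operator B" and BB: "\<And>x. B (B (hardy x)) = hardy (x - X x)"
    using dBR_operator_sqrt[OF b] by (auto simp: sqrt_property_def B_def)
  have bop: "H2_bounded_operator B" using pos by (simp add: H2_positive_operator_def)
  have "\<exists>y. B (hardy x) = hardy y" for x
    using bop hardy_in_H2[of x] unfolding H2_bounded_operator_def by (metis H2_eq_hardy PiE)
  \<comment> \<open>The operator chosen by \<open>SOME\<close>, read on coefficient sequences; the
    facts about it come from positivity and its square alone.\<close>
  then obtain A where A: "\<And>x. B (hardy x) = hardy (A x)" by metis
  have A_add: "A (x + y) = A x + A y" for x y
  proof -
    have "B (\<lambda>z. hardy x z + hardy y z) = (\<lambda>z. B (hardy x) z + B (hardy y) z)"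
      using bop hardy_in_H2 unfolding H2_bounded_operator_def by blast
    then show ?thesis by (simp add: hardy_add[symmetric] A)
  qed
  have A_scaleC: "A (scaleC c x) = scaleC c (A x)" for c x
  proof -
    have "B (\<lambda>z. c * hardy x z) = (\<lambda>z. c * B (hardy x) z)"
      using bop hardy_in_H2 unfolding H2_bounded_operator_def by blast
    then show ?thesis by (simp add: hardy_scaleC[symmetric] A)
  qed
  obtain C where "\<And>f. f \<in> H2 \<Longrightarrow> H2_norm (B f) \<le> C * H2_norm f"
    using bop unfolding H2_bounded_operator_def by blast
  then have C: "norm (A x) \<le> norm x * C" for x
    using hardy_in_H2[of x] by (metis A H2_norm_hardy mult.commute)
  have blA: "bounded_linear A"
    by (rule bounded_linear_intro[OF A_add _ C]) (metis A_scaleC scaleC_real)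
  have "H2_inner (B (hardy x)) (hardy x) \<in> \<real>\<^sub>\<ge>\<^sub>0" for x
    using pos hardy_in_H2 unfolding H2_positive_operator_def by blast
  then have "Im (cinner (A x) x) = 0" for x
    by (simp add: A H2_inner_hardy complex_nonneg_Reals_iff)
  then have symA: "inner (A x) y = inner x (A y)" for x y
    by (intro symmetric_if_positive A_add A_scaleC)
  have AA: "A (A v) = v - (1/4) *\<^sub>R (v + S v + S' v + S (S' v))" for v
    using BB[of v] by (simp add: A X_def)
  have fix0: "\<forall>u. S u = u \<longrightarrow> u = 0" using S_fixed_point by blast
  note dec = sqrt_range_decomposition[OF blA bounded_linear_S S'(1) symA S'(2,3) fix0 AA]
  have A0: "A 0 = 0" by (rule linear_0[OF bounded_linear.linear[OF blA]])
  have space: "dBR_space b = {hardy ((1/2) *\<^sub>R (u - S u) + k) | u k. S' k = 0}"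
  proof -
    have "dBR_space b = hardy ` range A"
      unfolding dBR_space_def B_def[symmetric] H2_eq_range by (simp add: A image_image)
    also have "\<dots> = {hardy ((1/2) *\<^sub>R (u - S u) + k) | u k. S' k = 0}" unfolding dec(2) by blast
    finally show ?thesis .
  qed
  have "dBR_kernel b = {hardy 0}"
  proof -
    have "B f = (\<lambda>z. 0) \<longleftrightarrow> f = hardy 0" if f: "f \<in> H2" for f
    proof -
      obtain x where x: "f = hardy x" using H2_eq_hardy[OF f] by blast
      have "A x = 0 \<longleftrightarrow> x = 0" using dec(1) A0 by blast
      then show ?thesis unfolding x A hardy_0[symmetric] hardy_inject .
    qed
    then show ?thesis unfolding dBR_kernel_def B_def[symmetric] using hardy_in_H2 by auto
  qed
  \<comment> \<open>With trivial kernel the preimage in the definition of the inner product ranges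
    over all of \<open>H2\<close>, so it is the plain inverse of the operator.\<close>
  then have ominus: "H2_ominus (dBR_kernel b) = H2"
    unfolding H2_ominus_def by (auto elim!: H2_eq_hardy simp: H2_inner_hardy hardy_in_H2)
  have pre: "dBR_preimage b (hardy (A x)) = hardy x" for x
    unfolding dBR_preimage_def ominus B_def[symmetric]
  proof (rule the_equality)
    show "hardy x \<in> H2 \<and> B (hardy x) = hardy (A x)" by (simp add: A hardy_in_H2)
    fix f assume f: "f \<in> H2 \<and> B f = hardy (A x)"
    then obtain y where y: "f = hardy y" using H2_eq_hardy by blast
    have "A (y - x) = 0" using f linear_diff[OF bounded_linear.linear[OF blA]] by (simp add: y A)
    then show "f = hardy x" using dec(1)[of "y - x"] by (simp add: y)
  qed
  have range: "\<exists>x. A x = (1/2) *\<^sub>R (u - S u) + k" if k: "S' k = 0" for u k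
  proof -
    have "(1/2) *\<^sub>R (u - S u) + k \<in> range A" unfolding dec(2) using k by blast
    then obtain x where "(1/2) *\<^sub>R (u - S u) + k = A x" by (rule rangeE)
    then show ?thesis by (intro exI[of _ x]) (rule sym)
  qed
  have S0: "S 0 = 0" by (rule linear_0[OF bounded_linear.linear[OF bounded_linear_S]])
  have S'0: "S' 0 = 0" by (rule linear_0[OF bounded_linear.linear[OF S'(1)]])
  show ?thesis
    unfolding orthogonal_direct_sum_def mult_range_a model_space_eq space
  proof (intro conjI ballI)
    show "{hardy ((1/2) *\<^sub>R (u - S u) + k) | u k. S' k = 0} =
      {(\<lambda>z. u z + v z) | u v. u \<in> {hardy ((1/2) *\<^sub>R (u - S u)) | u. True} \<and> v \<in> {hardy k | k. S' k = 0}}"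
      (is "?L = ?R")
    proof (intro equalityI subsetI)
      fix f assume "f \<in> ?L"
      then obtain u k where "f = hardy ((1/2) *\<^sub>R (u - S u) + k)" "S' k = 0" by blast
      then show "f \<in> ?R" unfolding hardy_add by blast
    next
      fix f assume "f \<in> ?R"
      then obtain u k where "f = (\<lambda>z. hardy ((1/2) *\<^sub>R (u - S u)) z + hardy k z)" "S' k = 0" by blast
      then show "f \<in> ?L" unfolding hardy_add[symmetric] by blast
    qed
    show "{hardy ((1/2) *\<^sub>R (u - S u)) | u. True} \<inter> {hardy k | k. S' k = 0} = {\<lambda>z. 0}"
      (is "?L \<inter> ?R = _")
    proof (intro equalityI subsetI)
      fix f assume "f \<in> ?L \<inter> ?R"
      then obtain u k where f: "f = hardy ((1/2) *\<^sub>R (u - S u))" "f = hardy k" "S' k = 0" by blast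
      then have "(1/2) *\<^sub>R (u - S u) = k" by (simp only: hardy_inject)
      then have "k = 0" using f(3) by (rule dec(4))
      then show "f \<in> {\<lambda>z. 0}" using f(2) by (simp add: hardy_0)
    next
      fix f :: "complex \<Rightarrow> complex" assume "f \<in> {\<lambda>z. 0}"
      then have f: "f = hardy 0" by (simp add: hardy_0)
      have "f = hardy ((1/2) *\<^sub>R (0 - S 0))" by (simp add: S0 f)
      then have "f \<in> ?L" by blast
      moreover have "f \<in> ?R" using f S'0 by blast
      ultimately show "f \<in> ?L \<inter> ?R" by blast
    qed
    fix f g assume "f \<in> {hardy ((1/2) *\<^sub>R (u - S u)) | u. True}" "g \<in> {hardy k | k. S' k = 0}"
    then obtain u k where uk: "f = hardy ((1/2) *\<^sub>R (u - S u))" "g = hardy k" "S' k = 0" by blast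
    obtain x where x: "A x = (1/2) *\<^sub>R (u - S u)" using range[OF S'0, of u] by auto
    obtain y where y: "A y = k" using range[OF uk(3), of 0] by (auto simp: S0)
    have "inner x y = 0" by (rule dec(3)[OF x y uk(3)])
    \<comment> \<open>The model space is stable under multiplication by i, so real orthogonality
      applied to i y and i k also removes the imaginary part.\<close>
    moreover have "inner x (scaleC \<i> y) = 0"
    proof (rule dec(3)[OF x])
      show "A (scaleC \<i> y) = scaleC \<i> k" by (simp add: A_scaleC y)
      show "S' (scaleC \<i> k) = 0" by (rule l2_eqI) (simp add: S'_scaleC uk(3))
    qed
    ultimately have "cinner x y = 0" by (simp add: cinner_eq_inner complex_eq_iff)
    then show "dBR_inner b f g = 0"
      unfolding dBR_inner_def uk(1,2) x[symmetric] y[symmetric] pre by (simp add: H2_inner_hardy)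
  qed
qed

end

theorem theorem5p17:
  fixes I a b :: "complex \<Rightarrow> complex"
  assumes "inner_function I"
    and "I 0 = 0"
    and "a = (\<lambda>z. (1 - I z) / 2)"
    and "b = (\<lambda>z. (1 + I z) / 2)"
  shows "orthogonal_direct_sum (dBR_inner b) (dBR_space b) (mult_range a) (model_space I)"
  unfolding assms(3) by (rule inner_mult.decomposition[OF inner_mult.intro[OF assms(1,2)] assms(4)])

end
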